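(* Let $\mathcal{N}_{A\to B}$ be a nonzero completely positive linear map (not necessarily trace preserving) and let $\varepsilon\in(0,1)$. Then the one-shot retrocausal quantum capacity of $\mathcal{N}$ within infidelity $\varepsilon$ satisfies $$Q_{\mathrm{retro}}^{\varepsilon}(\mathcal{N})=\log_2\left\lfloor\sqrt{\frac{\varepsilon}{1-\varepsilon}\,2^{I_{\max}(\mathcal{N})+I_{\mathrm{doe}}(\mathcal{N})}+1}\right\rfloor .$$
   Context: All quantum systems are finite-dimensional Hilbert spaces; $d_A\geq 1$ denotes the dimension of system $A$. A state is a positive semidefinite unit-trace operator; $\mathcal{D}_B$ is the set of states of $B$ and $\mathrm{aff}(\mathcal{D}_B)$ is the set of unit-trace Hermitian operators on $B$. A channel is a completely positive trace-preserving linear map. Maps act as the identity on systems not listed in their subscript. Primed systems are isomorphic copies ($A'\cong A$). $\Phi_{AA'}=\frac{1}{d_A}\sum_{i,j}|i\rangle\langle j|_A\otimes|i\rangle\langle j|_{A'}$ is the standard maximally entangled state, and $\pi_A=\mathbb{1}_A/d_A$. For a linear map $\mathcal{N}_{A\to B}$ its Choi operator is $\Phi^{\mathcal{N}}_{A'B}=\mathcal{N}_{A\to B}[\Phi_{A'A}]$. Max-information and Doeblin information of a completely positive map (operator inequalities in the Loewner order, $\inf\emptyset=+\infty$): $$I_{\max}(\mathcal{N})=\inf_{\lambda\in\mathbb{R},\,\sigma_B\in\mathcal{D}_B}\{\log_2\lambda:\Phi^{\mathcal{N}}_{A'B}\leq\lambda\,\pi_{A'}\otimes\sigma_B\},\qquad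 I_{\mathrm{doe}}(\mathcal{N})=\inf_{\lambda\in\mathbb{R},\,\tau_B\in\mathrm{aff}(\mathcal{D}_B)}\{\log_2\lambda:\pi_{A'}\otimes\tau_B\leq\lambda\,\Phi^{\mathcal{N}}_{A'B}\}.$$ $I_{\mathrm{doe}}$ may equal $+\infty$; conventions: $2^{\infty}=\lfloor\infty\rfloor=\log_2\infty=\infty$. Loop supermap: for a linear map $\mathcal{T}_{EA\to FA}$ and an operator $\rho_{RE}$ ($R$ any reference system), $\Gamma_A\{\mathcal{T}_{EA\to FA}\}[\rho_{RE}]=\mathrm{Tr}_{AA'}\big[\Phi_{AA'}\,\mathcal{T}_{EA\to FA}[\rho_{RE}\otimes\Phi_{AA'}]\big]$. Retrocausal communication: a strategy is a pair of channels $(\mathcal{E}_{ML\to A},\mathcal{D}_{B\to\widehat{M}L})$ with $\widehat{M}\cong M$ and $L$ an arbitrary system. Write $\mathcal{G}_{M\to\widehat{M}}=\Gamma_A\{\mathcal{E}_{ML\to A}\circ\mathcal{D}_{B\to\widehat{M}L}\circ\mathcal{N}_{A\to B}\}$, where the composition is viewed as a map from $MA$ to $\widehat{M}A$. The worst-case quantum infidelity is $$q_{\mathrm{infid}}((\mathcal{E},\mathcal{D}),\mathcal{N})=1-\inf_{\psi_{RM}}\frac{\mathrm{Tr}\big[\psi_{R\widehat{M}}\,\mathcal{G}[\psi_{RM}]\big]}{\mathrm{Tr}\big[\mathcal{G}[\psi_{RM}]\big]},$$ the infimum being over all dimensions $d_R$ and all pure states $\psi_{RM}$, where $\psi_{R\widehat{M}}$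 is $\psi_{RM}$ with $M$ identified with $\widehat{M}$. Only strategies for which all these denominators are nonzero are considered. The one-shot retrocausal quantum capacity is $$Q_{\mathrm{retro}}^{\varepsilon}(\mathcal{N})=\sup\{\log_2 d_M: q_{\mathrm{infid}}((\mathcal{E}_{ML\to A},\mathcal{D}_{B\to\widehat{M}L}),\mathcal{N}_{A\to B})\leq\varepsilon\},$$ the supremum being over all positive integers $d_M,d_L$ and all strategies. *)

theory Defs
  imports "Jordan_Normal_Form.Schur_Decomposition" "HOL-Library.Extended_Real"
begin

text \<open>
  A system of dimension \<open>d\<close> is represented by the standard basis indices \<open>0, \<dots>, d - 1\<close>, operators
  on it are matrices in \<open>carrier_mat d d\<close>, and composite systems use the lexicographic (Kronecker)
  ordering: the basis vector \<open>|a\<rangle> \<otimes> |b\<rangle>\<close> of a system of dimension \<open>dA * dB\<close> has index \<open>a * dB + b\<close>.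
  Maps on operators are functions whose values outside the relevant carrier are irrelevant.
\<close>

subsection \<open>Operators\<close>

definition mtrace :: "complex mat \<Rightarrow> complex" where
  "mtrace X = (\<Sum>i<dim_row X. X $$ (i, i))"

definition hermitian_op :: "nat \<Rightarrow> complex mat \<Rightarrow> bool" where
  "hermitian_op d X \<longleftrightarrow> X \<in> carrier_mat d d \<and> mat_adjoint X = X"

text \<open>In the order on \<^typ>\<open>complex\<close>, \<open>0 \<le> z\<close> means that \<open>z\<close> is real and nonnegative.\<close>

definition psd :: "nat \<Rightarrow> complex mat \<Rightarrow> bool" where
  "psd d X \<longleftrightarrow> hermitian_op d X \<and> (\<forall>v \<in> carrier_vec d. 0 \<le> (X *\<^sub>v v) \<bullet>c v)"

definition loewner_le :: "nat \<Rightarrow> complex mat \<Rightarrow> complex mat \<Rightarrow> bool" where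
  "loewner_le d X Y \<longleftrightarrow> X \<in> carrier_mat d d \<and> Y \<in> carrier_mat d d \<and> psd d (Y - X)"

definition state :: "nat \<Rightarrow> complex mat \<Rightarrow> bool" where
  "state d \<rho> \<longleftrightarrow> psd d \<rho> \<and> mtrace \<rho> = 1"

definition aff_state :: "nat \<Rightarrow> complex mat \<Rightarrow> bool" where
  "aff_state d \<tau> \<longleftrightarrow> hermitian_op d \<tau> \<and> mtrace \<tau> = 1"

definition pure_state :: "nat \<Rightarrow> complex mat \<Rightarrow> bool" where
  "pure_state d \<psi> \<longleftrightarrow>
     (\<exists>v \<in> carrier_vec d. v \<bullet>c v = 1 \<and> \<psi> = mat d d (\<lambda>(i, j). v $ i * conjugate (v $ j)))"

definition kron :: "complex mat \<Rightarrow> complex mat \<Rightarrow> complex mat" where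
  "kron X Y = mat (dim_row X * dim_row Y) (dim_col X * dim_col Y)
     (\<lambda>(i, j). X $$ (i div dim_row Y, j div dim_col Y) * Y $$ (i mod dim_row Y, j mod dim_col Y))"

definition max_mixed :: "nat \<Rightarrow> complex mat" where
  "max_mixed d = (1 / of_nat d) \<cdot>\<^sub>m 1\<^sub>m d"

text \<open>\<open>max_ent d\<close> is \<open>(1/d) \<Sum>i j. |i\<rangle>\<langle>j| \<otimes> |i\<rangle>\<langle>j|\<close>.\<close>

definition max_ent :: "nat \<Rightarrow> complex mat" where
  "max_ent d = mat (d * d) (d * d)
     (\<lambda>(i, j). if i div d = i mod d \<and> j div d = j mod d then 1 / of_nat d else 0)"

text \<open>Partial trace over the second factor of a system of dimension \<open>n * m\<close>.\<close>

definition ptrace_snd :: "nat \<Rightarrow> nat \<Rightarrow> complex mat \<Rightarrow> complex mat" where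
  "ptrace_snd n m X = mat n n (\<lambda>(i, j). \<Sum>k<m. X $$ (i * m + k, j * m + k))"

text \<open>Relabelling of a system of dimension \<open>d1 * d2 * d3\<close> as one of dimension \<open>d2 * d1 * d3\<close>,
  that is \<open>X \<otimes> Y \<otimes> Z \<mapsto> Y \<otimes> X \<otimes> Z\<close>.\<close>

definition swap_systems :: "nat \<Rightarrow> nat \<Rightarrow> nat \<Rightarrow> complex mat \<Rightarrow> complex mat" where
  "swap_systems d1 d2 d3 X =
     (let s = (\<lambda>i. (((i div d3) mod d1) * d2 + i div (d1 * d3)) * d3 + i mod d3)
      in mat (d2 * d1 * d3) (d2 * d1 * d3) (\<lambda>(i, j). X $$ (s i, s j)))"

subsection \<open>Linear maps and channels\<close>

definition linear_op_map :: "nat \<Rightarrow> nat \<Rightarrow> (complex mat \<Rightarrow> complex mat) \<Rightarrow> bool" where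
  "linear_op_map din dout T \<longleftrightarrow>
     (\<forall>X \<in> carrier_mat din din. T X \<in> carrier_mat dout dout) \<and>
     (\<forall>X \<in> carrier_mat din din. \<forall>Y \<in> carrier_mat din din. T (X + Y) = T X + T Y) \<and>
     (\<forall>c. \<forall>X \<in> carrier_mat din din. T (c \<cdot>\<^sub>m X) = c \<cdot>\<^sub>m T X)"

text \<open>\<open>amplify k din dout m T\<close> is \<open>id\<^sub>k \<otimes> T \<otimes> id\<^sub>m\<close>: \<open>T\<close> is applied to every \<open>din \<times> din\<close> block obtained
  by fixing the row and column indices of the outer two factors.\<close>

definition amplify ::
  "nat \<Rightarrow> nat \<Rightarrow> nat \<Rightarrow> nat \<Rightarrow> (complex mat \<Rightarrow> complex mat) \<Rightarrow> complex mat \<Rightarrow> complex mat" where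
  "amplify k din dout m T X = mat (k * dout * m) (k * dout * m)
     (\<lambda>(i, j).
        T (mat din din (\<lambda>(a, b). X $$ (((i div (dout * m)) * din + a) * m + i mod m,
                                        ((j div (dout * m)) * din + b) * m + j mod m)))
          $$ ((i div m) mod dout, (j div m) mod dout))"

definition cp_map :: "nat \<Rightarrow> nat \<Rightarrow> (complex mat \<Rightarrow> complex mat) \<Rightarrow> bool" where
  "cp_map din dout T \<longleftrightarrow> linear_op_map din dout T \<and>
     (\<forall>k X. psd (k * din) X \<longrightarrow> psd (k * dout) (amplify k din dout 1 T X))"

definition channel :: "nat \<Rightarrow> nat \<Rightarrow> (complex mat \<Rightarrow> complex mat) \<Rightarrow> bool" where
  "channel din dout T \<longleftrightarrow> cp_map din dout T \<and>
     (\<forall>X \<in> carrier_mat din din. mtrace (T X) = mtrace X)"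

definition choi :: "nat \<Rightarrow> nat \<Rightarrow> (complex mat \<Rightarrow> complex mat) \<Rightarrow> complex mat" where
  "choi dA dB N = amplify dA dA dB 1 N (max_ent dA)"

subsection \<open>Extended real functions\<close>

definition elog2 :: "ereal \<Rightarrow> ereal" where
  "elog2 x = (case x of ereal r \<Rightarrow> if r \<le> 0 then -\<infinity> else ereal (log 2 r) | PInfty \<Rightarrow> \<infinity> | MInfty \<Rightarrow> -\<infinity>)"

definition epow2 :: "ereal \<Rightarrow> ereal" where
  "epow2 x = (case x of ereal r \<Rightarrow> ereal (2 powr r) | PInfty \<Rightarrow> \<infinity> | MInfty \<Rightarrow> 0)"

definition esqrt :: "ereal \<Rightarrow> ereal" where
  "esqrt x = (case x of ereal r \<Rightarrow> ereal (sqrt r) | PInfty \<Rightarrow> \<infinity> | MInfty \<Rightarrow> -\<infinity>)"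

definition efloor :: "ereal \<Rightarrow> ereal" where
  "efloor x = (case x of ereal r \<Rightarrow> ereal (of_int \<lfloor>r\<rfloor>) | PInfty \<Rightarrow> \<infinity> | MInfty \<Rightarrow> -\<infinity>)"

subsection \<open>Max-information and Doeblin information\<close>

definition I_max :: "nat \<Rightarrow> nat \<Rightarrow> (complex mat \<Rightarrow> complex mat) \<Rightarrow> ereal" where
  "I_max dA dB N = Inf {elog2 (ereal l) | (l :: real) \<sigma>. state dB \<sigma> \<and>
     loewner_le (dA * dB) (choi dA dB N) (complex_of_real l \<cdot>\<^sub>m kron (max_mixed dA) \<sigma>)}"

definition I_doe :: "nat \<Rightarrow> nat \<Rightarrow> (complex mat \<Rightarrow> complex mat) \<Rightarrow> ereal" where
  "I_doe dA dB N = Inf {elog2 (ereal l) | (l :: real) \<tau>. aff_state dB \<tau> \<and>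
     loewner_le (dA * dB) (kron (max_mixed dA) \<tau>) (complex_of_real l \<cdot>\<^sub>m choi dA dB N)}"

subsection \<open>Retrocausal communication\<close>

text \<open>\<open>loop dR dE dF dA T\<close> is the map on operators of \<open>RE\<close> obtained by looping the system \<open>A\<close> of
  \<open>T : EA \<rightarrow> FA\<close>. The systems are ordered \<open>R E A A'\<close> before and \<open>R F A A'\<close> after \<open>T\<close>.\<close>

definition loop ::
  "nat \<Rightarrow> nat \<Rightarrow> nat \<Rightarrow> nat \<Rightarrow> (complex mat \<Rightarrow> complex mat) \<Rightarrow> complex mat \<Rightarrow> complex mat" where
  "loop dR dE dF dA T \<rho> = ptrace_snd (dR * dF) (dA * dA)
     (kron (1\<^sub>m (dR * dF)) (max_ent dA) *
      amplify dR (dE * dA) (dF * dA) dA T (kron \<rho> (max_ent dA)))"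

text \<open>The composition of \<open>E : ML \<rightarrow> A\<close>, \<open>D : B \<rightarrow> M'L\<close> and \<open>N : A \<rightarrow> B\<close> as a map \<open>MA \<rightarrow> M'A\<close>, where
  \<open>M'\<close> is the output copy of \<open>M\<close>. The systems are successively \<open>MA\<close>, \<open>MB\<close>, \<open>MM'L\<close>, \<open>M'ML\<close>, \<open>M'A\<close>.\<close>

definition strategy_map ::
  "nat \<Rightarrow> nat \<Rightarrow> nat \<Rightarrow> nat \<Rightarrow> (complex mat \<Rightarrow> complex mat) \<Rightarrow> (complex mat \<Rightarrow> complex mat) \<Rightarrow>
   (complex mat \<Rightarrow> complex mat) \<Rightarrow> complex mat \<Rightarrow> complex mat" where
  "strategy_map dM dL dA dB E D N X =
     amplify dM (dM * dL) dA 1 E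
       (swap_systems dM dM dL
         (amplify dM dB (dM * dL) 1 D
           (amplify dM dA dB 1 N X)))"

text \<open>The action of the effective map \<open>M \<rightarrow> M'\<close> on operators of \<open>RM\<close>, with \<open>R\<close> of dimension \<open>dR\<close>.\<close>

definition retro_map ::
  "nat \<Rightarrow> nat \<Rightarrow> nat \<Rightarrow> nat \<Rightarrow> (complex mat \<Rightarrow> complex mat) \<Rightarrow> (complex mat \<Rightarrow> complex mat) \<Rightarrow>
   (complex mat \<Rightarrow> complex mat) \<Rightarrow> nat \<Rightarrow> complex mat \<Rightarrow> complex mat" where
  "retro_map dM dL dA dB E D N dR = loop dR dM dM dA (strategy_map dM dL dA dB E D N)"

definition admissible_strategy ::
  "nat \<Rightarrow> nat \<Rightarrow> nat \<Rightarrow> nat \<Rightarrow> (complex mat \<Rightarrow> complex mat) \<Rightarrow> (complex mat \<Rightarrow> complex mat) \<Rightarrow>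
   (complex mat \<Rightarrow> complex mat) \<Rightarrow> bool" where
  "admissible_strategy dM dL dA dB E D N \<longleftrightarrow>
     channel (dM * dL) dA E \<and> channel dB (dM * dL) D \<and>
     (\<forall>dR \<psi>. dR \<ge> 1 \<and> pure_state (dR * dM) \<psi> \<longrightarrow>
        mtrace (retro_map dM dL dA dB E D N dR \<psi>) \<noteq> 0)"

text \<open>For an admissible strategy and completely positive \<open>N\<close> both traces are nonnegative reals, so
  \<^const>\<open>Re\<close> only converts the type of the quotient.\<close>

definition q_infid ::
  "nat \<Rightarrow> nat \<Rightarrow> nat \<Rightarrow> nat \<Rightarrow> (complex mat \<Rightarrow> complex mat) \<Rightarrow> (complex mat \<Rightarrow> complex mat) \<Rightarrow>
   (complex mat \<Rightarrow> complex mat) \<Rightarrow> real" where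
  "q_infid dM dL dA dB E D N = 1 -
     Inf {Re (mtrace (\<psi> * retro_map dM dL dA dB E D N dR \<psi>) /
              mtrace (retro_map dM dL dA dB E D N dR \<psi>))
          | dR \<psi>. dR \<ge> 1 \<and> pure_state (dR * dM) \<psi>}"

definition Q_retro :: "real \<Rightarrow> nat \<Rightarrow> nat \<Rightarrow> (complex mat \<Rightarrow> complex mat) \<Rightarrow> ereal" where
  "Q_retro \<epsilon> dA dB N = Sup {ereal (log 2 (real dM)) | dM dL E D.
     dM \<ge> 1 \<and> dL \<ge> 1 \<and> admissible_strategy dM dL dA dB E D N \<and>
     q_infid dM dL dA dB E D N \<le> \<epsilon>}"

end

(*
  Writing J for the Choi operator, the loop turns a strategy into a map that is linear and positive in J.
  For the maximally entangled input, J = pi (x) sigma gives fidelity weight 1/dM^2 relative to its trace,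
  so J <= lam pi (x) sigma bounds the weight of success by lam/dM^2 and pi (x) tau <= mu J bounds the weight
  of failure below by (1 - 1/dM^2)/mu; together dM^2 - 1 <= eps/(1 - eps) lam mu.
  Conversely, the optimal values of the two programs are attained by their duals, the maximum p1 and minimum
  p2 of Tr[J X] over Choi operators X of channels from B to A.
  Teleporting the message through the loop and looping A with the maximising channel when the
  teleportation succeeds, with the minimising one when it fails, gives success and failure weights
  in the ratio p1 : p2 (dM^2 - 1).
*)
theory Submission
  imports Defs "HOL-Analysis.Function_Topology" "HOL-Analysis.Topology_Euclidean_Space" "HOL-Analysis.Convex"
begin

unbundle no vec_syntax
hide_const (open) Finite_Cartesian_Product.mat Finite_Cartesian_Product.vec
hide_type (open) Finite_Cartesian_Product.vec

subsection \<open>Positive semidefinite kernels\<close>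

text \<open>The duality argument shapes the development. The constraint Tr_A X = 1 is first relaxed
  to Tr_A X <= 1: the relaxed set is compact, so an optimum exists, and it tolerates the
  perturbation from which the dual solution is read off. Filling up the marginal afterwards never
  lowers the pairing with a positive J. The minimum is the maximum for c 1 - J; here the equality
  Tr_A X = 1 matters, since it makes the pairing with c 1 constant. Gram decompositions take the
  place of spectral theory: they supply positivity, Kraus operators and the entry bounds behind
  compactness. The common currency of both directions is the family of vectors \<open>eff\<close>,
  one for each pair of Kraus operators and pair of messages: the effective map sees N only through
  the sesquilinear form of its Choi kernel at these vectors. In the converse J may therefore be
  replaced by differences such as \<mu> J - \<pi> (x) \<tau>; in the construction the loop weights
  become pairings. The two informations enter through one-sided bounds: dual feasibility bounds them
  above, and the converse holds for every pair of feasible values.\<close>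

definition qform :: "'a set \<Rightarrow> ('a \<Rightarrow> 'a \<Rightarrow> complex) \<Rightarrow> ('a \<Rightarrow> complex) \<Rightarrow> complex" where
  "qform S f v = (\<Sum>x\<in>S. \<Sum>y\<in>S. cnj (v x) * f x y * v y)"

text \<open>The sign condition is put on the real part; that the form is real is recovered in
  \<open>psd_on_qform_real\<close>. Index sets are arbitrary, so that a bipartite system can be
  indexed by pairs instead of the integer encoding of composite matrices.\<close>

definition psd_on :: "'a set \<Rightarrow> ('a \<Rightarrow> 'a \<Rightarrow> complex) \<Rightarrow> bool" where
  "psd_on S f \<longleftrightarrow> (\<forall>x\<in>S. \<forall>y\<in>S. f y x = cnj (f x y)) \<and> (\<forall>v. 0 \<le> Re (qform S f v))"

definition bform :: "'a set \<Rightarrow> ('a \<Rightarrow> 'a \<Rightarrow> complex) \<Rightarrow> ('a \<Rightarrow> complex) \<Rightarrow> ('a \<Rightarrow> complex) \<Rightarrow> complex" where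
  "bform S f v w = (\<Sum>x\<in>S. \<Sum>y\<in>S. cnj (v x) * f x y * w y)"

lemma qform_bform: "qform S f v = bform S f v v"
  by (simp add: qform_def bform_def)

lemma bform_gram:
  assumes "\<And>x y. x \<in> S \<Longrightarrow> y \<in> S \<Longrightarrow> f x y = (\<Sum>k\<in>K. u k x * cnj (u k y))"
  shows "bform S f v w = (\<Sum>k\<in>K. (\<Sum>x\<in>S. cnj (v x) * u k x) * cnj (\<Sum>y\<in>S. cnj (w y) * u k y))"
proof -
  have "bform S f v w = (\<Sum>x\<in>S. \<Sum>y\<in>S. \<Sum>k\<in>K. (cnj (v x) * u k x) * cnj (cnj (w y) * u k y))"
    unfolding bform_def
    by (intro sum.cong refl) (simp add: assms sum_distrib_left sum_distrib_right mult_ac)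
  also have "\<dots> = (\<Sum>x\<in>S. \<Sum>k\<in>K. \<Sum>y\<in>S. (cnj (v x) * u k x) * cnj (cnj (w y) * u k y))"
    by (intro sum.cong refl) (rule sum.swap)
  also have "\<dots> = (\<Sum>k\<in>K. \<Sum>x\<in>S. \<Sum>y\<in>S. (cnj (v x) * u k x) * cnj (cnj (w y) * u k y))"
    by (rule sum.swap)
  finally show ?thesis by (simp only: sum_product cnj_sum)
qed

lemma qform_gram:
  assumes "\<And>x y. x \<in> S \<Longrightarrow> y \<in> S \<Longrightarrow> f x y = (\<Sum>k\<in>K. u k x * cnj (u k y))"
  shows "qform S f v = (\<Sum>k\<in>K. complex_of_real ((cmod (\<Sum>x\<in>S. cnj (v x) * u k x))\<^sup>2))"
  unfolding qform_bform complex_norm_square by (rule bform_gram) (rule assms)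

lemma psd_on_gram:
  assumes "\<And>x y. x \<in> S \<Longrightarrow> y \<in> S \<Longrightarrow> f x y = (\<Sum>k\<in>K. u k x * cnj (u k y))"
  shows "psd_on S f"
proof -
  have "f y x = cnj (f x y)" if "x \<in> S" "y \<in> S" for x y
    using that by (simp add: assms mult.commute)
  moreover have "0 \<le> Re (qform S f v)" for v
    by (simp add: qform_gram[OF assms] sum_nonneg)
  ultimately show ?thesis
    unfolding psd_on_def by blast
qed

lemma qform_single:
  assumes "finite S" "a \<in> S"
  shows "qform S f (\<lambda>x. if x = a then 1 else 0) = f a a"
proof -
  have *: "(\<Sum>y\<in>S. cnj (if x = a then 1 else 0) * f x y * (if y = a then 1 else 0))
      = (if x = a then f x a else 0)" for x
  proof -
    have "(\<Sum>y\<in>S. cnj (if x = a then 1 else 0) * f x y * (if y = a then 1 else 0))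
        = (\<Sum>y\<in>S. if y = a then (if x = a then f x a else 0) else 0)"
      by (rule sum.cong) (simp_all split: if_split)
    then show ?thesis using assms by simp
  qed
  show ?thesis unfolding qform_def * using assms by simp
qed

lemma psd_on_diag:
  assumes "finite S" "psd_on S f" "a \<in> S"
  shows "f a a = complex_of_real (Re (f a a))" "0 \<le> Re (f a a)"
proof -
  have "f a a = cnj (f a a)"
    using assms(2,3) unfolding psd_on_def by blast
  then show "f a a = complex_of_real (Re (f a a))"
    by (metis Reals_cnj_iff of_real_Re)
  have "0 \<le> Re (qform S f (\<lambda>x. if x = a then 1 else 0))"
    using assms(2) unfolding psd_on_def by blast
  then show "0 \<le> Re (f a a)"
    unfolding qform_single[OF assms(1,3)] .
qed

lemma qform_insert:
  assumes "finite T" "a \<notin> T"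
  shows "qform (insert a T) f v = qform T f v + cnj (v a) * f a a * v a
    + cnj (v a) * (\<Sum>y\<in>T. f a y * v y) + (\<Sum>x\<in>T. cnj (v x) * f x a) * v a"
  unfolding qform_def using assms
  by (simp add: sum.distrib sum_distrib_left sum_distrib_right mult.assoc)

lemma qform_cong:
  assumes "\<And>x y. x \<in> S \<Longrightarrow> y \<in> S \<Longrightarrow> f x y = g x y" "\<And>x. x \<in> S \<Longrightarrow> v x = w x"
  shows "qform S f v = qform S g w"
  unfolding qform_def using assms by (intro sum.cong refl) auto

lemma psd_on_cong:
  assumes "\<And>x y. x \<in> S \<Longrightarrow> y \<in> S \<Longrightarrow> f x y = g x y"
  shows "psd_on S f \<longleftrightarrow> psd_on S g"
proof -
  have "qform S f v = qform S g v" for v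
    by (rule qform_cong) (use assms in auto)
  moreover have "(f y x = cnj (f x y)) = (g y x = cnj (g x y))" if "x \<in> S" "y \<in> S" for x y
    using assms that by simp
  ultimately show ?thesis
    unfolding psd_on_def by (metis (no_types))
qed

lemma psd_on_subset:
  assumes "finite S" "psd_on S f" "T \<subseteq> S"
  shows "psd_on T f"
proof -
  have "qform T f v = qform S f (\<lambda>x. if x \<in> T then v x else 0)" for v
  proof -
    have "qform S f (\<lambda>x. if x \<in> T then v x else 0)
        = (\<Sum>x\<in>S. if x \<in> T then (\<Sum>y\<in>S. if y \<in> T then cnj (v x) * f x y * v y else 0) else 0)"
      unfolding qform_def
    proof (rule sum.cong[OF refl])
      fix x
      show "(\<Sum>y\<in>S. cnj (if x \<in> T then v x else 0) * f x y * (if y \<in> T then v y else 0))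
          = (if x \<in> T then \<Sum>y\<in>S. if y \<in> T then cnj (v x) * f x y * v y else 0 else 0)"
        by (cases "x \<in> T") (auto intro: sum.cong)
    qed
    also have "\<dots> = qform T f v"
      using assms by (simp add: qform_def sum.inter_restrict[symmetric] inf_absorb2)
    finally show ?thesis by simp
  qed
  then show ?thesis
    using assms unfolding psd_on_def by (metis (no_types) subsetD)
qed

text \<open>Cholesky decomposition; the induction step passes to the Schur complement.\<close>

lemma psd_on_obtain_gram:
  assumes "finite S" "psd_on S f"
  shows "\<exists>u. \<forall>x\<in>S. \<forall>y\<in>S. f x y = (\<Sum>k\<in>S. u k x * cnj (u k y))"
  using assms
proof (induction S arbitrary: f rule: finite_induct)
  case empty
  then show ?case by simp
next
  case (insert a T)
  let ?S = "insert a T"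
  have fin: "finite ?S" using insert by simp
  note psd = insert.prems
  have herm: "f y x = cnj (f x y)" if "x \<in> ?S" "y \<in> ?S" for x y
    using psd that unfolding psd_on_def by blast
  have nn: "0 \<le> Re (qform ?S f v)" for v
    using psd unfolding psd_on_def by blast
  define c where "c = Re (f a a)"
  have c: "f a a = complex_of_real c" "c \<ge> 0"
    unfolding c_def using psd_on_diag[OF fin psd, of a] by blast+
  have zero: "f a y = 0" if "c = 0" "y \<in> T" for y
  proof (rule ccontr)
    assume "f a y \<noteq> 0"
    \<comment> \<open>At the vector e_y + t f(a,y) e_a the form equals f(y,y) + 2 t |f(a,y)|^2,
      because f(a,a) = 0; this t makes its real part -1.\<close>
    define t where "t = - (Re (f y y) + 1) / (2 * (cmod (f a y))\<^sup>2)"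
    have ya: "y \<noteq> a" using insert that by auto
    let ?v = "\<lambda>x. if x = y then 1 else if x = a then complex_of_real t * f a y else 0"
    have 1: "qform T f ?v = f y y"
    proof -
      have "qform T f ?v = qform T f (\<lambda>x. if x = y then 1 else 0)"
        by (rule qform_cong) (use insert in auto)
      also have "\<dots> = f y y" using insert that by (simp add: qform_single)
      finally show ?thesis .
    qed
    have 2: "(\<Sum>x\<in>T. f a x * ?v x) = f a y"
    proof -
      have "(\<Sum>x\<in>T. f a x * ?v x) = (\<Sum>x\<in>T. if x = y then f a y else 0)"
        by (intro sum.cong) (use insert in auto)
      then show ?thesis using insert that by simp
    qed
    have 3: "(\<Sum>x\<in>T. cnj (?v x) * f x a) = f y a"
    proof -
      have "(\<Sum>x\<in>T. cnj (?v x) * f x a) = (\<Sum>x\<in>T. if x = y then f y a else 0)"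
        by (intro sum.cong) (use insert in auto)
      then show ?thesis using insert that by simp
    qed
    have va: "?v a = complex_of_real t * f a y" using ya by simp
    have "qform ?S f ?v = f y y + 2 * complex_of_real t * (f a y * cnj (f a y))"
      unfolding qform_insert[OF insert(1,2)] 1 2 3 va
      using c that herm[of a y] by (simp add: algebra_simps)
    also have "f a y * cnj (f a y) = complex_of_real ((cmod (f a y))\<^sup>2)"
      by (simp add: complex_norm_square del: of_real_power)
    finally have "Re (qform ?S f ?v) = Re (f y y) + 2 * t * (cmod (f a y))\<^sup>2"
      by (simp del: of_real_power)
    also have "\<dots> = - 1"
      unfolding t_def using \<open>f a y \<noteq> 0\<close> by (simp add: field_simps)
    finally show False using nn[of ?v] by simp
  qed
  show ?case
  proof (cases "c = 0")
    case True
    have "psd_on T f"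
      using psd_on_subset[OF fin psd] by blast
    then obtain u where u: "\<And>x y. x \<in> T \<Longrightarrow> y \<in> T \<Longrightarrow> f x y = (\<Sum>k\<in>T. u k x * cnj (u k y))"
      using insert.IH by blast
    define w where "w = (\<lambda>k x. if k = a \<or> x = a then 0 else u k x)"
    have "f x y = (\<Sum>k\<in>?S. w k x * cnj (w k y))" if "x \<in> ?S" "y \<in> ?S" for x y
    proof (cases "x = a \<or> y = a")
      case T': True
      have "f x y = 0"
      proof (cases "x = a")
        case True
        then show ?thesis using zero[OF \<open>c = 0\<close>, of y] c \<open>c = 0\<close> that by auto
      next
        case False
        then have "f a x = 0" "y = a" using zero[OF \<open>c = 0\<close>, of x] T' that by auto
        then show ?thesis using herm[of a x] that by simp
      qed
      then show ?thesis using T' by (auto simp: w_def)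
    next
      case False
      then have "x \<in> T" "y \<in> T" using that by auto
      have "(\<Sum>k\<in>?S. w k x * cnj (w k y)) = (\<Sum>k\<in>T. w k x * cnj (w k y))"
        using insert by (simp add: w_def)
      also have "\<dots> = (\<Sum>k\<in>T. u k x * cnj (u k y))"
        by (intro sum.cong refl) (use False insert in \<open>auto simp: w_def\<close>)
      finally show ?thesis using u[OF \<open>x \<in> T\<close> \<open>y \<in> T\<close>] by simp
    qed
    then show ?thesis by blast
  next
    case False
    then have cpos: "c > 0" using c by simp
    define g where "g = (\<lambda>x y. f x y - f x a * f a y / complex_of_real c)"
    have "psd_on T g"
      unfolding psd_on_def
    proof (intro conjI ballI allI)
      fix x y assume "x \<in> T" "y \<in> T"
      then show "g y x = cnj (g x y)"
        using herm[of x y] herm[of x a] herm[of a y] by (simp add: g_def)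
    next
      fix v
      define \<beta> where "\<beta> = (\<Sum>y\<in>T. f a y * v y)"
      have b': "(\<Sum>x\<in>T. cnj (v x) * f x a) = cnj \<beta>"
        unfolding \<beta>_def cnj_sum by (intro sum.cong refl) (subst herm[of a], auto simp: mult.commute)
      \<comment> \<open>The entry -\<beta>/c at a minimises the form in that coordinate; completing
        the square leaves exactly the form of the Schur complement \<open>g\<close>.\<close>
      let ?v = "\<lambda>x. if x = a then - \<beta> / complex_of_real c else v x"
      have T: "x \<in> T \<Longrightarrow> x \<noteq> a" for x using insert by auto
      have 1: "qform T f ?v = qform T f v"
        by (rule qform_cong) (use T in auto)
      have 2: "(\<Sum>y\<in>T. f a y * ?v y) = \<beta>" "(\<Sum>x\<in>T. cnj (?v x) * f x a) = cnj \<beta>"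
        unfolding b'[symmetric] unfolding \<beta>_def by (intro sum.cong; use T in auto)+
      have "qform ?S f ?v = qform T f v - cnj \<beta> * \<beta> / complex_of_real c"
        unfolding qform_insert[OF insert(1,2)] 1 2 using cpos c
        by (simp add: field_simps)
      also have "\<dots> = qform T g v"
      proof -
        have "qform T g v = (\<Sum>x\<in>T. \<Sum>y\<in>T. cnj (v x) * f x y * v y
             - (cnj (v x) * f x a) * (f a y * v y) / complex_of_real c)"
          unfolding qform_def g_def by (intro sum.cong refl) (simp add: field_simps)
        also have "\<dots> = qform T f v - (\<Sum>x\<in>T. cnj (v x) * f x a) * \<beta> / complex_of_real c"
          unfolding qform_def \<beta>_def sum_subtractf sum_product sum_divide_distrib by simp
        finally show ?thesis unfolding b' by simp
      qed
      finally show "0 \<le> Re (qform T g v)" using nn[of ?v] by simp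
    qed
    then obtain u where u: "\<And>x y. x \<in> T \<Longrightarrow> y \<in> T \<Longrightarrow> g x y = (\<Sum>k\<in>T. u k x * cnj (u k y))"
      using insert.IH by blast
    \<comment> \<open>Column a of the triangular factor; its entry at a itself is sqrt c, since
      f(a,a) = c. The remaining columns vanish in row a.\<close>
    define w where "w = (\<lambda>k x. if k = a then f x a / complex_of_real (sqrt c) else if x = a then 0 else u k x)"
    have "f x y = (\<Sum>k\<in>?S. w k x * cnj (w k y))" if "x \<in> ?S" "y \<in> ?S" for x y
    proof -
      have sq: "complex_of_real (sqrt c) * complex_of_real (sqrt c) = complex_of_real c"
        unfolding of_real_mult[symmetric] using cpos by simp
      have a: "w a x * cnj (w a y) = f x a * f a y / complex_of_real c"
        using herm[of y a] that sq by (simp add: w_def)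
      have s: "(\<Sum>k\<in>?S. w k x * cnj (w k y)) = f x a * f a y / complex_of_real c + (\<Sum>k\<in>T. w k x * cnj (w k y))"
        using insert a by simp
      show ?thesis
      proof (cases "x = a \<or> y = a")
        case True
        have "(\<Sum>k\<in>T. w k x * cnj (w k y)) = 0"
          by (intro sum.neutral) (use True insert in \<open>auto simp: w_def\<close>)
        then show ?thesis unfolding s using True c cpos by auto
      next
        case False
        then have "x \<in> T" "y \<in> T" using that by auto
        have "(\<Sum>k\<in>T. w k x * cnj (w k y)) = g x y"
          unfolding u[OF \<open>x \<in> T\<close> \<open>y \<in> T\<close>]
          by (intro sum.cong refl) (use False insert in \<open>auto simp: w_def\<close>)
        then show ?thesis unfolding s g_def by simp
      qed
    qed
    then show ?thesis by blast
  qed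
qed

subsection \<open>Optimal channels and semidefinite duality\<close>

lemma cmod_sum_mult_le:
  fixes x y :: "'a \<Rightarrow> complex"
  shows "(cmod (\<Sum>i\<in>I. x i * y i))\<^sup>2 \<le> (\<Sum>i\<in>I. (cmod (x i))\<^sup>2) * (\<Sum>i\<in>I. (cmod (y i))\<^sup>2)"
proof -
  have "cmod (\<Sum>i\<in>I. x i * y i) \<le> (\<Sum>i\<in>I. cmod (x i) * cmod (y i))"
    by (rule order_trans[OF norm_sum]) (simp add: norm_mult)
  then have "(cmod (\<Sum>i\<in>I. x i * y i))\<^sup>2 \<le> (\<Sum>i\<in>I. cmod (x i) * cmod (y i))\<^sup>2"
    by (intro power_mono) auto
  also have "\<dots> \<le> (\<Sum>i\<in>I. (cmod (x i))\<^sup>2) * (\<Sum>i\<in>I. (cmod (y i))\<^sup>2)"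
    by (rule Cauchy_Schwarz_ineq_sum)
  finally show ?thesis .
qed

lemma psd_on_Re_nonneg: "psd_on S f \<Longrightarrow> 0 \<le> Re (qform S f v)"
  unfolding psd_on_def by blast

lemma psd_on_herm: "psd_on S f \<Longrightarrow> x \<in> S \<Longrightarrow> y \<in> S \<Longrightarrow> f y x = cnj (f x y)"
  unfolding psd_on_def by blast

section \<open>The pairing Tr (J X) and its positivity\<close>

definition pairing :: "'a set \<Rightarrow> ('a \<Rightarrow> 'a \<Rightarrow> complex) \<Rightarrow> ('a \<Rightarrow> 'a \<Rightarrow> complex) \<Rightarrow> complex" where
  "pairing S J X = (\<Sum>x\<in>S. \<Sum>y\<in>S. J x y * X y x)"

text \<open>Tr (J X) for X = sum of |u_k><u_k|. The index order in \<open>pairing\<close> is that of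
  a matrix product, so no transpose appears.\<close>

lemma pairing_gram:
  assumes "\<And>x y. x \<in> S \<Longrightarrow> y \<in> S \<Longrightarrow> X x y = (\<Sum>k\<in>K. u k x * cnj (u k y))"
  shows "pairing S J X = (\<Sum>k\<in>K. qform S J (u k))"
proof -
  have "pairing S J X = (\<Sum>x\<in>S. \<Sum>y\<in>S. \<Sum>k\<in>K. cnj (u k x) * J x y * u k y)"
    unfolding pairing_def
    by (intro sum.cong refl) (simp add: assms sum_distrib_left mult_ac)
  also have "\<dots> = (\<Sum>x\<in>S. \<Sum>k\<in>K. \<Sum>y\<in>S. cnj (u k x) * J x y * u k y)"
    by (intro sum.cong refl) (rule sum.swap)
  also have "\<dots> = (\<Sum>k\<in>K. qform S J (u k))"
    unfolding qform_def by (rule sum.swap)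
  finally show ?thesis .
qed

lemma psd_on_qform_real:
  assumes "finite S" "psd_on S J"
  shows "qform S J v = complex_of_real (Re (qform S J v))"
proof -
  obtain w where w: "\<forall>x\<in>S. \<forall>y\<in>S. J x y = (\<Sum>k\<in>S. w k x * cnj (w k y))"
    using psd_on_obtain_gram[OF assms] by blast
  show ?thesis
    by (subst (1 2) qform_gram[of S J w S]) (use w in auto)
qed

lemma pairing_nonneg:
  assumes "finite S" "psd_on S J" "psd_on S X"
  shows "0 \<le> Re (pairing S J X)" "pairing S J X = complex_of_real (Re (pairing S J X))"
proof -
  obtain u where u: "\<forall>x\<in>S. \<forall>y\<in>S. X x y = (\<Sum>k\<in>S. u k x * cnj (u k y))"
    using psd_on_obtain_gram[OF assms(1,3)] by blast
  have p: "pairing S J X = (\<Sum>k\<in>S. qform S J (u k))"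
    by (rule pairing_gram) (use u in blast)
  show "0 \<le> Re (pairing S J X)"
    unfolding p by (simp add: sum_nonneg psd_on_Re_nonneg[OF assms(2)])
  show "pairing S J X = complex_of_real (Re (pairing S J X))"
    unfolding p by (subst psd_on_qform_real[OF assms(1,2)]) simp
qed

section \<open>Partial trace over A, trace-nonincreasing maps from B to A, and compactness\<close>

definition marg :: "'a set \<Rightarrow> ('a \<times> 'b \<Rightarrow> 'a \<times> 'b \<Rightarrow> complex) \<Rightarrow> 'b \<Rightarrow> 'b \<Rightarrow> complex" where
  "marg A X b b' = (\<Sum>a\<in>A. X (a, b) (a, b'))"

text \<open>Choi operators with input B and output A under the relaxed constraint Tr_A X <= 1.
  Unlike the set of channels, this one is stable under scaling down, which
  \<open>sub_channel_scale\<close> exploits.\<close>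

definition sub_channel :: "'a set \<Rightarrow> 'b set \<Rightarrow> ('a \<times> 'b \<Rightarrow> 'a \<times> 'b \<Rightarrow> complex) \<Rightarrow> bool" where
  "sub_channel A B X \<longleftrightarrow> psd_on (A \<times> B) X \<and>
     (\<forall>v. Re (qform B (marg A X) v) \<le> (\<Sum>b\<in>B. (cmod (v b))\<^sup>2))"

text \<open>Entries are inner products of Gram vectors whose squared norms are diagonal entries, so
  Cauchy-Schwarz applies.\<close>

lemma gram_norm_le:
  assumes "\<forall>x\<in>S. \<forall>y\<in>S. X x y = (\<Sum>k\<in>K. u k x * cnj (u k y))"
    and "\<And>x. x \<in> S \<Longrightarrow> Re (X x x) \<le> 1" and "x \<in> S" "y \<in> S"
  shows "cmod (X x y) \<le> 1"
proof -
  have diag: "(\<Sum>k\<in>K. (cmod (u k z))\<^sup>2) \<le> 1" if "z \<in> S" for z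
  proof -
    have "X z z = (\<Sum>k\<in>K. complex_of_real ((cmod (u k z))\<^sup>2))"
      using assms(1) that by (simp add: complex_norm_square del: of_real_power)
    then have "Re (X z z) = (\<Sum>k\<in>K. (cmod (u k z))\<^sup>2)"
      by (simp del: of_real_power)
    then show ?thesis using assms(2)[OF that] by simp
  qed
  have "(cmod (X x y))\<^sup>2 \<le> (\<Sum>k\<in>K. (cmod (u k x))\<^sup>2) * (\<Sum>k\<in>K. (cmod (u k y))\<^sup>2)"
    using assms(1,3,4) cmod_sum_mult_le[of "\<lambda>k. u k x" "\<lambda>k. cnj (u k y)" K] by simp
  also have "\<dots> \<le> 1 * 1"
    by (intro mult_mono diag assms sum_nonneg) auto
  finally show ?thesis by (simp add: power_le_one_iff abs_square_le_1[of "cmod (X x y)", simplified])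
qed

text \<open>A diagonal entry of X is one nonnegative summand of a diagonal entry of the marginal,
  hence at most 1. This is the boundedness that compactness rests on.\<close>

lemma sub_channel_norm_le:
  assumes "finite A" "finite B" "sub_channel A B X" "x \<in> A \<times> B" "y \<in> A \<times> B"
  shows "cmod (X x y) \<le> 1"
proof -
  have fin: "finite (A \<times> B)" using assms by simp
  have psd: "psd_on (A \<times> B) X" using assms unfolding sub_channel_def by blast
  obtain u where u: "\<forall>x\<in>A\<times>B. \<forall>y\<in>A\<times>B. X x y = (\<Sum>k\<in>A\<times>B. u k x * cnj (u k y))"
    using psd_on_obtain_gram[OF fin psd] by blast
  show ?thesis
  proof (rule gram_norm_le[OF u _ assms(4,5)])
    fix z assume "z \<in> A \<times> B"
    then obtain a b where z: "z = (a, b)" "a \<in> A" "b \<in> B" by blast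
    have "Re (X z z) \<le> (\<Sum>a\<in>A. Re (X (a, b) (a, b)))"
      using member_le_sum[of a A "\<lambda>a. Re (X (a, b) (a, b))"] psd_on_diag(2)[OF fin psd] z assms(1)
      by auto
    also have "\<dots> = Re (qform B (marg A X) (\<lambda>x. if x = b then 1 else 0))"
      using qform_single[OF assms(2) z(3)] by (simp add: marg_def)
    also have "\<dots> \<le> (\<Sum>b'\<in>B. (cmod (if b' = b then 1 else 0))\<^sup>2)"
      using assms(3) unfolding sub_channel_def by blast
    also have "\<dots> = (\<Sum>b'\<in>B. if b' = b then 1 else 0)"
      by (rule sum.cong) auto
    also have "\<dots> = 1" using z assms(2) by simp
    finally show "Re (X z z) \<le> 1" .
  qed
qed

lemma continuous_on_eval:
  "continuous_on UNIV (\<lambda>F :: 'i \<Rightarrow> complex. F p)"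
  by (rule continuous_on_product_coordinates)

text \<open>Tychonoff's theorem for function spaces with the product topology, in which evaluation
  at a point is continuous.\<close>

lemma compact_Pi_cball:
  fixes C :: "'i \<Rightarrow> complex set"
  assumes "\<And>i. compact (C i)"
  shows "compact {F. \<forall>i. F i \<in> C i}"
proof -
  have "compactin (product_topology (\<lambda>i. euclidean) UNIV) (PiE UNIV C)"
    using assms by (subst compactin_PiE) auto
  then show ?thesis
    unfolding euclidean_product_topology compactin_euclidean_iff PiE_def Pi_def by simp
qed

lemma optimal_sub_channel:
  fixes A :: "'a set" and B :: "'b set"
  assumes "finite A" "finite B"
  shows "\<exists>X. sub_channel A B X \<and>
    (\<forall>Y. sub_channel A B Y \<longrightarrow> Re (pairing (A \<times> B) J Y) \<le> Re (pairing (A \<times> B) J X))"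
proof -
  let ?S = "A \<times> B"
  let ?u = "\<lambda>(F :: ('a \<times> 'b) \<times> ('a \<times> 'b) \<Rightarrow> complex) x y. F (x, y)"
  \<comment> \<open>Kernels are uncurried so that a single product topology suffices. Entries
    outside S x S, which \<open>sub_channel\<close> leaves free, are pinned to 0 to keep the set
    compact.\<close>
  define C where "C = {F. (\<forall>p. F p \<in> (if p \<in> ?S \<times> ?S then cball 0 1 else {0})) \<and> sub_channel A B (?u F)}"
  have cont: "continuous_on UNIV (\<lambda>F :: ('a \<times> 'b) \<times> ('a \<times> 'b) \<Rightarrow> complex. F p)" for p
    by (rule continuous_on_eval)
  have "closed {F. sub_channel A B (?u F)}"
    unfolding sub_channel_def psd_on_def qform_def marg_def Ball_def
    by (intro closed_Collect_conj closed_Collect_all closed_Collect_imp open_Collect_const closed_Collect_eq closed_Collect_le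
        continuous_intros cont)
  moreover have "compact {F :: ('a \<times> 'b) \<times> ('a \<times> 'b) \<Rightarrow> complex. \<forall>p. F p \<in> (if p \<in> ?S \<times> ?S then cball 0 1 else {0})}"
    by (rule compact_Pi_cball) auto
  ultimately have comp: "compact C"
    unfolding C_def Collect_conj_eq by (rule compact_Int_closed[rotated])
  have "(\<lambda>_. 0) \<in> C"
    by (auto simp: C_def sub_channel_def psd_on_def qform_def marg_def intro!: sum_nonneg)
  then have ne: "C \<noteq> {}" by blast
  have "continuous_on C (\<lambda>F. Re (pairing ?S J (?u F)))"
    unfolding pairing_def
    by (intro continuous_intros continuous_on_subset[OF cont]) auto
  then obtain F where F: "F \<in> C" "\<And>G. G \<in> C \<Longrightarrow> Re (pairing ?S J (?u G)) \<le> Re (pairing ?S J (?u F))"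
    using continuous_attains_sup[OF comp ne] by blast
  show ?thesis
  proof (intro exI[of _ "?u F"] conjI allI impI)
    show "sub_channel A B (?u F)" using F(1) by (simp add: C_def)
    fix Y assume Y: "sub_channel A B Y"
    \<comment> \<open>An arbitrary competitor Y is cut off outside S x S to land in
      \<open>C\<close>; neither feasibility nor the pairing sees the difference.\<close>
    define G where "G = (\<lambda>p. if p \<in> ?S \<times> ?S then Y (fst p) (snd p) else 0)"
    have eq: "?u G x y = Y x y" if "x \<in> ?S" "y \<in> ?S" for x y
      using that by (auto simp: G_def)
    have q: "qform B (marg A (?u G)) v = qform B (marg A Y) v" for v
      by (rule qform_cong) (auto simp: marg_def eq)
    have "sub_channel A B (?u G)"
      using Y psd_on_cong[of ?S "?u G" Y, OF eq] unfolding sub_channel_def q by blast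
    then have "G \<in> C"
      unfolding C_def using sub_channel_norm_le[OF assms Y] by (auto simp: G_def)
    moreover have "pairing ?S J (?u G) = pairing ?S J Y"
      unfolding pairing_def by (intro sum.cong refl) (simp only: eq)
    ultimately show "Re (pairing ?S J Y) \<le> Re (pairing ?S J (?u F))"
      using F(2)[of G] by simp
  qed
qed

section \<open>First-order variation around an optimum, and the dual solution\<close>

lemma bform_cnj:
  assumes "psd_on S f"
  shows "bform S f v w = cnj (bform S f w v)"
proof -
  have "cnj (bform S f w v) = (\<Sum>x\<in>S. \<Sum>y\<in>S. w x * cnj (f x y) * cnj (v y))"
    by (simp add: bform_def)
  also have "\<dots> = (\<Sum>x\<in>S. \<Sum>y\<in>S. cnj (v y) * f y x * w x)"
    by (intro sum.cong refl) (use psd_on_herm[OF assms] in \<open>metis mult.commute mult.left_commute\<close>)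
  also have "\<dots> = bform S f v w"
    unfolding bform_def by (rule sum.swap)
  finally show ?thesis by simp
qed

lemma Re_qform_perturb:
  assumes "psd_on S f"
  shows "Re (qform S f (\<lambda>x. v x - complex_of_real s * d x))
    = Re (qform S f v) - 2 * s * Re (bform S f d v) + s\<^sup>2 * Re (qform S f d)"
proof -
  have "qform S f (\<lambda>x. v x - complex_of_real s * d x)
    = (\<Sum>x\<in>S. \<Sum>y\<in>S. cnj (v x) * f x y * v y - complex_of_real s * (cnj (v x) * f x y * d y)
        - complex_of_real s * (cnj (d x) * f x y * v y) + complex_of_real (s\<^sup>2) * (cnj (d x) * f x y * d y))"
    unfolding qform_def by (intro sum.cong refl) (simp add: algebra_simps power2_eq_square)
  also have "\<dots> = qform S f v - complex_of_real s * bform S f v d - complex_of_real s * bform S f d v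
      + complex_of_real (s\<^sup>2) * qform S f d"
    unfolding qform_def bform_def by (simp only: sum.distrib sum_subtractf sum_distrib_left)
  also have "bform S f v d = cnj (bform S f d v)" by (rule bform_cnj[OF assms])
  finally show ?thesis by (simp del: of_real_power)
qed

text \<open>The marginal has the Gram family of all slices u_k(a, .), indexed by the pairs (k,
  a).\<close>

lemma qform_marg_gram:
  assumes "\<And>x y. x \<in> A \<times> B \<Longrightarrow> y \<in> A \<times> B \<Longrightarrow> X x y = (\<Sum>k\<in>K. u k x * cnj (u k y))"
  shows "qform B (marg A X) v
    = (\<Sum>k\<in>K. \<Sum>a\<in>A. complex_of_real ((cmod (\<Sum>b\<in>B. cnj (v b) * u k (a, b)))\<^sup>2))"
proof -
  have "marg A X b b' = (\<Sum>p\<in>K \<times> A. u (fst p) (snd p, b) * cnj (u (fst p) (snd p, b')))"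
    if "b \<in> B" "b' \<in> B" for b b'
  proof -
    have "marg A X b b' = (\<Sum>a\<in>A. \<Sum>k\<in>K. u k (a, b) * cnj (u k (a, b')))"
      unfolding marg_def using that assms by (intro sum.cong refl) auto
    also have "\<dots> = (\<Sum>k\<in>K. \<Sum>a\<in>A. u k (a, b) * cnj (u k (a, b')))"
      by (rule sum.swap)
    finally show ?thesis by (simp add: sum.cartesian_product case_prod_beta)
  qed
  from qform_gram[OF this] show ?thesis
    by (simp add: sum.cartesian_product case_prod_beta del: of_real_power)
qed

text \<open>By homogeneity, as X / \<kappa> is feasible. This converts a perturbation that
  overshoots the constraint by a factor \<kappa> into an inequality for the optimum.\<close>

lemma sub_channel_scale:
  assumes psd: "psd_on (A \<times> B) X" and "\<kappa> > 0"
    and m: "\<And>v. Re (qform B (marg A X) v) \<le> \<kappa> * (\<Sum>b\<in>B. (cmod (v b))\<^sup>2)"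
    and opt: "\<And>Y. sub_channel A B Y \<Longrightarrow> Re (pairing (A \<times> B) J Y) \<le> p"
  shows "Re (pairing (A \<times> B) J X) \<le> \<kappa> * p"
proof -
  define Y where "Y = (\<lambda>x y. complex_of_real (1 / \<kappa>) * X x y)"
  have q1: "qform (A \<times> B) Y v = complex_of_real (1 / \<kappa>) * qform (A \<times> B) X v" for v
    by (simp add: qform_def Y_def sum_distrib_left mult_ac)
  have q2: "qform B (marg A Y) v = complex_of_real (1 / \<kappa>) * qform B (marg A X) v" for v
    by (simp add: qform_def Y_def marg_def sum_distrib_left sum_distrib_right mult_ac)
  have "sub_channel A B Y"
    unfolding sub_channel_def psd_on_def
  proof (intro conjI ballI allI)
    fix x y assume "x \<in> A \<times> B" "y \<in> A \<times> B"
    then have "X y x = cnj (X x y)" by (rule psd_on_herm[OF psd])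
    then show "Y y x = cnj (Y x y)" unfolding Y_def by simp
  next
    fix v show "0 \<le> Re (qform (A \<times> B) Y v)"
      unfolding q1 using psd_on_Re_nonneg[OF psd, of v] \<open>\<kappa> > 0\<close> by simp
  next
    fix v show "Re (qform B (marg A Y) v) \<le> (\<Sum>b\<in>B. (cmod (v b))\<^sup>2)"
      unfolding q2 using m[of v] \<open>\<kappa> > 0\<close> by (simp add: field_simps)
  qed
  moreover have "pairing (A \<times> B) J Y = complex_of_real (1 / \<kappa>) * pairing (A \<times> B) J X"
    by (simp add: pairing_def Y_def sum_distrib_left mult_ac)
  ultimately have "1 / \<kappa> * Re (pairing (A \<times> B) J X) \<le> p"
    using opt[of Y] by simp
  then show ?thesis using \<open>\<kappa> > 0\<close> by (simp add: field_simps)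
qed

text \<open>Stationarity: divide by s and let s tend to 0. One explicit s, small compared with d /
  |c|, replaces the limit.\<close>

lemma first_order_nonpos:
  fixes d c :: real
  assumes "\<And>s. s > 0 \<Longrightarrow> s * d \<le> s\<^sup>2 * c"
  shows "d \<le> 0"
proof (rule ccontr)
  assume "\<not> d \<le> 0"
  define s where "s = d / (2 * (\<bar>c\<bar> + 1))"
  have s: "s > 0" using \<open>\<not> d \<le> 0\<close> by (simp add: s_def)
  have "d \<le> s * c"
    using assms[OF s] s by (simp add: power2_eq_square)
  also have "\<dots> \<le> s * (\<bar>c\<bar> + 1)" using s by (intro mult_left_mono) auto
  also have "\<dots> = d / 2" by (simp add: s_def field_simps)
  finally show False using \<open>\<not> d \<le> 0\<close> by simp
qed

text \<open>Complementary slackness suggests the Hermitian part of \<open>Tr\<^sub>A (J X)\<close> as dual solution. Its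
  feasibility follows by moving the optimal \<open>X\<close> in the direction of \<open>|l\<rangle>\<langle>l|\<close>, where the constraint
  is compensated by conjugating \<open>X\<close> with \<open>1 - s W\<close>, \<open>W = Tr\<^sub>A |l\<rangle>\<langle>l|\<close>.\<close>

lemma optimal_dual_solution:
  fixes A :: "'a set" and B :: "'b set"
  assumes fin: "finite A" "finite B" and J: "psd_on (A \<times> B) J"
    and X: "sub_channel A B X"
    and opt: "\<And>Y. sub_channel A B Y \<Longrightarrow> Re (pairing (A \<times> B) J Y) \<le> Re (pairing (A \<times> B) J X)"
  shows "\<exists>T. (\<forall>b b'. T b' b = cnj (T b b')) \<and> (\<Sum>b\<in>B. T b b) = pairing (A \<times> B) J X \<and>
    (\<forall>l. Re (qform (A \<times> B) J l) \<le> (\<Sum>a\<in>A. Re (qform B T (\<lambda>b. l (a, b)))))"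
proof -
  let ?S = "A \<times> B"
  have finS: "finite ?S" using fin by simp
  have psdX: "psd_on ?S X" using X unfolding sub_channel_def by blast
  obtain u and K :: "('a \<times> 'b) set" where finK: "finite K"
    and u: "\<And>x y. x \<in> ?S \<Longrightarrow> y \<in> ?S \<Longrightarrow> X x y = (\<Sum>k\<in>K. u k x * cnj (u k y))"
    using psd_on_obtain_gram[OF finS psdX] finS by blast
  define p where "p = Re (pairing ?S J X)"
  have pJX: "pairing ?S J X = (\<Sum>k\<in>K. qform ?S J (u k))"
    by (rule pairing_gram) (rule u)
  define Jc where "Jc = (\<lambda>k x. \<Sum>y\<in>?S. J x y * u k y)"
  \<comment> \<open>\<open>R\<close> is Tr_A (J X) written with the Gram vectors of X.
    \<open>T\<close> is its Hermitian part; real parts of quadratic forms are unchanged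
    (\<open>ReT\<close>), and so is the trace, because Tr (J X) is real.\<close>
  define R where "R = (\<lambda>b b'. \<Sum>k\<in>K. \<Sum>a\<in>A. Jc k (a, b) * cnj (u k (a, b')))"
  define T where "T = (\<lambda>b b'. (R b b' + cnj (R b' b)) / 2)"
  have Th: "T b' b = cnj (T b b')" for b b'
    by (simp add: T_def add.commute)
  have ReT: "Re (qform B T w) = Re (qform B R w)" for w
  proof -
    have "cnj (qform B R w) = (\<Sum>b\<in>B. \<Sum>b'\<in>B. w b * cnj (R b b') * cnj (w b'))"
      by (simp add: qform_def)
    also have "\<dots> = (\<Sum>b'\<in>B. \<Sum>b\<in>B. w b * cnj (R b b') * cnj (w b'))"
      by (rule sum.swap)
    finally have c: "cnj (qform B R w) = (\<Sum>b'\<in>B. \<Sum>b\<in>B. w b * cnj (R b b') * cnj (w b'))" .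
    have "qform B T w = (\<Sum>b\<in>B. \<Sum>b'\<in>B. (cnj (w b) * R b b' * w b' + w b' * cnj (R b' b) * cnj (w b)) / 2)"
      unfolding qform_def T_def by (intro sum.cong refl) (simp add: field_simps)
    also have "\<dots> = (qform B R w + cnj (qform B R w)) / 2"
      unfolding c unfolding qform_def sum_divide_distrib[symmetric] sum.distrib ..
    finally have "qform B T w = (qform B R w + cnj (qform B R w)) / 2" .
    then show ?thesis by (simp only: Re_divide_numeral plus_complex.sel cnj.sel) simp
  qed
  have trR: "(\<Sum>b\<in>B. R b b) = pairing ?S J X"
  proof -
    have "(\<Sum>b\<in>B. R b b) = (\<Sum>k\<in>K. \<Sum>b\<in>B. \<Sum>a\<in>A. Jc k (a, b) * cnj (u k (a, b)))"
      unfolding R_def by (rule sum.swap)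
    also have "\<dots> = (\<Sum>k\<in>K. \<Sum>a\<in>A. \<Sum>b\<in>B. Jc k (a, b) * cnj (u k (a, b)))"
      by (intro sum.cong refl) (rule sum.swap)
    also have "\<dots> = (\<Sum>k\<in>K. \<Sum>x\<in>?S. Jc k x * cnj (u k x))"
      by (simp add: sum.cartesian_product case_prod_beta)
    also have "\<dots> = (\<Sum>k\<in>K. qform ?S J (u k))"
      unfolding qform_def Jc_def
      by (intro sum.cong refl) (simp add: sum_distrib_left sum_distrib_right mult_ac)
    finally show ?thesis unfolding pJX .
  qed
  have preal: "pairing ?S J X = complex_of_real p"
    unfolding p_def by (rule pairing_nonneg(2)[OF finS J psdX])
  have trT: "(\<Sum>b\<in>B. T b b) = pairing ?S J X"
  proof -
    have "(\<Sum>b\<in>B. T b b) = ((\<Sum>b\<in>B. R b b) + cnj (\<Sum>b\<in>B. R b b)) / 2"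
      unfolding T_def by (simp add: sum.distrib sum_divide_distrib[symmetric])
    then show ?thesis unfolding trR preal by simp
  qed
  have ineq: "Re (qform ?S J l) \<le> (\<Sum>a\<in>A. Re (qform B T (\<lambda>b. l (a, b))))" for l
  proof -
    let ?t = "\<Sum>a\<in>A. Re (qform B T (\<lambda>b. l (a, b)))"
    define W where "W = (\<lambda>b b'. \<Sum>a\<in>A. l (a, b) * cnj (l (a, b')))"
    have Wh: "cnj (W b b') = W b' b" for b b'
      by (simp add: W_def mult.commute)
    define d where "d = (\<lambda>k x. \<Sum>b\<in>B. W (snd x) b * u k (fst x, b))"
    \<comment> \<open>The squared Hilbert-Schmidt norm of \<open>W\<close>, an upper bound for W^2
      as an operator.\<close>
    define w where "w = (\<Sum>b\<in>B. \<Sum>b'\<in>B. (cmod (W b b'))\<^sup>2)"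
    have w0: "w \<ge> 0" by (simp add: w_def sum_nonneg)
    \<comment> \<open>Up to the factor -2 s, the real part is the first-order change of the pairing
      when each u_k is replaced by u_k - s d_k. It is a pairing of \<open>W\<close> with
      \<open>R\<close>, and splitting \<open>W\<close> into the slices of l yields the dual side of
      the inequality.\<close>
    have "(\<Sum>k\<in>K. bform ?S J (d k) (u k)) = (\<Sum>a\<in>A. qform B R (\<lambda>b. l (a, b)))"
    proof -
      have "(\<Sum>k\<in>K. bform ?S J (d k) (u k)) = (\<Sum>k\<in>K. \<Sum>a\<in>A. \<Sum>b\<in>B. cnj (d k (a, b)) * Jc k (a, b))"
        unfolding bform_def Jc_def
        by (simp add: sum.cartesian_product' sum_distrib_left mult_ac)
      also have "\<dots> = (\<Sum>k\<in>K. \<Sum>a\<in>A. \<Sum>b\<in>B. \<Sum>b'\<in>B. cnj (W b b') * (Jc k (a, b) * cnj (u k (a, b'))))"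
        unfolding d_def by (simp add: sum_distrib_left sum_distrib_right mult_ac)
      also have "\<dots> = (\<Sum>q\<in>K \<times> A. \<Sum>r\<in>B \<times> B. cnj (W (fst r) (snd r)) *
          (Jc (fst q) (snd q, fst r) * cnj (u (fst q) (snd q, snd r))))"
        by (simp add: sum.cartesian_product')
      also have "\<dots> = (\<Sum>r\<in>B \<times> B. \<Sum>q\<in>K \<times> A. cnj (W (fst r) (snd r)) *
          (Jc (fst q) (snd q, fst r) * cnj (u (fst q) (snd q, snd r))))"
        by (rule sum.swap)
      also have "\<dots> = (\<Sum>b\<in>B. \<Sum>b'\<in>B. cnj (W b b') * R b b')"
        unfolding R_def by (simp add: sum.cartesian_product' sum_distrib_left)
      also have "\<dots> = (\<Sum>r\<in>B \<times> B. \<Sum>a\<in>A. cnj (l (a, fst r)) * R (fst r) (snd r) * l (a, snd r))"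
        unfolding W_def by (simp add: sum.cartesian_product' sum_distrib_left sum_distrib_right mult_ac)
      also have "\<dots> = (\<Sum>a\<in>A. \<Sum>r\<in>B \<times> B. cnj (l (a, fst r)) * R (fst r) (snd r) * l (a, snd r))"
        by (rule sum.swap)
      also have "\<dots> = (\<Sum>a\<in>A. qform B R (\<lambda>b. l (a, b)))"
        unfolding qform_def by (simp add: sum.cartesian_product')
      finally show ?thesis .
    qed
    then have bf: "(\<Sum>k\<in>K. Re (bform ?S J (d k) (u k))) = ?t"
      unfolding ReT by (metis Re_sum)
    have "2 * (Re (qform ?S J l) - ?t) \<le> 0"
    proof (rule first_order_nonpos[where c = "w * p"])
      fix s :: real assume s: "s > 0"
      \<comment> \<open>The Gram family of X' = (1 - s W) X (1 - s W) + 2 s |l><l|. Its marginal is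
        at most (1 - s W)^2 + 2 s W = 1 + s^2 W^2: the coefficient 2 s is the one for which the
        first-order terms cancel.\<close>
      define g where "g = (\<lambda>k x. u k x - complex_of_real s * d k x)"
      define h where "h = (\<lambda>q x. case q of None \<Rightarrow> complex_of_real (sqrt (2 * s)) * l x | Some k \<Rightarrow> g k x)"
      define Q where "Q = insert None (Some ` K)"
      have sumQ: "(\<Sum>q\<in>Q. f q) = f None + (\<Sum>k\<in>K. f (Some k))" for f :: "('a \<times> 'b) option \<Rightarrow> 'c :: ab_group_add"
        unfolding Q_def using finK by (simp add: sum.reindex)
      define X' where "X' = (\<lambda>x y. \<Sum>q\<in>Q. h q x * cnj (h q y))"
      have "psd_on ?S X'" by (rule psd_on_gram[of _ _ h Q]) (simp add: X'_def)
      moreover have "Re (qform B (marg A X') v) \<le> (1 + s\<^sup>2 * w) * (\<Sum>b\<in>B. (cmod (v b))\<^sup>2)" for v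
      proof -
        let ?v = "\<Sum>b\<in>B. (cmod (v b))\<^sup>2"
        define Wv where "Wv = (\<lambda>b. \<Sum>b'\<in>B. W b b' * v b')"
        define v' where "v' = (\<lambda>b. v b - complex_of_real s * Wv b)"
        have 1: "(\<Sum>b\<in>B. cnj (v b) * g k (a, b)) = (\<Sum>b\<in>B. cnj (v' b) * u k (a, b))" for k a
        proof -
          have "(\<Sum>b\<in>B. cnj (v b) * d k (a, b)) = (\<Sum>b\<in>B. \<Sum>b'\<in>B. cnj (v b) * W b b' * u k (a, b'))"
            by (simp add: d_def sum_distrib_left mult_ac)
          also have "\<dots> = (\<Sum>b'\<in>B. \<Sum>b\<in>B. cnj (v b) * W b b' * u k (a, b'))"
            by (rule sum.swap)
          also have "\<dots> = (\<Sum>b\<in>B. cnj (Wv b) * u k (a, b))"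
            unfolding Wv_def by (simp add: Wh sum_distrib_left sum_distrib_right mult_ac)
          finally show ?thesis
            unfolding g_def v'_def
            by (simp add: algebra_simps sum_subtractf sum_distrib_left[symmetric])
        qed
        have 2: "(\<Sum>a\<in>A. (cmod (\<Sum>b\<in>B. cnj (v b) * l (a, b)))\<^sup>2) = Re (\<Sum>b\<in>B. cnj (v b) * Wv b)"
        proof -
          have "qform B W v = (\<Sum>a\<in>A. complex_of_real ((cmod (\<Sum>b\<in>B. cnj (v b) * l (a, b)))\<^sup>2))"
            by (rule qform_gram) (simp add: W_def)
          moreover have "qform B W v = (\<Sum>b\<in>B. cnj (v b) * Wv b)"
            by (simp add: qform_def Wv_def sum_distrib_left mult_ac)
          ultimately show ?thesis by (simp del: of_real_power)
        qed
        have "Re (qform B (marg A X') v) = (\<Sum>q\<in>Q. \<Sum>a\<in>A. (cmod (\<Sum>b\<in>B. cnj (v b) * h q (a, b)))\<^sup>2)"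
          by (subst qform_marg_gram[of A B X' h Q]) (simp_all add: X'_def del: of_real_power)
        also have "\<dots> = (\<Sum>a\<in>A. (cmod (\<Sum>b\<in>B. cnj (v b) * (complex_of_real (sqrt (2 * s)) * l (a, b))))\<^sup>2)
            + (\<Sum>k\<in>K. \<Sum>a\<in>A. (cmod (\<Sum>b\<in>B. cnj (v b) * g k (a, b)))\<^sup>2)"
          unfolding sumQ by (simp add: h_def)
        also have "(\<Sum>a\<in>A. (cmod (\<Sum>b\<in>B. cnj (v b) * (complex_of_real (sqrt (2 * s)) * l (a, b))))\<^sup>2)
            = 2 * s * Re (\<Sum>b\<in>B. cnj (v b) * Wv b)"
        proof -
          have "(cmod (\<Sum>b\<in>B. cnj (v b) * (complex_of_real (sqrt (2 * s)) * l (a, b))))\<^sup>2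
              = 2 * s * (cmod (\<Sum>b\<in>B. cnj (v b) * l (a, b)))\<^sup>2" for a
          proof -
            have "(\<Sum>b\<in>B. cnj (v b) * (complex_of_real (sqrt (2 * s)) * l (a, b)))
                = complex_of_real (sqrt (2 * s)) * (\<Sum>b\<in>B. cnj (v b) * l (a, b))"
              by (simp add: sum_distrib_left mult_ac)
            then show ?thesis using s by (simp add: norm_mult power_mult_distrib)
          qed
          then show ?thesis unfolding 2[symmetric] by (simp add: sum_distrib_left)
        qed
        also have "(\<Sum>k\<in>K. \<Sum>a\<in>A. (cmod (\<Sum>b\<in>B. cnj (v b) * g k (a, b)))\<^sup>2) = Re (qform B (marg A X) v')"
          unfolding 1 by (subst qform_marg_gram[of A B X u K]) (simp_all add: u[symmetric] del: of_real_power)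
        also have "\<dots> \<le> (\<Sum>b\<in>B. (cmod (v' b))\<^sup>2)"
          using X unfolding sub_channel_def by blast
        also have "(\<Sum>b\<in>B. (cmod (v' b))\<^sup>2) = ?v - 2 * s * Re (\<Sum>b\<in>B. cnj (v b) * Wv b)
            + s\<^sup>2 * (\<Sum>b\<in>B. (cmod (Wv b))\<^sup>2)"
        proof -
          have "(cmod (v' b))\<^sup>2 = (cmod (v b))\<^sup>2 - 2 * s * Re (cnj (v b) * Wv b) + s\<^sup>2 * (cmod (Wv b))\<^sup>2" for b
            unfolding v'_def cmod_power2 by (simp add: power2_eq_square algebra_simps)
          then show ?thesis
            by (simp only: Re_sum sum.distrib sum_subtractf sum_distrib_left)
        qed
        also have "2 * s * Re (\<Sum>b\<in>B. cnj (v b) * Wv b) + (?v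
            - 2 * s * Re (\<Sum>b\<in>B. cnj (v b) * Wv b) + s\<^sup>2 * (\<Sum>b\<in>B. (cmod (Wv b))\<^sup>2))
            = ?v + s\<^sup>2 * (\<Sum>b\<in>B. (cmod (Wv b))\<^sup>2)" by simp
        also have "\<dots> \<le> ?v + s\<^sup>2 * (w * ?v)"
        proof -
          have "(\<Sum>b\<in>B. (cmod (Wv b))\<^sup>2) \<le> w * ?v"
            unfolding w_def Wv_def by (subst sum_distrib_right) (intro sum_mono cmod_sum_mult_le)
          then show ?thesis by (intro add_left_mono mult_left_mono) auto
        qed
        finally show ?thesis by (simp add: algebra_simps)
      qed
      moreover have "1 + s\<^sup>2 * w > 0" using w0 by (simp add: add_pos_nonneg)
      ultimately have "Re (pairing ?S J X') \<le> (1 + s\<^sup>2 * w) * p"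
        using opt[folded p_def] by (intro sub_channel_scale) auto
      moreover have "Re (pairing ?S J X') = 2 * s * Re (qform ?S J l) + (\<Sum>k\<in>K. Re (qform ?S J (g k)))"
      proof -
        have 1: "pairing ?S J X' = (\<Sum>q\<in>Q. qform ?S J (h q))"
          by (rule pairing_gram) (simp add: X'_def)
        have sq: "complex_of_real (sqrt (2 * s)) * complex_of_real (sqrt (2 * s)) = complex_of_real (2 * s)"
          unfolding of_real_mult[symmetric] using s by simp
        have "qform ?S J (h None) = complex_of_real (sqrt (2 * s)) * complex_of_real (sqrt (2 * s)) * qform ?S J l"
          by (simp add: qform_def h_def sum_distrib_left mult_ac)
        then have 2: "qform ?S J (h None) = complex_of_real (2 * s) * qform ?S J l"
          unfolding sq .
        have 3: "h (Some k) = g k" for k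
          by (rule ext) (simp add: h_def)
        show ?thesis unfolding 1 sumQ 2 3 by simp
      qed
      \<comment> \<open>The terms of order s^2 are values of the positive form of J, so a lower
        bound may drop them.\<close>
      moreover have "(\<Sum>k\<in>K. Re (qform ?S J (g k))) \<ge> p - 2 * s * ?t"
      proof -
        have "(\<Sum>k\<in>K. Re (qform ?S J (g k))) = (\<Sum>k\<in>K. Re (qform ?S J (u k))
            - 2 * s * Re (bform ?S J (d k) (u k)) + s\<^sup>2 * Re (qform ?S J (d k)))"
          unfolding g_def Re_qform_perturb[OF J] ..
        also have "\<dots> \<ge> (\<Sum>k\<in>K. Re (qform ?S J (u k)) - 2 * s * Re (bform ?S J (d k) (u k)))"
          by (intro sum_mono) (simp add: psd_on_Re_nonneg[OF J])
        also have "(\<Sum>k\<in>K. Re (qform ?S J (u k)) - 2 * s * Re (bform ?S J (d k) (u k)))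
            = p - 2 * s * ?t"
          unfolding sum_subtractf sum_distrib_left[symmetric] bf by (simp add: p_def pJX)
        finally show ?thesis by simp
      qed
      ultimately show "s * (2 * (Re (qform ?S J l) - ?t)) \<le> s\<^sup>2 * (w * p)"
        by (simp add: algebra_simps)
    qed
    then show ?thesis by simp
  qed
  show ?thesis using Th trT ineq by blast
qed

section \<open>Channels from B to A and strong duality\<close>

definition channel_kernel :: "'a set \<Rightarrow> 'b set \<Rightarrow> ('a \<times> 'b \<Rightarrow> 'a \<times> 'b \<Rightarrow> complex) \<Rightarrow> bool" where
  "channel_kernel A B X \<longleftrightarrow> psd_on (A \<times> B) X \<and>
     (\<forall>b\<in>B. \<forall>b'\<in>B. marg A X b b' = (if b = b' then 1 else 0))"

lemma qform_delta_minus: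
  assumes "finite S"
  shows "qform S (\<lambda>x y. (if x = y then c else 0) - f x y) v
    = c * complex_of_real (\<Sum>x\<in>S. (cmod (v x))\<^sup>2) - qform S f v"
proof -
  have "qform S (\<lambda>x y. (if x = y then c else 0) - f x y) v
      = (\<Sum>x\<in>S. \<Sum>y\<in>S. (if x = y then c * (v x * cnj (v x)) else 0) - cnj (v x) * f x y * v y)"
    unfolding qform_def by (intro sum.cong refl) (simp add: algebra_simps)
  also have "\<dots> = (\<Sum>x\<in>S. c * (v x * cnj (v x))) - qform S f v"
    unfolding sum_subtractf qform_def using assms by simp
  finally show ?thesis
    by (simp add: sum_distrib_left complex_norm_square del: of_real_power)
qed

lemma qform_delta:
  assumes "finite S" "\<And>x y. x \<in> S \<Longrightarrow> y \<in> S \<Longrightarrow> f x y = (if x = y then c else 0)"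
  shows "qform S f v = c * complex_of_real (\<Sum>x\<in>S. (cmod (v x))\<^sup>2)"
proof -
  have "qform S f v = qform S (\<lambda>x y. (if x = y then c else 0) - 0) v"
    by (rule qform_cong) (use assms in auto)
  also have "\<dots> = c * complex_of_real (\<Sum>x\<in>S. (cmod (v x))\<^sup>2) - qform S (\<lambda>x y. 0) v"
    by (rule qform_delta_minus[OF assms(1)])
  finally show ?thesis by (simp add: qform_def)
qed

lemma psd_on_add:
  assumes "psd_on S f" "psd_on S g"
  shows "psd_on S (\<lambda>x y. f x y + g x y)"
proof -
  have q: "qform S (\<lambda>x y. f x y + g x y) v = qform S f v + qform S g v" for v
    unfolding qform_def by (simp add: algebra_simps sum.distrib)
  show ?thesis
    unfolding psd_on_def q
  proof (intro conjI ballI allI)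
    fix x y assume "x \<in> S" "y \<in> S"
    then show "f y x + g y x = cnj (f x y + g x y)"
      using psd_on_herm[OF assms(1), of x y] psd_on_herm[OF assms(2), of x y] by (metis complex_cnj_add)
  next
    fix v show "0 \<le> Re (qform S f v + qform S g v)"
      using psd_on_Re_nonneg[OF assms(1), of v] psd_on_Re_nonneg[OF assms(2), of v] by simp
  qed
qed

text \<open>The defect 1 - Tr_A X is positive. Tensoring it with a fixed basis state a0 of A gives a
  positive kernel whose addition restores the marginal and cannot lower the pairing with a positive
  J.\<close>

lemma complete_sub_channel:
  assumes fin: "finite A" "finite B" and "A \<noteq> {}" and X: "sub_channel A B X"
  shows "\<exists>Y. channel_kernel A B Y \<and>
    (\<forall>J. psd_on (A \<times> B) J \<longrightarrow> Re (pairing (A \<times> B) J X) \<le> Re (pairing (A \<times> B) J Y))"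
proof -
  obtain a0 where a0: "a0 \<in> A" using \<open>A \<noteq> {}\<close> by blast
  have finS: "finite (A \<times> B)" using fin by simp
  have psdX: "psd_on (A \<times> B) X" using X unfolding sub_channel_def by blast
  define M where "M = (\<lambda>b b'. (if b = b' then 1 else 0) - marg A X b b')"
  have "psd_on B M"
    unfolding psd_on_def
  proof (intro conjI ballI allI)
    fix b b' assume "b \<in> B" "b' \<in> B"
    then have "marg A X b' b = cnj (marg A X b b')"
      unfolding marg_def cnj_sum by (intro sum.cong refl psd_on_herm[OF psdX]) auto
    then show "M b' b = cnj (M b b')" unfolding M_def by simp
  next
    fix v
    have "Re (qform B (marg A X) v) \<le> (\<Sum>b\<in>B. (cmod (v b))\<^sup>2)"
      using X unfolding sub_channel_def by blast
    then show "0 \<le> Re (qform B M v)"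
      unfolding M_def qform_delta_minus[OF fin(2)] by (simp del: of_real_power of_real_sum)
  qed
  then obtain m where m: "\<And>b b'. b \<in> B \<Longrightarrow> b' \<in> B \<Longrightarrow> M b b' = (\<Sum>k\<in>B. m k b * cnj (m k b'))"
    using psd_on_obtain_gram[OF fin(2)] by blast
  define E where "E = (\<lambda>x y. if fst x = a0 \<and> fst y = a0 then M (snd x) (snd y) else 0)"
  have psdE: "psd_on (A \<times> B) E"
    by (rule psd_on_gram[of _ _ "\<lambda>k x. if fst x = a0 then m k (snd x) else 0" B])
      (auto simp: E_def m)
  define Y where "Y = (\<lambda>x y. X x y + E x y)"
  have "psd_on (A \<times> B) Y" unfolding Y_def by (rule psd_on_add[OF psdX psdE])
  moreover have "marg A Y b b' = (if b = b' then 1 else 0)" for b b'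
  proof -
    have "marg A Y b b' = marg A X b b' + (\<Sum>a\<in>A. if a = a0 then M b b' else 0)"
      unfolding marg_def Y_def E_def by (simp add: sum.distrib cong: if_cong)
    then show ?thesis using a0 fin by (simp add: M_def)
  qed
  ultimately have "channel_kernel A B Y" unfolding channel_kernel_def by blast
  moreover have "Re (pairing (A \<times> B) J X) \<le> Re (pairing (A \<times> B) J Y)" if J: "psd_on (A \<times> B) J" for J
  proof -
    have "pairing (A \<times> B) J Y = pairing (A \<times> B) J X + pairing (A \<times> B) J E"
      unfolding pairing_def Y_def by (simp add: algebra_simps sum.distrib)
    then show ?thesis using pairing_nonneg(1)[OF finS J psdE] by simp
  qed
  ultimately show ?thesis by blast
qed

lemma channel_kernel_sub_channel:
  assumes "finite B" "channel_kernel A B X"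
  shows "sub_channel A B X"
proof -
  have "qform B (marg A X) v = 1 * complex_of_real (\<Sum>b\<in>B. (cmod (v b))\<^sup>2)" for v
    by (rule qform_delta) (use assms in \<open>auto simp: channel_kernel_def\<close>)
  then show ?thesis using assms unfolding sub_channel_def channel_kernel_def by simp
qed

text \<open>The last conjunct is the dual constraint J <= 1_A (x) T, and Tr T = Tr (J X) says that
  the duality gap is zero. X is the completion of an optimal trace-nonincreasing map, hence still
  optimal in the relaxed class, as \<open>optimal_dual_solution\<close> demands.\<close>

lemma channel_duality_max:
  assumes fin: "finite A" "finite B" and "A \<noteq> {}" and J: "psd_on (A \<times> B) J"
  shows "\<exists>X T. channel_kernel A B X \<and> (\<forall>b b'. T b' b = cnj (T b b')) \<and>
    (\<Sum>b\<in>B. T b b) = pairing (A \<times> B) J X \<and>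
    (\<forall>l. Re (qform (A \<times> B) J l) \<le> (\<Sum>a\<in>A. Re (qform B T (\<lambda>b. l (a, b)))))"
proof -
  obtain X0 where X0: "sub_channel A B X0"
    "\<And>Y. sub_channel A B Y \<Longrightarrow> Re (pairing (A \<times> B) J Y) \<le> Re (pairing (A \<times> B) J X0)"
    using optimal_sub_channel[OF fin] by blast
  obtain X where X: "channel_kernel A B X" "Re (pairing (A \<times> B) J X0) \<le> Re (pairing (A \<times> B) J X)"
    using complete_sub_channel[OF fin \<open>A \<noteq> {}\<close> X0(1)] J by blast
  have "Re (pairing (A \<times> B) J Y) \<le> Re (pairing (A \<times> B) J X)" if "sub_channel A B Y" for Y
    using X0(2)[OF that] X(2) by simp
  from optimal_dual_solution[OF fin J channel_kernel_sub_channel[OF fin(2) X(1)] this]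
  show ?thesis using X(1) by blast
qed

text \<open>The maximal case for c 1 - J. Every channel kernel has trace |B|, so minimising Tr (J X)
  amounts to maximising Tr ((c 1 - J) X), and c 1 - T' solves the dual. The resulting T is Hermitian
  but may fail to be positive, in line with the affine states of the Doeblin information.\<close>

lemma channel_duality_min:
  assumes fin: "finite A" "finite B" and "A \<noteq> {}" and J: "psd_on (A \<times> B) J"
  shows "\<exists>X T. channel_kernel A B X \<and> (\<forall>b b'. T b' b = cnj (T b b')) \<and>
    (\<Sum>b\<in>B. T b b) = pairing (A \<times> B) J X \<and>
    (\<forall>l. (\<Sum>a\<in>A. Re (qform B T (\<lambda>b. l (a, b)))) \<le> Re (qform (A \<times> B) J l))"
proof -
  let ?S = "A \<times> B"
  have finS: "finite ?S" using fin by simp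
  obtain u where u: "\<And>x y. x \<in> ?S \<Longrightarrow> y \<in> ?S \<Longrightarrow> J x y = (\<Sum>k\<in>?S. u k x * cnj (u k y))"
    using psd_on_obtain_gram[OF finS J] by blast
  \<comment> \<open>The trace of J; by Cauchy-Schwarz it dominates the form of J on unit vectors, so
    c 1 - J is positive.\<close>
  define c where "c = (\<Sum>k\<in>?S. \<Sum>x\<in>?S. (cmod (u k x))\<^sup>2)"
  define J' where "J' = (\<lambda>x y. (if x = y then complex_of_real c else 0) - J x y)"
  have qJ': "Re (qform ?S J' v) = c * (\<Sum>x\<in>?S. (cmod (v x))\<^sup>2) - Re (qform ?S J v)" for v
    unfolding J'_def qform_delta_minus[OF finS] by (simp del: of_real_power of_real_sum)
  have "psd_on ?S J'"
    unfolding psd_on_def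
  proof (intro conjI ballI allI)
    fix x y assume "x \<in> ?S" "y \<in> ?S"
    then have "J y x = cnj (J x y)" by (rule psd_on_herm[OF J])
    then show "J' y x = cnj (J' x y)" unfolding J'_def by simp
  next
    fix v
    have "Re (qform ?S J v) = (\<Sum>k\<in>?S. (cmod (\<Sum>x\<in>?S. cnj (v x) * u k x))\<^sup>2)"
      by (subst qform_gram[of ?S J u ?S]) (simp_all add: u del: of_real_power)
    also have "\<dots> \<le> (\<Sum>k\<in>?S. (\<Sum>x\<in>?S. (cmod (cnj (v x)))\<^sup>2) * (\<Sum>x\<in>?S. (cmod (u k x))\<^sup>2))"
      by (intro sum_mono cmod_sum_mult_le)
    also have "\<dots> = c * (\<Sum>x\<in>?S. (cmod (v x))\<^sup>2)"
      unfolding c_def sum_distrib_left[symmetric] complex_mod_cnj by (rule mult.commute)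
    finally show "0 \<le> Re (qform ?S J' v)" unfolding qJ' by simp
  qed
  then obtain X T' where X: "channel_kernel A B X" and T'h: "\<And>b b'. T' b' b = cnj (T' b b')"
    and trT': "(\<Sum>b\<in>B. T' b b) = pairing ?S J' X"
    and T'ge: "\<And>l. Re (qform ?S J' l) \<le> (\<Sum>a\<in>A. Re (qform B T' (\<lambda>b. l (a, b))))"
    using channel_duality_max[OF fin \<open>A \<noteq> {}\<close>] by blast
  define T where "T = (\<lambda>b b'. (if b = b' then complex_of_real c else 0) - T' b b')"
  have "T b' b = cnj (T b b')" for b b'
    unfolding T_def T'h[of b b'] by simp
  moreover have "(\<Sum>b\<in>B. T b b) = pairing ?S J X"
  proof -
    have "(\<Sum>x\<in>?S. X x x) = (\<Sum>b\<in>B. marg A X b b)"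
      unfolding marg_def sum.cartesian_product' by (rule sum.swap)
    also have "\<dots> = of_nat (card B)" using X by (simp add: channel_kernel_def)
    finally have trX: "(\<Sum>x\<in>?S. X x x) = of_nat (card B)" .
    have "pairing ?S J' X = (\<Sum>x\<in>?S. \<Sum>y\<in>?S. (if x = y then complex_of_real c * X x x else 0) - J x y * X y x)"
      unfolding pairing_def J'_def by (intro sum.cong refl) (simp add: algebra_simps)
    also have "\<dots> = complex_of_real c * (\<Sum>x\<in>?S. X x x) - pairing ?S J X"
      unfolding sum_subtractf pairing_def sum_distrib_left using finS by simp
    finally show ?thesis
      unfolding T_def sum_subtractf trT' trX by (simp add: mult.commute)
  qed
  moreover have "(\<Sum>a\<in>A. Re (qform B T (\<lambda>b. l (a, b)))) \<le> Re (qform ?S J l)" for l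
  proof -
    have "(\<Sum>a\<in>A. Re (qform B T (\<lambda>b. l (a, b))))
        = (\<Sum>a\<in>A. c * (\<Sum>b\<in>B. (cmod (l (a, b)))\<^sup>2) - Re (qform B T' (\<lambda>b. l (a, b))))"
      unfolding T_def qform_delta_minus[OF fin(2)] by (simp del: of_real_power of_real_sum)
    also have "\<dots> = c * (\<Sum>x\<in>?S. (cmod (l x))\<^sup>2) - (\<Sum>a\<in>A. Re (qform B T' (\<lambda>b. l (a, b))))"
      unfolding sum_subtractf sum.cartesian_product' sum_distrib_left ..
    finally show ?thesis using T'ge[of l] qJ'[of l] by simp
  qed
  ultimately show ?thesis using X by blast
qed

subsection \<open>Matrices and Kraus operators\<close>

lemma sum_lessThan_mult:
  fixes f :: "nat \<Rightarrow> 'a :: comm_monoid_add"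
  shows "(\<Sum>i<n * m. f i) = (\<Sum>a<n. \<Sum>b<m. f (a * m + b))"
proof -
  have "(\<Sum>i<n * m. f i) = (\<Sum>a<n. sum f {a * m..<a * m + m})"
    by (rule sum.nat_group[symmetric])
  also have "\<dots> = (\<Sum>a<n. \<Sum>b<m. f (a * m + b))"
  proof (rule sum.cong[OF refl])
    fix a
    have "sum f {0 + a * m..<m + a * m} = (\<Sum>b = 0..<m. f (b + a * m))"
      by (rule sum.shift_bounds_nat_ivl)
    then show "sum f {a * m..<a * m + m} = (\<Sum>b<m. f (a * m + b))"
      by (simp add: add.commute atLeast0LessThan)
  qed
  finally show ?thesis .
qed

lemma pair_index_less: "a < n \<Longrightarrow> b < m \<Longrightarrow> a * m + b < n * (m :: nat)"
proof -
  assume "a < n" "b < m"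
  then have "a * m + b < Suc a * m" by simp
  also have "\<dots> \<le> n * m" using \<open>a < n\<close> by (intro mult_le_mono1) simp
  finally show ?thesis .
qed

lemma pair_index_cases:
  assumes "i < n * (m :: nat)"
  obtains a b where "a < n" "b < m" "i = a * m + b"
proof -
  have "m > 0" using assms by (cases m) auto
  then have "i div m < n" "i mod m < m" using assms by (auto simp: less_mult_imp_div_less)
  then show ?thesis using that[of "i div m" "i mod m"] by simp
qed

lemma mat_adjoint_index:
  assumes "X \<in> carrier_mat d d" "i < d" "j < d"
  shows "mat_adjoint X $$ (i, j) = cnj (X $$ (j, i))"
  using assms by (simp add: mat_adjoint_def mat_of_rows_index)

lemma hermitian_op_iff:
  "hermitian_op d X \<longleftrightarrow> X \<in> carrier_mat d d \<and> (\<forall>i<d. \<forall>j<d. X $$ (j, i) = cnj (X $$ (i, j)))"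
proof (cases "X \<in> carrier_mat d d")
  case True
  have "mat_adjoint X = X \<longleftrightarrow> (\<forall>i<d. \<forall>j<d. mat_adjoint X $$ (j, i) = X $$ (j, i))"
  proof
    assume *: "\<forall>i<d. \<forall>j<d. mat_adjoint X $$ (j, i) = X $$ (j, i)"
    show "mat_adjoint X = X"
      by (rule eq_matI) (use True * in \<open>auto simp: mat_adjoint_def\<close>)
  qed simp
  also have "\<dots> \<longleftrightarrow> (\<forall>i<d. \<forall>j<d. X $$ (j, i) = cnj (X $$ (i, j)))"
    using mat_adjoint_index[OF True] by metis
  finally show ?thesis using True by (simp add: hermitian_op_def)
qed (simp add: hermitian_op_def)

lemma scalar_prod_qform:
  assumes "X \<in> carrier_mat d d" "v \<in> carrier_vec d"
  shows "(X *\<^sub>v v) \<bullet>c v = qform {..<d} (\<lambda>i j. X $$ (i, j)) (\<lambda>i. v $ i)"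
proof -
  have "(X *\<^sub>v v) \<bullet>c v = (\<Sum>i<d. (\<Sum>j<d. X $$ (i, j) * v $ j) * cnj (v $ i))"
    using assms by (simp add: scalar_prod_def atLeast0LessThan)
  then show ?thesis
    unfolding qform_def by (simp add: sum_distrib_left sum_distrib_right mult_ac)
qed

text \<open>The bridge between matrices and kernels. Matrix positivity speaks of a nonnegative
  complex number, so coming from kernels one also needs that the form is real.\<close>

lemma psd_iff:
  "psd d X \<longleftrightarrow> X \<in> carrier_mat d d \<and> psd_on {..<d} (\<lambda>i j. X $$ (i, j))"
proof (cases "X \<in> carrier_mat d d")
  case True
  let ?f = "\<lambda>i j. X $$ (i, j)"
  have "psd_on {..<d} ?f" if "psd d X"
    unfolding psd_on_def
  proof (intro conjI ballI allI)
    fix i j assume "i \<in> {..<d}" "j \<in> {..<d}"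
    then show "X $$ (j, i) = cnj (X $$ (i, j))"
      using that unfolding psd_def hermitian_op_iff by blast
  next
    fix v
    have "0 \<le> (X *\<^sub>v vec d v) \<bullet>c vec d v"
      using that unfolding psd_def by simp
    then have "0 \<le> qform {..<d} ?f (\<lambda>i. vec d v $ i)"
      using scalar_prod_qform[OF True, of "vec d v"] by simp
    moreover have "qform {..<d} ?f (\<lambda>i. vec d v $ i) = qform {..<d} ?f v"
      by (rule qform_cong) auto
    ultimately show "0 \<le> Re (qform {..<d} ?f v)" by (simp add: less_eq_complex_def)
  qed
  moreover have "psd d X" if f: "psd_on {..<d} ?f"
    unfolding psd_def hermitian_op_iff
  proof (intro conjI ballI allI impI True)
    fix i j assume "i < d" "j < d"
    then show "X $$ (j, i) = cnj (X $$ (i, j))"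
      using psd_on_herm[OF f, of i j] by simp
  next
    fix v :: "complex vec" assume "v \<in> carrier_vec d"
    show "0 \<le> (X *\<^sub>v v) \<bullet>c v"
      unfolding scalar_prod_qform[OF True \<open>v \<in> carrier_vec d\<close>]
      by (subst psd_on_qform_real[OF _ f]) (simp_all add: psd_on_Re_nonneg[OF f] less_eq_complex_def)
  qed
  ultimately show ?thesis using True by blast
qed (simp add: psd_def hermitian_op_def)

section \<open>Bipartite matrices as kernels on pairs\<close>

definition pair_kernel :: "nat \<Rightarrow> complex mat \<Rightarrow> nat \<times> nat \<Rightarrow> nat \<times> nat \<Rightarrow> complex" where
  "pair_kernel m X x y = X $$ (fst x * m + snd x, fst y * m + snd y)"

lemma qform_pair_kernel:
  "qform ({..<n} \<times> {..<m}) (pair_kernel m X) v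
    = qform {..<n * m} (\<lambda>i j. X $$ (i, j)) (\<lambda>i. v (i div m, i mod m))"
  unfolding qform_def sum_lessThan_mult sum.cartesian_product' pair_kernel_def
  by (intro sum.cong refl) auto

lemma psd_pair_kernel:
  assumes "psd (n * m) X"
  shows "psd_on ({..<n} \<times> {..<m}) (pair_kernel m X)"
  unfolding psd_on_def qform_pair_kernel
proof (intro conjI ballI allI)
  have p: "psd_on {..<n * m} (\<lambda>i j. X $$ (i, j))" using assms by (simp add: psd_iff)
  show "0 \<le> Re (qform {..<n * m} (\<lambda>i j. X $$ (i, j)) v)" for v
    by (rule psd_on_Re_nonneg[OF p])
  fix x y assume "x \<in> {..<n} \<times> {..<m}" "y \<in> {..<n} \<times> {..<m}"
  then show "pair_kernel m X y x = cnj (pair_kernel m X x y)"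
    unfolding pair_kernel_def by (intro psd_on_herm[OF p]) (auto intro: pair_index_less)
qed

lemma psd_pair_kernelI:
  assumes X: "X \<in> carrier_mat (n * m) (n * m)"
    and herm: "\<And>a b a' b'. a < n \<Longrightarrow> b < m \<Longrightarrow> a' < n \<Longrightarrow> b' < m \<Longrightarrow>
      X $$ (a' * m + b', a * m + b) = cnj (X $$ (a * m + b, a' * m + b'))"
    and nonneg: "\<And>l. 0 \<le> Re (qform ({..<n} \<times> {..<m}) (pair_kernel m X) l)"
  shows "psd (n * m) X"
  unfolding psd_iff psd_on_def
proof (intro conjI ballI allI X)
  fix i j assume "i \<in> {..<n * m}" "j \<in> {..<n * m}"
  then show "X $$ (j, i) = cnj (X $$ (i, j))"
    using herm by (metis lessThan_iff pair_index_cases)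
next
  fix v
  have "qform ({..<n} \<times> {..<m}) (pair_kernel m X) (\<lambda>(a, b). v (a * m + b)) = qform {..<n * m} (\<lambda>i j. X $$ (i, j)) v"
    unfolding qform_def sum_lessThan_mult sum.cartesian_product' pair_kernel_def by simp
  then show "0 \<le> Re (qform {..<n * m} (\<lambda>i j. X $$ (i, j)) v)"
    using nonneg[of "\<lambda>(a, b). v (a * m + b)"] by simp
qed

lemma amplify_index:
  assumes "r < k" "s < k" "f < dout" "g < dout" "c < m" "c' < m"
  shows "amplify k din dout m T X $$ ((r * dout + f) * m + c, (s * dout + g) * m + c')
    = T (mat din din (\<lambda>(a, b). X $$ ((r * din + a) * m + c, (s * din + b) * m + c'))) $$ (f, g)"
proof -
  have *: "(r * dout + f) * m + c < k * dout * m" "((r * dout + f) * m + c) div m = r * dout + f"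
    "((r * dout + f) * m + c) div (dout * m) = r" "((r * dout + f) * m + c) mod m = c"
    "(r * dout + f) mod dout = f" if "r < k" "f < dout" "c < m" for r f c
  proof -
    show "(r * dout + f) * m + c < k * dout * m" using that by (intro pair_index_less)
    show d: "((r * dout + f) * m + c) div m = r * dout + f" "((r * dout + f) * m + c) mod m = c"
      "(r * dout + f) mod dout = f" using that by auto
    have "((r * dout + f) * m + c) div (dout * m) = ((r * dout + f) * m + c) div m div dout"
      by (simp add: div_mult2_eq mult.commute[of dout])
    then show "((r * dout + f) * m + c) div (dout * m) = r" unfolding d using that by simp
  qed
  show ?thesis
    unfolding amplify_def using *[of r f c] *[of s g c'] assms by simp
qed

lemma amplify_index1:
  assumes "r < k" "s < k" "f < dout" "g < dout"
  shows "amplify k din dout 1 T X $$ (r * dout + f, s * dout + g)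
    = T (mat din din (\<lambda>(a, b). X $$ (r * din + a, s * din + b))) $$ (f, g)"
  using amplify_index[of r k s f dout g 0 1 0 din T X] assms by simp

lemma amplify_carrier: "amplify k din dout m T X \<in> carrier_mat (k * dout * m) (k * dout * m)"
  by (simp add: amplify_def)

section \<open>Matrix units, Kraus operators and Choi operators\<close>

definition munit :: "nat \<Rightarrow> nat \<Rightarrow> nat \<Rightarrow> complex mat" where
  "munit n p q = mat n n (\<lambda>(a, b). if a = p \<and> b = q then 1 else 0)"

lemma linear_op_map_expand:
  assumes T: "linear_op_map n m T" and X: "X \<in> carrier_mat n n" and ij: "i < m" "j < m"
  shows "T X $$ (i, j) = (\<Sum>p<n. \<Sum>q<n. X $$ (p, q) * T (munit n p q) $$ (i, j))"
proof -
  have Tc: "T Y \<in> carrier_mat m m" if "Y \<in> carrier_mat n n" for Y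
    using T that unfolding linear_op_map_def by blast
  have Tadd: "T (Y + Z) = T Y + T Z" if "Y \<in> carrier_mat n n" "Z \<in> carrier_mat n n" for Y Z
    using T that unfolding linear_op_map_def by blast
  have Tsm: "T (c \<cdot>\<^sub>m Y) = c \<cdot>\<^sub>m T Y" if "Y \<in> carrier_mat n n" for c Y
    using T that unfolding linear_op_map_def by blast
  have unit: "munit n p q \<in> carrier_mat n n" for p q by (simp add: munit_def)
  \<comment> \<open>Additivity is given for two summands, so the entries of X are switched on one
    position at a time.\<close>
  have "T (mat n n (\<lambda>p. if p \<in> P then X $$ p else 0)) $$ (i, j) = (\<Sum>p\<in>P. X $$ p * T (munit n (fst p) (snd p)) $$ (i, j))"
    if "finite P" "P \<subseteq> {..<n} \<times> {..<n}" for P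
    using that
  proof (induction P rule: finite_induct)
    case empty
    \<comment> \<open>The zero matrix appears as 0 times a matrix unit, so that homogeneity yields
      its image.\<close>
    have "mat n n (\<lambda>p. if p \<in> {} then X $$ p else 0) = 0 \<cdot>\<^sub>m munit n 0 0"
      by (rule eq_matI) (auto simp: munit_def)
    then show ?case using Tsm[OF unit, of 0 0 0] Tc[OF unit, of 0 0] ij by simp
  next
    case (insert x P)
    have "mat n n (\<lambda>p. if p \<in> insert x P then X $$ p else 0)
        = mat n n (\<lambda>p. if p \<in> P then X $$ p else 0) + X $$ x \<cdot>\<^sub>m munit n (fst x) (snd x)"
      by (rule eq_matI) (use insert in \<open>auto simp: munit_def\<close>)
    then have "T (mat n n (\<lambda>p. if p \<in> insert x P then X $$ p else 0))
        = T (mat n n (\<lambda>p. if p \<in> P then X $$ p else 0)) + X $$ x \<cdot>\<^sub>m T (munit n (fst x) (snd x))"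
      using Tadd Tsm unit by (simp add: mat_carrier smult_carrier_mat)
    moreover have "T (munit n (fst x) (snd x)) \<in> carrier_mat m m"
      "T (mat n n (\<lambda>p. if p \<in> P then X $$ p else 0)) \<in> carrier_mat m m"
      by (intro Tc unit mat_carrier)+
    ultimately show ?case using insert ij by simp
  qed
  from this[of "{..<n} \<times> {..<n}"]
  have "T (mat n n (\<lambda>p. if p \<in> {..<n} \<times> {..<n} then X $$ p else 0)) $$ (i, j)
      = (\<Sum>p<n. \<Sum>q<n. X $$ (p, q) * T (munit n p q) $$ (i, j))"
    by (simp add: sum.cartesian_product')
  moreover have "mat n n (\<lambda>p. if p \<in> {..<n} \<times> {..<n} then X $$ p else 0) = X"
    by (rule eq_matI) (use X in auto)
  ultimately show ?thesis by simp
qed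

definition kraus ::
  "'k set \<Rightarrow> ('k \<Rightarrow> nat \<Rightarrow> nat \<Rightarrow> complex) \<Rightarrow> nat \<Rightarrow> nat \<Rightarrow> complex mat \<Rightarrow> complex mat" where
  "kraus K V n m X = mat m m (\<lambda>(i, j). \<Sum>k\<in>K. \<Sum>p<n. \<Sum>q<n. V k i p * X $$ (p, q) * cnj (V k j q))"

lemma linear_op_map_kraus: "linear_op_map n m (kraus K V n m)"
  unfolding linear_op_map_def
proof (intro conjI ballI allI)
  fix X Y :: "complex mat" and c assume X: "X \<in> carrier_mat n n" and Y: "Y \<in> carrier_mat n n"
  show "kraus K V n m (X + Y) = kraus K V n m X + kraus K V n m Y"
    by (rule eq_matI) (use X Y in \<open>simp_all add: kraus_def sum.distrib algebra_simps\<close>)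
next
  fix X :: "complex mat" and c assume X: "X \<in> carrier_mat n n"
  show "kraus K V n m (c \<cdot>\<^sub>m X) = c \<cdot>\<^sub>m kraus K V n m X"
    by (rule eq_matI) (use X in \<open>simp_all add: kraus_def sum_distrib_left algebra_simps\<close>)
qed (simp add: kraus_def)

text \<open>Images of Gram vectors are Gram vectors: if X has the family u_l, the amplified image
  has the family (1 (x) V_k) u_l, indexed by the pairs (k, l).\<close>

lemma cp_map_kraus:
  assumes "finite K"
  shows "cp_map n m (kraus K V n m)"
  unfolding cp_map_def
proof (intro conjI linear_op_map_kraus allI impI)
  fix r X assume X: "psd (r * n) X"
  then have "psd_on {..<r * n} (\<lambda>i j. X $$ (i, j))" by (simp add: psd_iff)
  from psd_on_obtain_gram[OF _ this]
  obtain u where u: "\<And>i j. i < r * n \<Longrightarrow> j < r * n \<Longrightarrow> X $$ (i, j) = (\<Sum>l<r * n. u l i * cnj (u l j))"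
    by auto
  define w where "w = (\<lambda>q i. \<Sum>p<n. V (fst q) (i mod m) p * u (snd q) (i div m * n + p))"
  have "amplify r n m 1 (kraus K V n m) X $$ (i, j) = (\<Sum>q\<in>K \<times> {..<r * n}. w q i * cnj (w q j))"
    if ij: "i < r * m" "j < r * m" for i j
  proof -
    obtain a f where i: "a < r" "f < m" "i = a * m + f" using ij(1) by (rule pair_index_cases)
    obtain b g where j: "b < r" "g < m" "j = b * m + g" using ij(2) by (rule pair_index_cases)
    have X': "X $$ (a * n + p, b * n + q) = (\<Sum>l<r * n. u l (a * n + p) * cnj (u l (b * n + q)))"
      if "p < n" "q < n" for p q
      by (intro u pair_index_less i(1) j(1) that)
    have "amplify r n m 1 (kraus K V n m) X $$ (i, j)
        = (\<Sum>k\<in>K. \<Sum>p<n. \<Sum>q<n. V k f p * X $$ (a * n + p, b * n + q) * cnj (V k g q))"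
      unfolding i(3) j(3) amplify_index1[OF i(1) j(1) i(2) j(2)] using i(2) j(2)
      by (simp add: kraus_def)
    also have "\<dots> = (\<Sum>k\<in>K. \<Sum>p<n. \<Sum>q<n. \<Sum>l<r * n.
        (V k f p * u l (a * n + p)) * cnj (V k g q * u l (b * n + q)))"
      by (intro sum.cong refl)
        (simp add: X' sum_distrib_left sum_distrib_right mult_ac)
    also have "\<dots> = (\<Sum>k\<in>K. \<Sum>x\<in>{..<n} \<times> {..<n}. \<Sum>l<r * n.
        (V k f (fst x) * u l (a * n + fst x)) * cnj (V k g (snd x) * u l (b * n + snd x)))"
      by (simp add: sum.cartesian_product')
    also have "\<dots> = (\<Sum>k\<in>K. \<Sum>l<r * n. \<Sum>x\<in>{..<n} \<times> {..<n}.
        (V k f (fst x) * u l (a * n + fst x)) * cnj (V k g (snd x) * u l (b * n + snd x)))"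
      by (intro sum.cong refl) (rule sum.swap)
    also have "\<dots> = (\<Sum>q\<in>K \<times> {..<r * n}. w q i * cnj (w q j))"
      using i j by (simp add: w_def sum_product sum.cartesian_product')
    finally show ?thesis .
  qed
  then have "psd_on {..<r * m} (\<lambda>i j. amplify r n m 1 (kraus K V n m) X $$ (i, j))"
    by (intro psd_on_gram[of _ _ w "K \<times> {..<r * n}"]) auto
  then show "psd (r * m) (amplify r n m 1 (kraus K V n m) X)"
    unfolding psd_iff using amplify_carrier[of r n m 1 "kraus K V n m" X] by simp
qed

lemma psd_max_ent: "psd (d * d) (max_ent d)"
proof -
  define w where "w = (\<lambda>(k :: nat) i. if i div d = i mod d then complex_of_real (1 / sqrt (real d)) else 0)"
  have sq: "complex_of_real (1 / sqrt (real d)) * complex_of_real (1 / sqrt (real d)) = 1 / of_nat d"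
    unfolding of_real_mult[symmetric] by simp
  have "psd_on {..<d * d} (\<lambda>i j. max_ent d $$ (i, j))"
    by (rule psd_on_gram[of _ _ w "{0}"]) (use sq in \<open>auto simp: max_ent_def w_def\<close>)
  then show ?thesis by (simp add: psd_iff max_ent_def)
qed

lemma choi_index:
  assumes T: "linear_op_map n m T" and "a < n" "b < n" "x < m" "y < m"
  shows "choi n m T $$ (a * m + x, b * m + y) = T (munit n a b) $$ (x, y) / of_nat n"
proof -
  have "mat n n (\<lambda>(p, q). max_ent n $$ (a * n + p, b * n + q)) = (1 / of_nat n) \<cdot>\<^sub>m munit n a b"
    by (rule eq_matI) (use assms pair_index_less[OF assms(2)] pair_index_less[OF assms(3)] in \<open>auto simp: max_ent_def munit_def\<close>)
  moreover have "T ((1 / of_nat n) \<cdot>\<^sub>m munit n a b) = (1 / of_nat n) \<cdot>\<^sub>m T (munit n a b)"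
    "T (munit n a b) \<in> carrier_mat m m"
    using T unfolding linear_op_map_def by (auto simp: munit_def)
  ultimately show ?thesis
    unfolding choi_def amplify_index1[OF assms(2-5)] using assms by simp
qed

lemma choi_carrier: "choi n m T \<in> carrier_mat (n * m) (n * m)"
  using amplify_carrier[of n n m 1] by (simp add: choi_def)

lemma psd_choi: "cp_map n m T \<Longrightarrow> psd (n * m) (choi n m T)"
  using psd_max_ent unfolding cp_map_def choi_def by blast

text \<open>Choi's theorem: Gram vectors of the Choi operator, reshaped into matrices, are Kraus
  operators. The factor sqrt n undoes the normalisation of \<open>max_ent\<close>.\<close>

lemma cp_map_obtain_kraus:
  assumes T: "cp_map n m T" and "n \<ge> 1"
  shows "\<exists>V. \<forall>X \<in> carrier_mat n n. T X = kraus ({..<n} \<times> {..<m}) V n m X"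
proof -
  have lin: "linear_op_map n m T" using T unfolding cp_map_def by blast
  obtain u where u: "\<And>x y. x \<in> {..<n} \<times> {..<m} \<Longrightarrow> y \<in> {..<n} \<times> {..<m} \<Longrightarrow>
      pair_kernel m (choi n m T) x y = (\<Sum>k\<in>{..<n} \<times> {..<m}. u k x * cnj (u k y))"
    using psd_on_obtain_gram[OF _ psd_pair_kernel[OF psd_choi[OF T]]] by blast
  define V where "V = (\<lambda>k i p. complex_of_real (sqrt (real n)) * u k (p, i))"
  have sq: "complex_of_real (sqrt (real n)) * complex_of_real (sqrt (real n)) = of_nat n"
    unfolding of_real_mult[symmetric] by simp
  have unit: "T (munit n p q) $$ (i, j) = (\<Sum>k\<in>{..<n} \<times> {..<m}. V k i p * cnj (V k j q))"
    if "p < n" "q < n" "i < m" "j < m" for p q i j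
  proof -
    have "T (munit n p q) $$ (i, j) = of_nat n * pair_kernel m (choi n m T) (p, i) (q, j)"
      using choi_index[OF lin that] \<open>n \<ge> 1\<close> by (simp add: pair_kernel_def)
    also have "\<dots> = of_nat n * (\<Sum>k\<in>{..<n} \<times> {..<m}. u k (p, i) * cnj (u k (q, j)))"
      using u that by simp
    also have "\<dots> = (\<Sum>k\<in>{..<n} \<times> {..<m}. V k i p * cnj (V k j q))"
      unfolding V_def sq[symmetric] by (simp add: sum_distrib_left mult_ac)
    finally show ?thesis .
  qed
  have "T X = kraus ({..<n} \<times> {..<m}) V n m X" if X: "X \<in> carrier_mat n n" for X
  proof (rule eq_matI)
    have Tc: "T X \<in> carrier_mat m m" using lin X unfolding linear_op_map_def by blast
    then show "dim_row (T X) = dim_row (kraus ({..<n} \<times> {..<m}) V n m X)"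
      "dim_col (T X) = dim_col (kraus ({..<n} \<times> {..<m}) V n m X)" by (auto simp: kraus_def)
    fix i j assume "i < dim_row (kraus ({..<n} \<times> {..<m}) V n m X)" "j < dim_col (kraus ({..<n} \<times> {..<m}) V n m X)"
    then have ij: "i < m" "j < m" by (auto simp: kraus_def)
    have "T X $$ (i, j) = (\<Sum>p<n. \<Sum>q<n. X $$ (p, q) * T (munit n p q) $$ (i, j))"
      by (rule linear_op_map_expand[OF lin X ij])
    also have "\<dots> = (\<Sum>x\<in>{..<n} \<times> {..<n}. \<Sum>k\<in>{..<n} \<times> {..<m}. V k i (fst x) * X $$ x * cnj (V k j (snd x)))"
      by (simp only: sum.cartesian_product'[of _ "{..<n}" "{..<n}"] fst_conv snd_conv)
        (intro sum.cong refl, simp add: unit ij sum_distrib_left mult_ac)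
    also have "\<dots> = (\<Sum>k\<in>{..<n} \<times> {..<m}. \<Sum>x\<in>{..<n} \<times> {..<n}. V k i (fst x) * X $$ x * cnj (V k j (snd x)))"
      by (rule sum.swap)
    also have "\<dots> = kraus ({..<n} \<times> {..<m}) V n m X $$ (i, j)"
      using ij by (simp add: kraus_def sum.cartesian_product'[of _ "{..<n}" "{..<n}"])
    finally show "T X $$ (i, j) = kraus ({..<n} \<times> {..<m}) V n m X $$ (i, j)" .
  qed
  then show ?thesis by blast
qed

subsection \<open>The effective map of a strategy\<close>

lemma swap_systems_index:
  assumes "f < d2" "g < d2" "m < d1" "m' < d1" "l < d3" "l' < d3"
  shows "swap_systems d1 d2 d3 X $$ ((f * d1 + m) * d3 + l, (g * d1 + m') * d3 + l')
    = X $$ ((m * d2 + f) * d3 + l, (m' * d2 + g) * d3 + l')"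
proof -
  have *: "(f * d1 + m) * d3 + l < d2 * d1 * d3" "((f * d1 + m) * d3 + l) div d3 mod d1 = m"
    "((f * d1 + m) * d3 + l) div (d1 * d3) = f" "((f * d1 + m) * d3 + l) mod d3 = l"
    if "f < d2" "m < d1" "l < d3" for f m l
  proof -
    show "(f * d1 + m) * d3 + l < d2 * d1 * d3" using that by (intro pair_index_less)
    have d: "((f * d1 + m) * d3 + l) div d3 = f * d1 + m" using that by auto
    show "((f * d1 + m) * d3 + l) div d3 mod d1 = m" "((f * d1 + m) * d3 + l) mod d3 = l"
      unfolding d using that by auto
    have "((f * d1 + m) * d3 + l) div (d1 * d3) = ((f * d1 + m) * d3 + l) div d3 div d1"
      by (simp add: div_mult2_eq mult.commute[of d1])
    then show "((f * d1 + m) * d3 + l) div (d1 * d3) = f" unfolding d using that by simp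
  qed
  show ?thesis
    unfolding swap_systems_def Let_def
    using *[of f m l] *[of g m' l'] assms by simp
qed

lemma kron_index:
  assumes "X \<in> carrier_mat p p" "Y \<in> carrier_mat q q" "i < p" "j < p" "k < q" "l < q"
  shows "kron X Y $$ (i * q + k, j * q + l) = X $$ (i, j) * Y $$ (k, l)"
  using assms pair_index_less[of i p k q] pair_index_less[of j p l q] by (simp add: kron_def)

lemma kron_carrier:
  "X \<in> carrier_mat p p \<Longrightarrow> Y \<in> carrier_mat q q \<Longrightarrow> kron X Y \<in> carrier_mat (p * q) (p * q)"
  by (simp add: kron_def)

lemma max_ent_carrier: "max_ent d \<in> carrier_mat (d * d) (d * d)"
  by (simp add: max_ent_def)

lemma max_ent_index:
  assumes "c < d" "c' < d" "e < d" "e' < d"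
  shows "max_ent d $$ (c * d + c', e * d + e') = (if c = c' \<and> e = e' then 1 / of_nat d else 0)"
  using assms pair_index_less[of c d c' d] pair_index_less[of e d e' d] by (simp add: max_ent_def)

text \<open>Contraction with the maximally entangled operator makes each pair of indices diagonal,
  at the price of 1/d. It serves both to close the loop and to evaluate the fidelity at the
  maximally entangled input.\<close>

lemma sum_max_ent:
  "(\<Sum>k<d * d. \<Sum>q<d * d. max_ent d $$ (k, q) * F k q) = (\<Sum>a<d. \<Sum>e<d. F (a * d + a) (e * d + e)) / of_nat d"
proof -
  have "(\<Sum>k<d * d. \<Sum>q<d * d. max_ent d $$ (k, q) * F k q)
      = (\<Sum>a<d. \<Sum>b<d. \<Sum>e<d. \<Sum>e'<d. if e' = e then (if b = a then F (a * d + a) (e * d + e) / of_nat d else 0) else 0)"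
    unfolding sum_lessThan_mult by (intro sum.cong refl) (auto simp: max_ent_index)
  also have "\<dots> = (\<Sum>a<d. \<Sum>b<d. if b = a then (\<Sum>e<d. F (a * d + a) (e * d + e) / of_nat d) else 0)"
    by (intro sum.cong refl) simp
  finally show ?thesis by (simp add: sum_divide_distrib)
qed

text \<open>In the index x of M L, \<open>x div dL\<close> is the incoming message and
  \<open>x mod dL\<close> the memory. The output message indices f and g come from D and are mere
  spectators of E, which is what the system swap achieves.\<close>

lemma strategy_map_index:
  assumes N: "linear_op_map dA dB N" and fg: "f < dM" "g < dM" and ab: "a < dA" "b < dA"
  shows "strategy_map dM dL dA dB E D N X $$ (f * dA + a, g * dA + b)
    = E (mat (dM * dL) (dM * dL) (\<lambda>(x, y).
        D (N (mat dA dA (\<lambda>(c, d). X $$ (x div dL * dA + c, y div dL * dA + d))))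
          $$ (f * dL + x mod dL, g * dL + y mod dL))) $$ (a, b)"
proof -
  let ?Y1 = "amplify dM dA dB 1 N X"
  let ?Y2 = "amplify dM dB (dM * dL) 1 D ?Y1"
  let ?Y3 = "swap_systems dM dM dL ?Y2"
  have "?Y3 $$ (f * (dM * dL) + x, g * (dM * dL) + y)
      = D (N (mat dA dA (\<lambda>(c, d). X $$ (x div dL * dA + c, y div dL * dA + d))))
          $$ (f * dL + x mod dL, g * dL + y mod dL)"
    if x: "x < dM * dL" and y: "y < dM * dL" for x y
  proof -
    obtain m l where m: "m < dM" "l < dL" "x = m * dL + l" using x by (rule pair_index_cases)
    obtain m' l' where m': "m' < dM" "l' < dL" "y = m' * dL + l'" using y by (rule pair_index_cases)
    have x': "f * (dM * dL) + x = (f * dM + m) * dL + l" "g * (dM * dL) + y = (g * dM + m') * dL + l'"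
      unfolding m(3) m'(3) by (simp_all add: algebra_simps)
    have i: "(m * dM + f) * dL + l = m * (dM * dL) + (f * dL + l)"
      "(m' * dM + g) * dL + l' = m' * (dM * dL) + (g * dL + l')"
      by (simp_all add: algebra_simps)
    let ?B = "mat dA dA (\<lambda>(c, d). X $$ (m * dA + c, m' * dA + d))"
    have NB: "N ?B \<in> carrier_mat dB dB" using N unfolding linear_op_map_def by simp
    have B: "mat dB dB (\<lambda>(p, q). ?Y1 $$ (m * dB + p, m' * dB + q)) = N ?B"
      by (rule eq_matI) (use NB in \<open>auto simp: amplify_index1[OF m(1) m'(1)] simp del: One_nat_def\<close>)
    have "?Y3 $$ (f * (dM * dL) + x, g * (dM * dL) + y) = ?Y2 $$ (m * (dM * dL) + (f * dL + l), m' * (dM * dL) + (g * dL + l'))"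
      unfolding x' swap_systems_index[OF fg m(1) m'(1) m(2) m'(2)] i ..
    also have "\<dots> = D (N ?B) $$ (f * dL + l, g * dL + l')"
      unfolding amplify_index1[OF m(1) m'(1) pair_index_less[OF fg(1) m(2)] pair_index_less[OF fg(2) m'(2)]] B ..
    finally show ?thesis using m m' by simp
  qed
  then have *: "mat (dM * dL) (dM * dL) (\<lambda>(x, y). ?Y3 $$ (f * (dM * dL) + x, g * (dM * dL) + y))
      = mat (dM * dL) (dM * dL) (\<lambda>(x, y).
        D (N (mat dA dA (\<lambda>(c, d). X $$ (x div dL * dA + c, y div dL * dA + d))))
          $$ (f * dL + x mod dL, g * dL + y mod dL))"
    by (intro eq_matI) auto
  show ?thesis
    unfolding strategy_map_def amplify_index1[OF fg ab] * ..
qed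

text \<open>The final projection onto the maximally entangled state makes the indices of A and A'
  agree, a in the row and b in the column. A' carries them unchanged past T, so the same a and b
  select the block on which T acts.\<close>

lemma loop_index:
  assumes rs: "r < dR" "s < dR" and fg: "f < dF" "g < dF"
  shows "loop dR dE dF dA T \<rho> $$ (r * dF + f, s * dF + g)
    = 1 / of_nat dA * (\<Sum>a<dA. \<Sum>b<dA.
        T (mat (dE * dA) (dE * dA) (\<lambda>(x, y). kron \<rho> (max_ent dA) $$
          ((r * (dE * dA) + x) * dA + a, (s * (dE * dA) + y) * dA + b))) $$ (f * dA + a, g * dA + b))"
proof -
  define Y where "Y = amplify dR (dE * dA) (dF * dA) dA T (kron \<rho> (max_ent dA))"
  let ?K = "kron (1\<^sub>m (dR * dF)) (max_ent dA)"
  let ?i = "r * dF + f" and ?j = "s * dF + g" and ?Q = "dA * dA"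
  have ij: "?i < dR * dF" "?j < dR * dF" using rs fg by (auto intro: pair_index_less)
  have Kc: "?K \<in> carrier_mat (dR * dF * ?Q) (dR * dF * ?Q)"
    by (rule kron_carrier) (auto simp: max_ent_carrier)
  have Yc: "Y \<in> carrier_mat (dR * dF * ?Q) (dR * dF * ?Q)"
    using amplify_carrier[of dR "dE * dA" "dF * dA" dA T] unfolding Y_def by (simp add: mult.assoc)
  have prod: "(?K * Y) $$ (?i * ?Q + k, ?j * ?Q + k) = (\<Sum>q<?Q. max_ent dA $$ (k, q) * Y $$ (?i * ?Q + q, ?j * ?Q + k))"
    if k: "k < ?Q" for k
  proof -
    note kk = pair_index_less[OF ij(1) k] pair_index_less[OF ij(2) k]
    have "(?K * Y) $$ (?i * ?Q + k, ?j * ?Q + k)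
        = (\<Sum>l<dR * dF * ?Q. ?K $$ (?i * ?Q + k, l) * Y $$ (l, ?j * ?Q + k))"
      using kk Kc Yc by (simp add: scalar_prod_def atLeast0LessThan)
    also have "\<dots> = (\<Sum>p<dR * dF. \<Sum>q<?Q. ?K $$ (?i * ?Q + k, p * ?Q + q) * Y $$ (p * ?Q + q, ?j * ?Q + k))"
      by (rule sum_lessThan_mult)
    also have "\<dots> = (\<Sum>p<dR * dF. if p = ?i then (\<Sum>q<?Q. max_ent dA $$ (k, q) * Y $$ (?i * ?Q + q, ?j * ?Q + k)) else 0)"
    proof (rule sum.cong[OF refl])
      fix p assume "p \<in> {..<dR * dF}"
      then have p: "p < dR * dF" by simp
      have K: "?K $$ (?i * ?Q + k, p * ?Q + q) = (if p = ?i then max_ent dA $$ (k, q) else 0)" if "q < ?Q" for q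
        using kron_index[OF one_carrier_mat max_ent_carrier ij(1) p k that] ij p by simp
      have "(\<Sum>q<?Q. ?K $$ (?i * ?Q + k, p * ?Q + q) * Y $$ (p * ?Q + q, ?j * ?Q + k))
          = (\<Sum>q<?Q. (if p = ?i then max_ent dA $$ (k, q) else 0) * Y $$ (p * ?Q + q, ?j * ?Q + k))"
        by (intro sum.cong refl) (simp only: K lessThan_iff)
      then show "(\<Sum>q<?Q. ?K $$ (?i * ?Q + k, p * ?Q + q) * Y $$ (p * ?Q + q, ?j * ?Q + k))
          = (if p = ?i then (\<Sum>q<?Q. max_ent dA $$ (k, q) * Y $$ (?i * ?Q + q, ?j * ?Q + k)) else 0)"
        by (cases "p = ?i") simp_all
    qed
    finally show ?thesis using ij by simp
  qed
  have Yi: "Y $$ (?i * ?Q + (a * dA + a), ?j * ?Q + (b * dA + b))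
      = T (mat (dE * dA) (dE * dA) (\<lambda>(x, y). kron \<rho> (max_ent dA) $$
          ((r * (dE * dA) + x) * dA + a, (s * (dE * dA) + y) * dA + b))) $$ (f * dA + a, g * dA + b)"
    if "a < dA" "b < dA" for a b
  proof -
    have e: "?i * ?Q + (a * dA + a) = (r * (dF * dA) + (f * dA + a)) * dA + a"
      "?j * ?Q + (b * dA + b) = (s * (dF * dA) + (g * dA + b)) * dA + b"
      by (simp_all add: algebra_simps)
    show ?thesis
      unfolding e Y_def
      by (rule amplify_index[OF rs pair_index_less[OF fg(1) that(1)] pair_index_less[OF fg(2) that(2)] that])
  qed
  have "loop dR dE dF dA T \<rho> $$ (?i, ?j) = (\<Sum>k<?Q. (?K * Y) $$ (?i * ?Q + k, ?j * ?Q + k))"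
    unfolding loop_def Y_def[symmetric] ptrace_snd_def using ij by simp
  also have "\<dots> = (\<Sum>k<?Q. \<Sum>q<?Q. max_ent dA $$ (k, q) * Y $$ (?i * ?Q + q, ?j * ?Q + k))"
    using prod by (intro sum.cong refl) blast
  also have "\<dots> = (\<Sum>c<dA. \<Sum>d<dA. Y $$ (?i * ?Q + (d * dA + d), ?j * ?Q + (c * dA + c))) / of_nat dA"
    by (rule sum_max_ent)
  also have "(\<Sum>c<dA. \<Sum>d<dA. Y $$ (?i * ?Q + (d * dA + d), ?j * ?Q + (c * dA + c)))
      = (\<Sum>d<dA. \<Sum>c<dA. Y $$ (?i * ?Q + (d * dA + d), ?j * ?Q + (c * dA + c)))"
    by (rule sum.swap)
  also have "\<dots> = (\<Sum>a<dA. \<Sum>b<dA.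
        T (mat (dE * dA) (dE * dA) (\<lambda>(x, y). kron \<rho> (max_ent dA) $$
          ((r * (dE * dA) + x) * dA + a, (s * (dE * dA) + y) * dA + b))) $$ (f * dA + a, g * dA + b))"
    by (intro sum.cong refl) (use Yi in auto)
  finally show ?thesis by simp
qed

text \<open>The loop feeds |a><b| into N and reads off entry (a, b) behind E, summed over a and b: a
  trace of a map on operators. Each of the two maximally entangled states contributes one factor
  1/dA.\<close>

lemma retro_map_index:
  assumes N: "linear_op_map dA dB N" and D: "linear_op_map dB (dM * dL) D"
    and \<rho>: "\<rho> \<in> carrier_mat (dR * dM) (dR * dM)"
    and rs: "r < dR" "s < dR" and fg: "f < dM" "g < dM"
  shows "retro_map dM dL dA dB E D N dR \<rho> $$ (r * dM + f, s * dM + g)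
    = 1 / of_nat dA * (\<Sum>a<dA. \<Sum>b<dA.
        E (mat (dM * dL) (dM * dL) (\<lambda>(x, y). \<rho> $$ (r * dM + x div dL, s * dM + y div dL) / of_nat dA *
          D (N (munit dA a b)) $$ (f * dL + x mod dL, g * dL + y mod dL))) $$ (a, b))"
proof -
  have "strategy_map dM dL dA dB E D N
      (mat (dM * dA) (dM * dA) (\<lambda>(x, y). kron \<rho> (max_ent dA) $$
          ((r * (dM * dA) + x) * dA + a, (s * (dM * dA) + y) * dA + b))) $$ (f * dA + a, g * dA + b)
      = E (mat (dM * dL) (dM * dL) (\<lambda>(x, y). \<rho> $$ (r * dM + x div dL, s * dM + y div dL) / of_nat dA *
          D (N (munit dA a b)) $$ (f * dL + x mod dL, g * dL + y mod dL))) $$ (a, b)"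
    (is "strategy_map _ _ _ _ _ _ _ ?X $$ _ = E ?R $$ _")
    if ab: "a < dA" "b < dA" for a b
  proof -
    have "mat (dM * dL) (dM * dL) (\<lambda>(x, y).
        D (N (mat dA dA (\<lambda>(c, d). ?X $$ (x div dL * dA + c, y div dL * dA + d))))
          $$ (f * dL + x mod dL, g * dL + y mod dL)) = ?R"
    proof (rule eq_matI)
      fix x y assume "x < dim_row ?R" "y < dim_col ?R"
      then have xy: "x < dM * dL" "y < dM * dL" by auto
      obtain m l where m: "m < dM" "l < dL" "x = m * dL + l" using xy(1) by (rule pair_index_cases)
      obtain m' l' where m': "m' < dM" "l' < dL" "y = m' * dL + l'" using xy(2) by (rule pair_index_cases)
      let ?c = "\<rho> $$ (r * dM + m, s * dM + m') / of_nat dA"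
      have "mat dA dA (\<lambda>(c, d). ?X $$ (m * dA + c, m' * dA + d)) = ?c \<cdot>\<^sub>m munit dA a b"
      proof (rule eq_matI)
        fix c d assume "c < dim_row (?c \<cdot>\<^sub>m munit dA a b)" "d < dim_col (?c \<cdot>\<^sub>m munit dA a b)"
        then have cd: "c < dA" "d < dA" by (auto simp: munit_def)
        have e: "(r * (dM * dA) + (m * dA + c)) * dA + a = (r * dM + m) * (dA * dA) + (c * dA + a)"
          "(s * (dM * dA) + (m' * dA + d)) * dA + b = (s * dM + m') * (dA * dA) + (d * dA + b)"
          by (simp_all add: algebra_simps)
        have "?X $$ (m * dA + c, m' * dA + d) = \<rho> $$ (r * dM + m, s * dM + m') * max_ent dA $$ (c * dA + a, d * dA + b)"
          using pair_index_less[OF m(1) cd(1)] pair_index_less[OF m'(1) cd(2)]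
            kron_index[OF \<rho> max_ent_carrier pair_index_less[OF rs(1) m(1)] pair_index_less[OF rs(2) m'(1)]
              pair_index_less[OF cd(1) ab(1)] pair_index_less[OF cd(2) ab(2)]]
          by (simp add: e)
        then show "mat dA dA (\<lambda>(c, d). ?X $$ (m * dA + c, m' * dA + d)) $$ (c, d) = (?c \<cdot>\<^sub>m munit dA a b) $$ (c, d)"
          using cd ab by (simp add: max_ent_index munit_def)
      qed (auto simp: munit_def)
      moreover have "munit dA a b \<in> carrier_mat dA dA" by (simp add: munit_def)
      then have "N (?c \<cdot>\<^sub>m munit dA a b) = ?c \<cdot>\<^sub>m N (munit dA a b)" "N (munit dA a b) \<in> carrier_mat dB dB"
        using N unfolding linear_op_map_def by blast+
      then have "D (N (?c \<cdot>\<^sub>m munit dA a b)) = ?c \<cdot>\<^sub>m D (N (munit dA a b))"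
        "D (N (munit dA a b)) \<in> carrier_mat (dM * dL) (dM * dL)"
        using D unfolding linear_op_map_def by auto
      ultimately show "mat (dM * dL) (dM * dL) (\<lambda>(x, y).
        D (N (mat dA dA (\<lambda>(c, d). ?X $$ (x div dL * dA + c, y div dL * dA + d))))
          $$ (f * dL + x mod dL, g * dL + y mod dL)) $$ (x, y) = ?R $$ (x, y)"
        using xy m m' pair_index_less[OF fg(1) m(2)] pair_index_less[OF fg(2) m'(2)] by simp
    qed auto
    then show ?thesis
      unfolding strategy_map_index[OF N fg ab] by simp
  qed
  then show ?thesis
    unfolding retro_map_def loop_index[OF rs fg] by simp
qed

text \<open>The vector on A x B left when a Kraus operator of the encoder and one of the decoder are
  contracted over the memory L, for input message m and output message f. The conjugate compensates
  for the one that \<open>bform\<close> puts on its first argument.\<close>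

definition eff :: "nat \<Rightarrow> ('e \<Rightarrow> nat \<Rightarrow> nat \<Rightarrow> complex) \<Rightarrow> ('d \<Rightarrow> nat \<Rightarrow> nat \<Rightarrow> complex) \<Rightarrow>
    'e \<times> 'd \<Rightarrow> nat \<Rightarrow> nat \<Rightarrow> nat \<times> nat \<Rightarrow> complex" where
  "eff dL VE VD k f m p = cnj (\<Sum>l<dL. VE (fst k) (fst p) (m * dL + l) * VD (snd k) (f * dL + l) (snd p))"

text \<open>The strategy enters through the vectors \<open>eff\<close> and N through its Choi
  kernel, on which the right-hand side depends linearly. Of the two factors 1/dA of the loop, one is
  absorbed by the normalisation of the Choi operator.\<close>

lemma retro_map_kraus:
  fixes VE :: "'e \<Rightarrow> nat \<Rightarrow> nat \<Rightarrow> complex" and VD :: "'d \<Rightarrow> nat \<Rightarrow> nat \<Rightarrow> complex"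
  assumes N: "linear_op_map dA dB N" and D: "linear_op_map dB (dM * dL) D" and "dA \<ge> 1"
    and Dk: "\<And>X. X \<in> carrier_mat dB dB \<Longrightarrow> D X = kraus KD VD dB (dM * dL) X"
    and Ek: "\<And>X. X \<in> carrier_mat (dM * dL) (dM * dL) \<Longrightarrow> E X = kraus KE VE (dM * dL) dA X"
    and \<rho>: "\<rho> \<in> carrier_mat (dR * dM) (dR * dM)"
    and rs: "r < dR" "s < dR" and fg: "f < dM" "g < dM"
  shows "retro_map dM dL dA dB E D N dR \<rho> $$ (r * dM + f, s * dM + g)
    = 1 / of_nat dA * (\<Sum>m<dM. \<Sum>m'<dM. \<rho> $$ (r * dM + m, s * dM + m') *
        (\<Sum>k\<in>KE \<times> KD. bform ({..<dA} \<times> {..<dB}) (pair_kernel dB (choi dA dB N))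
          (eff dL VE VD k f m) (eff dL VE VD k g m')))"
proof -
  define J where "J = pair_kernel dB (choi dA dB N)"
  define t where "t = (\<lambda>a b e m l m' l' d x y. \<rho> $$ (r * dM + m, s * dM + m') *
    (VE e a (m * dL + l) * VD d (f * dL + l) x * J (a, x) (b, y) *
      cnj (VE e b (m' * dL + l')) * cnj (VD d (g * dL + l') y)))"
  have Z: "D (N (munit dA a b)) $$ (i, j)
      = of_nat dA * (\<Sum>d\<in>KD. \<Sum>x<dB. \<Sum>y<dB. VD d i x * J (a, x) (b, y) * cnj (VD d j y))"
    if "a < dA" "b < dA" "i < dM * dL" "j < dM * dL" for a b i j
  proof -
    have "N (munit dA a b) \<in> carrier_mat dB dB" using N unfolding linear_op_map_def by (simp add: munit_def)
    then have "D (N (munit dA a b)) $$ (i, j)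
        = (\<Sum>d\<in>KD. \<Sum>x<dB. \<Sum>y<dB. VD d i x * N (munit dA a b) $$ (x, y) * cnj (VD d j y))"
      using that by (simp add: Dk kraus_def)
    also have "\<dots> = (\<Sum>d\<in>KD. \<Sum>x<dB. \<Sum>y<dB. VD d i x * (of_nat dA * J (a, x) (b, y)) * cnj (VD d j y))"
      using choi_index[OF N that(1,2)] \<open>dA \<ge> 1\<close>
      by (intro sum.cong refl) (simp add: J_def pair_kernel_def)
    finally show ?thesis by (simp add: sum_distrib_left mult_ac)
  qed
  let ?M = "\<lambda>a b. mat (dM * dL) (dM * dL) (\<lambda>(x, y). \<rho> $$ (r * dM + x div dL, s * dM + y div dL) / of_nat dA *
          D (N (munit dA a b)) $$ (f * dL + x mod dL, g * dL + y mod dL))"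
  have EZ: "E (?M a b) $$ (a, b)
      = (\<Sum>e\<in>KE. \<Sum>m<dM. \<Sum>l<dL. \<Sum>m'<dM. \<Sum>l'<dL. \<Sum>d\<in>KD. \<Sum>x<dB. \<Sum>y<dB. t a b e m l m' l' d x y)"
    if ab: "a < dA" "b < dA" for a b
  proof -
    have "E (?M a b) $$ (a, b) = (\<Sum>e\<in>KE. \<Sum>p<dM * dL. \<Sum>q<dM * dL. VE e a p * ?M a b $$ (p, q) * cnj (VE e b q))"
      using ab by (simp add: Ek kraus_def)
    also have "\<dots> = (\<Sum>e\<in>KE. \<Sum>m<dM. \<Sum>l<dL. \<Sum>m'<dM. \<Sum>l'<dL.
        VE e a (m * dL + l) * ?M a b $$ (m * dL + l, m' * dL + l') * cnj (VE e b (m' * dL + l')))"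
      unfolding sum_lessThan_mult ..
    also have "\<dots> = (\<Sum>e\<in>KE. \<Sum>m<dM. \<Sum>l<dL. \<Sum>m'<dM. \<Sum>l'<dL. \<Sum>d\<in>KD. \<Sum>x<dB. \<Sum>y<dB. t a b e m l m' l' d x y)"
    proof (intro sum.cong refl)
      fix e m l m' l' assume "m \<in> {..<dM}" "l \<in> {..<dL}" "m' \<in> {..<dM}" "l' \<in> {..<dL}"
      then have *: "m < dM" "l < dL" "m' < dM" "l' < dL" by auto
      have "?M a b $$ (m * dL + l, m' * dL + l') = \<rho> $$ (r * dM + m, s * dM + m') / of_nat dA *
          D (N (munit dA a b)) $$ (f * dL + l, g * dL + l')"
        using * pair_index_less[OF *(1,2)] pair_index_less[OF *(3,4)] by simp
      also have "\<dots> = \<rho> $$ (r * dM + m, s * dM + m') *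
          (\<Sum>d\<in>KD. \<Sum>x<dB. \<Sum>y<dB. VD d (f * dL + l) x * J (a, x) (b, y) * cnj (VD d (g * dL + l') y))"
        using \<open>dA \<ge> 1\<close> Z[OF ab pair_index_less[OF fg(1) *(2)] pair_index_less[OF fg(2) *(4)]] by simp
      finally show "VE e a (m * dL + l) * ?M a b $$ (m * dL + l, m' * dL + l') * cnj (VE e b (m' * dL + l'))
          = (\<Sum>d\<in>KD. \<Sum>x<dB. \<Sum>y<dB. t a b e m l m' l' d x y)"
        by (simp add: t_def sum_distrib_left sum_distrib_right mult_ac)
    qed
    finally show ?thesis .
  qed
  let ?T = "(\<Sum>a<dA. \<Sum>b<dA. \<Sum>e\<in>KE. \<Sum>m<dM. \<Sum>l<dL. \<Sum>m'<dM. \<Sum>l'<dL. \<Sum>d\<in>KD. \<Sum>x<dB. \<Sum>y<dB. t a b e m l m' l' d x y)"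
  \<comment> \<open>All ten sums are exchanged at once: as one sum over 10-tuples, reindexed by the
    permutation that moves message indices and Kraus labels outwards.\<close>
  have "?T
      = (\<Sum>m<dM. \<Sum>m'<dM. \<Sum>e\<in>KE. \<Sum>d\<in>KD. \<Sum>a<dA. \<Sum>x<dB. \<Sum>b<dA. \<Sum>y<dB. \<Sum>l<dL. \<Sum>l'<dL. t a b e m l m' l' d x y)"
    unfolding sum.cartesian_product
    by (rule sum.reindex_bij_witness[of _
        "\<lambda>(m, m', e, d, a, x, b, y, l, l'). (a, b, e, m, l, m', l', d, x, y)"
        "\<lambda>(a, b, e, m, l, m', l', d, x, y). (m, m', e, d, a, x, b, y, l, l')"]) auto
  also have "\<dots> = (\<Sum>m<dM. \<Sum>m'<dM. \<rho> $$ (r * dM + m, s * dM + m') *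
        (\<Sum>k\<in>KE \<times> KD. bform ({..<dA} \<times> {..<dB}) J (eff dL VE VD k f m) (eff dL VE VD k g m')))"
  proof (intro sum.cong refl)
    fix m m'
    have bf: "bform ({..<dA} \<times> {..<dB}) J (eff dL VE VD (e, d) f m) (eff dL VE VD (e, d) g m')
        = (\<Sum>a<dA. \<Sum>x<dB. \<Sum>b<dA. \<Sum>y<dB. \<Sum>l<dL. \<Sum>l'<dL. VE e a (m * dL + l) * VD d (f * dL + l) x *
            J (a, x) (b, y) * (cnj (VE e b (m' * dL + l')) * cnj (VD d (g * dL + l') y)))" for e d
      unfolding bform_def sum.cartesian_product' eff_def fst_conv snd_conv complex_cnj_cnj cnj_sum complex_cnj_mult
      by (simp only: sum_distrib_right[of _ _ "J _ _"] sum_product)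
    have t: "\<rho> $$ (r * dM + m, s * dM + m') * (VE e a (m * dL + l) * VD d (f * dL + l) x *
            J (a, x) (b, y) * (cnj (VE e b (m' * dL + l')) * cnj (VD d (g * dL + l') y)))
        = t a b e m l m' l' d x y" for a b e l l' d x y
      unfolding t_def by (simp only: mult.assoc)
    show "(\<Sum>e\<in>KE. \<Sum>d\<in>KD. \<Sum>a<dA. \<Sum>x<dB. \<Sum>b<dA. \<Sum>y<dB. \<Sum>l<dL. \<Sum>l'<dL. t a b e m l m' l' d x y)
        = \<rho> $$ (r * dM + m, s * dM + m') *
        (\<Sum>k\<in>KE \<times> KD. bform ({..<dA} \<times> {..<dB}) J (eff dL VE VD k f m) (eff dL VE VD k g m'))"
      unfolding sum.cartesian_product'[of _ KE KD] bf sum_distrib_left t ..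
  qed
  finally have perm: "?T
    = (\<Sum>m<dM. \<Sum>m'<dM. \<rho> $$ (r * dM + m, s * dM + m') *
        (\<Sum>k\<in>KE \<times> KD. bform ({..<dA} \<times> {..<dB}) J (eff dL VE VD k f m) (eff dL VE VD k g m')))" .
  have "(\<Sum>a<dA. \<Sum>b<dA. E (?M a b) $$ (a, b))
      = ?T"
    by (intro sum.cong refl EZ) (simp_all only: lessThan_iff)
  then show ?thesis
    unfolding retro_map_index[OF N D \<rho> rs fg] J_def[symmetric] perm by (rule arg_cong)
qed

subsection \<open>Converse bound\<close>

lemma bform_sum:
  "bform S f (\<lambda>x. \<Sum>r\<in>R. v r x) (\<lambda>x. \<Sum>s\<in>Q. w s x) = (\<Sum>r\<in>R. \<Sum>s\<in>Q. bform S f (v r) (w s))"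
proof -
  have "bform S f (\<lambda>x. \<Sum>r\<in>R. v r x) (\<lambda>x. \<Sum>s\<in>Q. w s x)
      = (\<Sum>p\<in>S \<times> S. \<Sum>q\<in>R \<times> Q. cnj (v (fst q) (fst p)) * f (fst p) (snd p) * w (snd q) (snd p))"
    unfolding bform_def sum.cartesian_product' fst_conv snd_conv cnj_sum
    by (simp only: sum_distrib_right[of _ _ "f _ _"] sum_product)
  also have "\<dots> = (\<Sum>q\<in>R \<times> Q. \<Sum>p\<in>S \<times> S. cnj (v (fst q) (fst p)) * f (fst p) (snd p) * w (snd q) (snd p))"
    by (rule sum.swap)
  finally show ?thesis unfolding bform_def sum.cartesian_product' by simp
qed

text \<open>Cauchy-Schwarz in each Gram component, against the all-ones vector on R. With R the set
  of messages this is the reason why a fidelity weight cannot exceed the trace weight.\<close>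

lemma qform_sum_le:
  assumes "finite S" "psd_on S f"
  shows "Re (qform S f (\<lambda>x. \<Sum>r\<in>R. v r x)) \<le> real (card R) * (\<Sum>r\<in>R. Re (qform S f (v r)))"
proof -
  obtain u where u: "\<And>x y. x \<in> S \<Longrightarrow> y \<in> S \<Longrightarrow> f x y = (\<Sum>k\<in>S. u k x * cnj (u k y))"
    using psd_on_obtain_gram[OF assms] by blast
  have q: "Re (qform S f w) = (\<Sum>k\<in>S. (cmod (\<Sum>x\<in>S. cnj (w x) * u k x))\<^sup>2)" for w
    by (subst qform_gram[of S f u S]) (simp_all add: u[symmetric] del: of_real_power)
  have "Re (qform S f (\<lambda>x. \<Sum>r\<in>R. v r x)) = (\<Sum>k\<in>S. (cmod (\<Sum>r\<in>R. 1 * (\<Sum>x\<in>S. cnj (v r x) * u k x)))\<^sup>2)"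
  proof -
    have "(\<Sum>x\<in>S. cnj (\<Sum>r\<in>R. v r x) * u k x) = (\<Sum>r\<in>R. 1 * (\<Sum>x\<in>S. cnj (v r x) * u k x))" for k
      by (simp only: cnj_sum sum_distrib_right mult_1) (rule sum.swap)
    then show ?thesis unfolding q by simp
  qed
  also have "\<dots> \<le> (\<Sum>k\<in>S. (\<Sum>r\<in>R. (cmod 1)\<^sup>2) * (\<Sum>r\<in>R. (cmod (\<Sum>x\<in>S. cnj (v r x) * u k x))\<^sup>2))"
    by (intro sum_mono cmod_sum_mult_le)
  also have "\<dots> = real (card R) * (\<Sum>k\<in>S. \<Sum>r\<in>R. (cmod (\<Sum>x\<in>S. cnj (v r x) * u k x))\<^sup>2)"
    by (simp add: sum_distrib_left)
  also have "(\<Sum>k\<in>S. \<Sum>r\<in>R. (cmod (\<Sum>x\<in>S. cnj (v r x) * u k x))\<^sup>2) = (\<Sum>r\<in>R. Re (qform S f (v r)))"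
    unfolding q by (rule sum.swap)
  finally show ?thesis .
qed

lemma mtrace_kraus_munit:
  assumes "p < n" "q < n"
  shows "mtrace (kraus K V n m (munit n p q)) = (\<Sum>k\<in>K. \<Sum>i<m. V k i p * cnj (V k i q))"
proof -
  have "(\<Sum>p'<n. \<Sum>q'<n. V k i p' * munit n p q $$ (p', q') * cnj (V k i q')) = V k i p * cnj (V k i q)" for k i
  proof -
    have "(\<Sum>p'<n. \<Sum>q'<n. V k i p' * munit n p q $$ (p', q') * cnj (V k i q'))
        = (\<Sum>p'<n. \<Sum>q'<n. if q' = q then (if p' = p then V k i p * cnj (V k i q) else 0) else 0)"
      by (intro sum.cong refl) (auto simp: munit_def)
    then show ?thesis using assms by simp
  qed
  then have "mtrace (kraus K V n m (munit n p q)) = (\<Sum>i<m. \<Sum>k\<in>K. V k i p * cnj (V k i q))"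
    by (simp add: mtrace_def kraus_def)
  then show ?thesis by (simp only: sum.swap[of _ K])
qed

lemma mtrace_munit: "p < n \<Longrightarrow> q < n \<Longrightarrow> mtrace (munit n p q) = (if p = q then 1 else 0)"
proof -
  assume "p < n" "q < n"
  have "mtrace (munit n p q) = (\<Sum>i<n. if i = p then (if p = q then 1 else 0) else 0)"
    unfolding mtrace_def by (rule sum.cong) (auto simp: munit_def)
  then show ?thesis using \<open>p < n\<close> by simp
qed

lemma mtrace_pure_mult:
  assumes "X \<in> carrier_mat n n" "\<psi> \<in> carrier_mat n n"
    and "\<And>i j. i < n \<Longrightarrow> j < n \<Longrightarrow> \<psi> $$ (i, j) = v i * cnj (v j)"
  shows "mtrace (\<psi> * X) = qform {..<n} (\<lambda>i j. X $$ (i, j)) v"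
proof -
  have "mtrace (\<psi> * X) = (\<Sum>i<n. \<Sum>j<n. \<psi> $$ (i, j) * X $$ (j, i))"
    using assms(1,2) by (simp add: mtrace_def scalar_prod_def atLeast0LessThan)
  also have "\<dots> = (\<Sum>j<n. \<Sum>i<n. \<psi> $$ (i, j) * X $$ (j, i))" by (rule sum.swap)
  also have "\<dots> = qform {..<n} (\<lambda>i j. X $$ (i, j)) v"
    unfolding qform_def by (intro sum.cong refl) (simp add: assms(3))
  finally show ?thesis .
qed

lemma mtrace_psd_real:
  assumes "psd n X"
  shows "mtrace X = complex_of_real (Re (mtrace X))" "0 \<le> Re (mtrace X)"
proof -
  have p: "psd_on {..<n} (\<lambda>i j. X $$ (i, j))" "X \<in> carrier_mat n n" using assms by (simp_all add: psd_iff)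
  have t: "mtrace X = (\<Sum>i<n. X $$ (i, i))" using p(2) by (simp add: mtrace_def)
  have d: "X $$ (i, i) = complex_of_real (Re (X $$ (i, i)))" "0 \<le> Re (X $$ (i, i))" if "i < n" for i
    using psd_on_diag[OF _ p(1), of i] that by simp_all
  have "(\<Sum>i<n. X $$ (i, i)) = (\<Sum>i<n. complex_of_real (Re (X $$ (i, i))))"
    by (rule sum.cong[OF refl], rule d(1)) simp
  then show "mtrace X = complex_of_real (Re (mtrace X))" unfolding t by simp
  show "0 \<le> Re (mtrace X)" unfolding t Re_sum by (intro sum_nonneg d(2)) simp
qed

text \<open>The setting of both directions: the converse enters with Kraus operators extracted from
  an arbitrary strategy, the construction with explicit ones, hence the free types of Kraus
  labels.\<close>

locale kraus_strategy =
  fixes dA dB dM dL :: nat and N E D :: "complex mat \<Rightarrow> complex mat"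
    and KE :: "'e set" and VE :: "'e \<Rightarrow> nat \<Rightarrow> nat \<Rightarrow> complex"
    and KD :: "'d set" and VD :: "'d \<Rightarrow> nat \<Rightarrow> nat \<Rightarrow> complex"
  assumes dA: "dA \<ge> 1" and dM: "dM \<ge> 1" and N: "cp_map dA dB N"
    and D: "linear_op_map dB (dM * dL) D"
    and Dk: "\<And>X. X \<in> carrier_mat dB dB \<Longrightarrow> D X = kraus KD VD dB (dM * dL) X"
    and Ek: "\<And>X. X \<in> carrier_mat (dM * dL) (dM * dL) \<Longrightarrow> E X = kraus KE VE (dM * dL) dA X"
begin

definition "AB = {..<dA} \<times> {..<dB}"

definition "J = pair_kernel dB (choi dA dB N)"

abbreviation "\<theta> \<equiv> eff dL VE VD"

abbreviation "G \<equiv> retro_map dM dL dA dB E D N"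

lemma finite_AB: "finite AB" by (simp add: AB_def)

lemma psd_J: "psd_on AB J"
  unfolding AB_def J_def by (rule psd_pair_kernel[OF psd_choi[OF N]])

lemma linear_N: "linear_op_map dA dB N" using N unfolding cp_map_def by blast

lemma G_index:
  assumes "\<rho> \<in> carrier_mat (dR * dM) (dR * dM)" "r < dR" "s < dR" "f < dM" "g < dM"
  shows "G dR \<rho> $$ (r * dM + f, s * dM + g)
    = 1 / of_nat dA * (\<Sum>m<dM. \<Sum>m'<dM. \<rho> $$ (r * dM + m, s * dM + m') *
        (\<Sum>k\<in>KE \<times> KD. bform AB J (\<theta> k f m) (\<theta> k g m')))"
  unfolding AB_def J_def by (rule retro_map_kraus[OF linear_N D dA Dk Ek assms])

lemma G_carrier: "G dR \<rho> \<in> carrier_mat (dR * dM) (dR * dM)"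
  by (simp add: retro_map_def loop_def ptrace_snd_def)

text \<open>Pairing the vectors \<open>eff\<close> with the Gram vectors of J yields matrices
  \<open>A k j\<close>, which up to the factor 1 / sqrt dA are Kraus operators of the effective map.
  Their images of v form the Gram family of the output.\<close>

lemma psd_G:
  assumes \<rho>: "\<rho> \<in> carrier_mat (dR * dM) (dR * dM)"
    and v: "\<And>i j. i < dR * dM \<Longrightarrow> j < dR * dM \<Longrightarrow> \<rho> $$ (i, j) = v i * cnj (v j)"
  shows "psd (dR * dM) (G dR \<rho>)"
proof -
  obtain u where u: "\<And>x y. x \<in> AB \<Longrightarrow> y \<in> AB \<Longrightarrow> J x y = (\<Sum>j\<in>AB. u j x * cnj (u j y))"
    using psd_on_obtain_gram[OF finite_AB psd_J] by blast
  define A where "A = (\<lambda>k j f m. \<Sum>x\<in>AB. cnj (\<theta> k f m x) * u j x)"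
  have bA: "bform AB J (\<theta> k f m) (\<theta> k g m') = (\<Sum>j\<in>AB. A k j f m * cnj (A k j g m'))" for k f m g m'
    unfolding A_def by (rule bform_gram) (rule u)
  define c where "c = complex_of_real (1 / sqrt (real dA))"
  have cc: "c * c = 1 / of_nat dA" "cnj c = c"
    unfolding c_def of_real_mult[symmetric] by simp_all
  define w where "w = (\<lambda>q i. c * (\<Sum>m<dM. v (i div dM * dM + m) * A (fst q) (snd q) (i mod dM) m))"
  have "G dR \<rho> $$ (i, j) = (\<Sum>q\<in>(KE \<times> KD) \<times> AB. w q i * cnj (w q j))"
    if ij: "i < dR * dM" "j < dR * dM" for i j
  proof -
    obtain r f where i: "r < dR" "f < dM" "i = r * dM + f" using ij(1) by (rule pair_index_cases)
    obtain s g where j: "s < dR" "g < dM" "j = s * dM + g" using ij(2) by (rule pair_index_cases)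
    have "G dR \<rho> $$ (i, j) = 1 / of_nat dA * (\<Sum>m<dM. \<Sum>m'<dM. v (r * dM + m) * cnj (v (s * dM + m')) *
        (\<Sum>q\<in>(KE \<times> KD) \<times> AB. A (fst q) (snd q) f m * cnj (A (fst q) (snd q) g m')))"
      unfolding i(3) j(3) G_index[OF \<rho> i(1) j(1) i(2) j(2)]
      by (simp add: v pair_index_less i(1) j(1) bA sum.cartesian_product'[of _ "KE \<times> KD" AB])
    also have "\<dots> = c * c * (\<Sum>p\<in>{..<dM} \<times> {..<dM}. \<Sum>q\<in>(KE \<times> KD) \<times> AB.
        (v (r * dM + fst p) * A (fst q) (snd q) f (fst p)) * cnj (v (s * dM + snd p) * A (fst q) (snd q) g (snd p)))"
      unfolding cc sum.cartesian_product'[of _ "{..<dM}" "{..<dM}"]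
      by (simp add: sum_distrib_left mult_ac del: sum.cartesian_product')
    also have "\<dots> = c * c * (\<Sum>q\<in>(KE \<times> KD) \<times> AB. \<Sum>p\<in>{..<dM} \<times> {..<dM}.
        (v (r * dM + fst p) * A (fst q) (snd q) f (fst p)) * cnj (v (s * dM + snd p) * A (fst q) (snd q) g (snd p)))"
      by (subst sum.swap) (rule refl)
    also have "\<dots> = (\<Sum>q\<in>(KE \<times> KD) \<times> AB. w q i * cnj (w q j))"
    proof -
      have "w q i * cnj (w q j) = c * c * (\<Sum>p\<in>{..<dM} \<times> {..<dM}.
        (v (r * dM + fst p) * A (fst q) (snd q) f (fst p)) * cnj (v (s * dM + snd p) * A (fst q) (snd q) g (snd p)))" for q
      proof -
        have "w q i * cnj (w q j) = c * c * ((\<Sum>m<dM. v (r * dM + m) * A (fst q) (snd q) f m) *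
          (\<Sum>m<dM. cnj (v (s * dM + m) * A (fst q) (snd q) g m)))"
          unfolding w_def using i j cc(2) by (simp add: mult_ac)
        then show ?thesis
          unfolding sum_product sum.cartesian_product'[of _ "{..<dM}" "{..<dM}"] by simp
      qed
      then show ?thesis by (simp only: sum_distrib_left)
    qed
    finally show ?thesis .
  qed
  then have "psd_on {..<dR * dM} (\<lambda>i j. G dR \<rho> $$ (i, j))"
    by (intro psd_on_gram[of _ _ w "(KE \<times> KD) \<times> AB"]) auto
  then show ?thesis using G_carrier by (simp add: psd_iff)
qed

text \<open>The quotient in \<open>q_infid\<close> is a complex division under \<open>Re\<close>.
  Reality of both traces makes it a real fraction, and its nonnegativity is the lower bound that the
  real infimum requires.\<close>

lemma fidelity_quotient:
  assumes "pure_state (dR * dM) \<psi>"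
  shows "0 \<le> Re (mtrace (\<psi> * G dR \<psi>) / mtrace (G dR \<psi>))"
    "mtrace (\<psi> * G dR \<psi>) = complex_of_real (Re (mtrace (\<psi> * G dR \<psi>)))"
    "mtrace (G dR \<psi>) = complex_of_real (Re (mtrace (G dR \<psi>)))" "0 \<le> Re (mtrace (G dR \<psi>))"
proof -
  obtain v where v: "v \<in> carrier_vec (dR * dM)"
    "\<psi> = mat (dR * dM) (dR * dM) (\<lambda>(i, j). v $ i * conjugate (v $ j))"
    using assms unfolding pure_state_def by blast
  have \<psi>: "\<psi> \<in> carrier_mat (dR * dM) (dR * dM)" by (simp add: v(2))
  have \<psi>v: "\<psi> $$ (i, j) = v $ i * cnj (v $ j)" if "i < dR * dM" "j < dR * dM" for i j
    using that by (simp add: v(2))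
  have p: "psd (dR * dM) (G dR \<psi>)" by (rule psd_G[OF \<psi> \<psi>v])
  then have p': "psd_on {..<dR * dM} (\<lambda>i j. G dR \<psi> $$ (i, j))" by (simp add: psd_iff)
  have n: "mtrace (\<psi> * G dR \<psi>) = qform {..<dR * dM} (\<lambda>i j. G dR \<psi> $$ (i, j)) (\<lambda>i. v $ i)"
    by (rule mtrace_pure_mult[OF G_carrier \<psi>]) (rule \<psi>v)
  have n1: "mtrace (\<psi> * G dR \<psi>) = complex_of_real (Re (mtrace (\<psi> * G dR \<psi>)))"
    unfolding n by (rule psd_on_qform_real[OF _ p']) simp
  have n2: "0 \<le> Re (mtrace (\<psi> * G dR \<psi>))"
    unfolding n by (rule psd_on_Re_nonneg[OF p'])
  note d = mtrace_psd_real[OF p]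
  show "mtrace (\<psi> * G dR \<psi>) = complex_of_real (Re (mtrace (\<psi> * G dR \<psi>)))" by (rule n1)
  show "mtrace (G dR \<psi>) = complex_of_real (Re (mtrace (G dR \<psi>)))" "0 \<le> Re (mtrace (G dR \<psi>))"
    by (rule d)+
  have "mtrace (\<psi> * G dR \<psi>) / mtrace (G dR \<psi>)
      = complex_of_real (Re (mtrace (\<psi> * G dR \<psi>)) / Re (mtrace (G dR \<psi>)))"
    by (subst n1, subst d(1)) simp
  then show "0 \<le> Re (mtrace (\<psi> * G dR \<psi>) / mtrace (G dR \<psi>))"
    using n2 d(2) by simp
qed

end

lemma kraus_channel_completeness:
  assumes T: "channel n m T" and K: "\<And>X. X \<in> carrier_mat n n \<Longrightarrow> T X = kraus K V n m X"
    and pq: "p < n" "q < n"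
  shows "(\<Sum>k\<in>K. \<Sum>i<m. V k i p * cnj (V k i q)) = (if p = q then 1 else 0)"
proof -
  have c: "munit n p q \<in> carrier_mat n n" by (simp add: munit_def)
  then have "mtrace (T (munit n p q)) = mtrace (munit n p q)"
    using T unfolding channel_def by blast
  then show ?thesis unfolding K[OF c] mtrace_kraus_munit[OF pq] mtrace_munit[OF pq] .
qed

lemma pure_state_max_ent:
  assumes "d \<ge> 1"
  shows "pure_state (d * d) (max_ent d)"
proof -
  define c where "c = complex_of_real (1 / sqrt (real d))"
  have cc: "c * c = 1 / of_nat d" "cnj c = c"
    unfolding c_def of_real_mult[symmetric] by simp_all
  define v where "v = vec (d * d) (\<lambda>i. if i div d = i mod d then c else 0)"
  have "v \<bullet>c v = (\<Sum>i<d * d. if i div d = i mod d then 1 / of_nat d else 0)"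
    unfolding v_def scalar_prod_def by (simp add: atLeast0LessThan) (rule sum.cong, auto simp: cc)
  also have "\<dots> = (\<Sum>a<d. \<Sum>b<d. if b = a then 1 / of_nat d else 0)"
    unfolding sum_lessThan_mult by (intro sum.cong refl) auto
  also have "\<dots> = 1" using assms by simp
  finally have "v \<bullet>c v = 1" .
  moreover have "max_ent d = mat (d * d) (d * d) (\<lambda>(i, j). v $ i * conjugate (v $ j))"
    by (rule eq_matI) (auto simp: max_ent_def v_def cc)
  moreover have "v \<in> carrier_vec (d * d)" by (simp add: v_def)
  ultimately show ?thesis unfolding pure_state_def by blast
qed

lemma mtrace_max_ent_mult:
  assumes "X \<in> carrier_mat (d * d) (d * d)"
  shows "mtrace (max_ent d * X) = (\<Sum>r<d. \<Sum>s<d. X $$ (r * d + r, s * d + s)) / of_nat d"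
proof -
  have "mtrace (max_ent d * X) = (\<Sum>i<d * d. \<Sum>j<d * d. max_ent d $$ (i, j) * X $$ (j, i))"
    using assms max_ent_carrier[of d] by (simp add: mtrace_def scalar_prod_def atLeast0LessThan)
  also have "\<dots> = (\<Sum>a<d. \<Sum>e<d. X $$ (e * d + e, a * d + a)) / of_nat d"
    by (rule sum_max_ent)
  also have "(\<Sum>a<d. \<Sum>e<d. X $$ (e * d + e, a * d + a)) = (\<Sum>r<d. \<Sum>s<d. X $$ (r * d + r, s * d + s))"
    by (rule sum.swap)
  finally show ?thesis .
qed

section \<open>Fidelity and trace weights for the maximally entangled input\<close>

definition prod_kernel :: "complex mat \<Rightarrow> nat \<times> nat \<Rightarrow> nat \<times> nat \<Rightarrow> complex" where
  "prod_kernel \<sigma> p q = (if fst p = fst q then \<sigma> $$ (snd p, snd q) else 0)"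

context kraus_strategy
begin

text \<open>Together with \<open>den\<close>: numerator and denominator of the fidelity, without
  their factors 1 / (dA dM^2) and 1 / (dA dM) (\<open>mtrace_num\<close>,
  \<open>mtrace_den\<close>). The kernel is a parameter because the converse evaluates both also at
  1_A (x) \<sigma> and at differences with J.\<close>

definition "num X = (\<Sum>k\<in>KE \<times> KD. qform AB X (\<lambda>p. \<Sum>r<dM. \<theta> k r r p))"

definition "den X = (\<Sum>k\<in>KE \<times> KD. \<Sum>f<dM. \<Sum>r<dM. qform AB X (\<theta> k f r))"

lemma num_bform: "num X = (\<Sum>r<dM. \<Sum>s<dM. \<Sum>k\<in>KE \<times> KD. bform AB X (\<theta> k r r) (\<theta> k s s))"
  unfolding num_def qform_bform bform_sum sum.swap[of _ _ "KE \<times> KD"] ..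

lemma den_bform: "den X = (\<Sum>f<dM. \<Sum>r<dM. \<Sum>k\<in>KE \<times> KD. bform AB X (\<theta> k f r) (\<theta> k f r))"
  unfolding den_def qform_bform sum.swap[of _ _ "KE \<times> KD"] ..

lemma num_nonneg: "psd_on AB X \<Longrightarrow> 0 \<le> Re (num X)"
  unfolding num_def by (simp add: sum_nonneg psd_on_Re_nonneg)

text \<open>By \<open>qform_sum_le\<close>, after adding the nonnegative terms with f different from
  r. It is stated for every positive X because it is applied to \<mu> J - \<pi> (x) \<tau>, in which
  \<tau> alone may fail to be positive.\<close>

lemma num_le_den:
  assumes X: "psd_on AB X"
  shows "Re (num X) \<le> real dM * Re (den X)"
proof -
  have "Re (qform AB X (\<lambda>p. \<Sum>r<dM. \<theta> k r r p)) \<le> real dM * (\<Sum>f<dM. \<Sum>r<dM. Re (qform AB X (\<theta> k f r)))" for k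
  proof -
    have "Re (qform AB X (\<lambda>p. \<Sum>r<dM. \<theta> k r r p)) \<le> real dM * (\<Sum>r<dM. Re (qform AB X (\<theta> k r r)))"
      using qform_sum_le[OF finite_AB X, of "\<lambda>r. \<theta> k r r" "{..<dM}"] by simp
    also have "(\<Sum>r<dM. Re (qform AB X (\<theta> k r r))) \<le> (\<Sum>f<dM. \<Sum>r<dM. Re (qform AB X (\<theta> k f r)))"
      by (intro sum_mono member_le_sum) (auto simp: psd_on_Re_nonneg[OF X])
    finally show ?thesis by (simp add: mult_left_mono)
  qed
  then show ?thesis
    unfolding num_def den_def Re_sum sum_distrib_left[of "real dM" _ "KE \<times> KD"] by (intro sum_mono)
qed

lemma num_lincomb: "num (\<lambda>x y. a * X x y - b * Y x y) = a * num X - b * num Y"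
  by (simp add: num_def qform_def algebra_simps sum_subtractf sum_distrib_left)

lemma den_lincomb: "den (\<lambda>x y. a * X x y - b * Y x y) = a * den X - b * den Y"
  by (simp add: den_def qform_def algebra_simps sum_subtractf sum_distrib_left)

lemma G_max_ent_index:
  assumes rs: "r < dM" "s < dM" and fg: "f < dM" "g < dM"
  shows "G dM (max_ent dM) $$ (r * dM + f, s * dM + g)
    = (\<Sum>k\<in>KE \<times> KD. bform AB J (\<theta> k f r) (\<theta> k g s)) / (of_nat dA * of_nat dM)"
proof -
  let ?F = "\<lambda>m m'. (\<Sum>k\<in>KE \<times> KD. bform AB J (\<theta> k f m) (\<theta> k g m'))"
  have "(\<Sum>m<dM. \<Sum>m'<dM. max_ent dM $$ (r * dM + m, s * dM + m') * ?F m m')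
      = (\<Sum>m<dM. \<Sum>m'<dM. if m' = s then (if m = r then ?F r s / of_nat dM else 0) else 0)"
    by (intro sum.cong refl) (use rs in \<open>auto simp: max_ent_index\<close>)
  also have "\<dots> = ?F r s / of_nat dM" using rs by simp
  finally show ?thesis
    unfolding G_index[OF max_ent_carrier rs fg] by simp
qed

lemma mtrace_num: "mtrace (max_ent dM * G dM (max_ent dM)) = num J / (of_nat dA * (of_nat dM)\<^sup>2)"
proof -
  have "(\<Sum>r<dM. \<Sum>s<dM. G dM (max_ent dM) $$ (r * dM + r, s * dM + s))
      = (\<Sum>r<dM. \<Sum>s<dM. \<Sum>k\<in>KE \<times> KD. bform AB J (\<theta> k r r) (\<theta> k s s)) / (of_nat dA * of_nat dM)"
    unfolding sum_divide_distrib[of _ "{..<dM}"] by (intro sum.cong refl) (simp add: G_max_ent_index)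
  then show ?thesis
    unfolding mtrace_max_ent_mult[OF G_carrier] num_bform by (simp add: power2_eq_square)
qed

lemma mtrace_den: "mtrace (G dM (max_ent dM)) = den J / (of_nat dA * of_nat dM)"
proof -
  have "mtrace (G dM (max_ent dM)) = (\<Sum>i<dM * dM. G dM (max_ent dM) $$ (i, i))"
    using G_carrier[of dM "max_ent dM"] by (simp add: mtrace_def)
  also have "\<dots> = (\<Sum>r<dM. \<Sum>f<dM. \<Sum>k\<in>KE \<times> KD. bform AB J (\<theta> k f r) (\<theta> k f r)) / (of_nat dA * of_nat dM)"
    unfolding sum_lessThan_mult sum_divide_distrib[of _ "{..<dM}"]
    by (intro sum.cong refl) (simp add: G_max_ent_index)
  also have "(\<Sum>r<dM. \<Sum>f<dM. \<Sum>k\<in>KE \<times> KD. bform AB J (\<theta> k f r) (\<theta> k f r)) = den J"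
    unfolding den_bform by (rule sum.swap)
  finally show ?thesis .
qed

text \<open>With the identity on A, the completeness relation of the encoder identifies m with m'
  and l with l'. Only Tr_L D(\<sigma>) is left: the output does not depend on the message.\<close>

lemma bform_prod_kernel:
  assumes cE: "\<And>p q. p < dM * dL \<Longrightarrow> q < dM * dL \<Longrightarrow>
      (\<Sum>e\<in>KE. \<Sum>a<dA. VE e a p * cnj (VE e a q)) = (if p = q then 1 else 0)"
    and \<sigma>: "\<sigma> \<in> carrier_mat dB dB" and fg: "f < dM" "g < dM" and m: "m < dM" "m' < dM"
  shows "(\<Sum>k\<in>KE \<times> KD. bform AB (prod_kernel \<sigma>) (\<theta> k f m) (\<theta> k g m'))
    = (if m = m' then \<Sum>l<dL. D \<sigma> $$ (f * dL + l, g * dL + l) else 0)"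
proof -
  define W where "W = (\<lambda>l l'. \<Sum>d\<in>KD. \<Sum>x<dB. \<Sum>y<dB. VD d (f * dL + l) x * \<sigma> $$ (x, y) * cnj (VD d (g * dL + l') y))"
  have W: "W l l' = D \<sigma> $$ (f * dL + l, g * dL + l')" if "l < dL" "l' < dL" for l l'
    using pair_index_less[OF fg(1) that(1)] pair_index_less[OF fg(2) that(2)]
    by (simp add: W_def Dk[OF \<sigma>] kraus_def)
  have b: "bform AB (prod_kernel \<sigma>) (\<theta> (e, d) f m) (\<theta> (e, d) g m')
      = (\<Sum>a<dA. \<Sum>x<dB. \<Sum>y<dB. \<Sum>l<dL. \<Sum>l'<dL. VE e a (m * dL + l) * VD d (f * dL + l) x *
          \<sigma> $$ (x, y) * (cnj (VE e a (m' * dL + l')) * cnj (VD d (g * dL + l') y)))" for e d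
  proof -
    have "bform AB (prod_kernel \<sigma>) (\<theta> (e, d) f m) (\<theta> (e, d) g m')
      = (\<Sum>a<dA. \<Sum>x<dB. \<Sum>b<dA. if b = a then (\<Sum>y<dB. cnj (\<theta> (e, d) f m (a, x)) * \<sigma> $$ (x, y) * \<theta> (e, d) g m' (a, y)) else 0)"
      unfolding bform_def AB_def sum.cartesian_product' prod_kernel_def fst_conv snd_conv
    proof (intro sum.cong refl)
      fix a x b
      show "(\<Sum>y<dB. cnj (\<theta> (e, d) f m (a, x)) * (if a = b then \<sigma> $$ (x, y) else 0) * \<theta> (e, d) g m' (b, y))
        = (if b = a then \<Sum>y<dB. cnj (\<theta> (e, d) f m (a, x)) * \<sigma> $$ (x, y) * \<theta> (e, d) g m' (a, y) else 0)"
        by (cases "a = b") simp_all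
    qed
    also have "\<dots> = (\<Sum>a<dA. \<Sum>x<dB. \<Sum>y<dB. cnj (\<theta> (e, d) f m (a, x)) * \<sigma> $$ (x, y) * \<theta> (e, d) g m' (a, y))"
      by (rule sum.cong[OF refl], rule sum.cong[OF refl]) simp
    finally show ?thesis
      unfolding eff_def fst_conv snd_conv complex_cnj_cnj cnj_sum complex_cnj_mult
      by (simp only: sum_distrib_right[of _ _ "\<sigma> $$ _"] sum_product)
  qed
  have "(\<Sum>k\<in>KE \<times> KD. bform AB (prod_kernel \<sigma>) (\<theta> k f m) (\<theta> k g m'))
    = (\<Sum>e\<in>KE. \<Sum>d\<in>KD. \<Sum>a<dA. \<Sum>x<dB. \<Sum>y<dB. \<Sum>l<dL. \<Sum>l'<dL. VE e a (m * dL + l) * VD d (f * dL + l) x *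
          \<sigma> $$ (x, y) * (cnj (VE e a (m' * dL + l')) * cnj (VD d (g * dL + l') y)))"
    unfolding sum.cartesian_product' b ..
  also have "\<dots> = (\<Sum>l<dL. \<Sum>l'<dL. \<Sum>e\<in>KE. \<Sum>a<dA. \<Sum>d\<in>KD. \<Sum>x<dB. \<Sum>y<dB. VE e a (m * dL + l) * VD d (f * dL + l) x *
          \<sigma> $$ (x, y) * (cnj (VE e a (m' * dL + l')) * cnj (VD d (g * dL + l') y)))"
    unfolding sum.cartesian_product
    by (rule sum.reindex_bij_witness[of _
        "\<lambda>(l, l', e, a, d, x, y). (e, d, a, x, y, l, l')" "\<lambda>(e, d, a, x, y, l, l'). (l, l', e, a, d, x, y)"]) auto
  also have "\<dots> = (\<Sum>l<dL. \<Sum>l'<dL. (\<Sum>e\<in>KE. \<Sum>a<dA. VE e a (m * dL + l) * cnj (VE e a (m' * dL + l'))) * W l l')"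
  proof (intro sum.cong refl)
    fix l l'
    have "(\<Sum>d\<in>KD. \<Sum>x<dB. \<Sum>y<dB. VE e a (m * dL + l) * VD d (f * dL + l) x *
          \<sigma> $$ (x, y) * (cnj (VE e a (m' * dL + l')) * cnj (VD d (g * dL + l') y)))
        = VE e a (m * dL + l) * cnj (VE e a (m' * dL + l')) * W l l'" for e a
      unfolding W_def by (simp add: sum_distrib_left mult_ac)
    then show "(\<Sum>e\<in>KE. \<Sum>a<dA. \<Sum>d\<in>KD. \<Sum>x<dB. \<Sum>y<dB. VE e a (m * dL + l) * VD d (f * dL + l) x *
          \<sigma> $$ (x, y) * (cnj (VE e a (m' * dL + l')) * cnj (VD d (g * dL + l') y)))
        = (\<Sum>e\<in>KE. \<Sum>a<dA. VE e a (m * dL + l) * cnj (VE e a (m' * dL + l'))) * W l l'"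
      by (simp only: sum_distrib_right)
  qed
  also have "\<dots> = (\<Sum>l<dL. \<Sum>l'<dL. if l' = l then (if m = m' then W l l else 0) else 0)"
  proof (intro sum.cong refl)
    fix l l' assume "l \<in> {..<dL}" "l' \<in> {..<dL}"
    then have l: "l < dL" "l' < dL" by auto
    have "(m * dL + l = m' * dL + l') = (m = m' \<and> l' = l)"
      using l by (metis add.commute add_left_imp_eq div_mult_self3 mod_less mod_mult_self3 div_less add_0_right less_nat_zero_code mult.commute)
    then show "(\<Sum>e\<in>KE. \<Sum>a<dA. VE e a (m * dL + l) * cnj (VE e a (m' * dL + l'))) * W l l'
        = (if l' = l then (if m = m' then W l l else 0) else 0)"
      using cE[OF pair_index_less[OF m(1) l(1)] pair_index_less[OF m(2) l(2)]] by auto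
  qed
  also have "\<dots> = (if m = m' then \<Sum>l<dL. D \<sigma> $$ (f * dL + l, g * dL + l) else 0)"
    using W by simp
  finally show ?thesis .
qed

end

context kraus_strategy
begin

lemma trace_blocks:
  assumes "X \<in> carrier_mat (dM * dL) (dM * dL)"
  shows "(\<Sum>f<dM. \<Sum>l<dL. X $$ (f * dL + l, f * dL + l)) = mtrace X"
  using assms by (simp add: mtrace_def sum_lessThan_mult)

lemma prod_kernel_traces:
  assumes cE: "\<And>p q. p < dM * dL \<Longrightarrow> q < dM * dL \<Longrightarrow>
      (\<Sum>e\<in>KE. \<Sum>a<dA. VE e a p * cnj (VE e a q)) = (if p = q then 1 else 0)"
    and \<sigma>: "\<sigma> \<in> carrier_mat dB dB" and tr: "mtrace (D \<sigma>) = 1"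
  shows "num (prod_kernel \<sigma>) = 1" "den (prod_kernel \<sigma>) = of_nat dM"
proof -
  have Dc: "D \<sigma> \<in> carrier_mat (dM * dL) (dM * dL)" using D \<sigma> unfolding linear_op_map_def by blast
  note b = bform_prod_kernel[OF cE \<sigma>]
  have "num (prod_kernel \<sigma>) = (\<Sum>r<dM. \<Sum>s<dM. if s = r then \<Sum>l<dL. D \<sigma> $$ (r * dL + l, r * dL + l) else 0)"
    unfolding num_bform
  proof (intro sum.cong refl)
    fix r s assume "r \<in> {..<dM}" "s \<in> {..<dM}"
    then have "r < dM" "s < dM" by auto
    then show "(\<Sum>k\<in>KE \<times> KD. bform AB (prod_kernel \<sigma>) (\<theta> k r r) (\<theta> k s s))
        = (if s = r then \<Sum>l<dL. D \<sigma> $$ (r * dL + l, r * dL + l) else 0)"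
      by (subst b) auto
  qed
  also have "\<dots> = (\<Sum>r<dM. \<Sum>l<dL. D \<sigma> $$ (r * dL + l, r * dL + l))" by simp
  also have "\<dots> = 1" unfolding trace_blocks[OF Dc] tr ..
  finally show "num (prod_kernel \<sigma>) = 1" .
  have "den (prod_kernel \<sigma>) = (\<Sum>f<dM. \<Sum>r<dM. \<Sum>l<dL. D \<sigma> $$ (f * dL + l, f * dL + l))"
    unfolding den_bform by (intro sum.cong refl) (subst b, auto)
  also have "\<dots> = of_nat dM * (\<Sum>f<dM. \<Sum>l<dL. D \<sigma> $$ (f * dL + l, f * dL + l))"
    by (simp add: sum_distrib_left)
  also have "\<dots> = of_nat dM" unfolding trace_blocks[OF Dc] tr by simp
  finally show "den (prod_kernel \<sigma>) = of_nat dM" .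
qed

end

lemma pair_kernel_kron_max_mixed:
  assumes "\<sigma> \<in> carrier_mat dB dB" "x \<in> {..<dA} \<times> {..<dB}" "y \<in> {..<dA} \<times> {..<dB}"
  shows "pair_kernel dB (kron (max_mixed dA) \<sigma>) x y = (1 / of_nat dA) * prod_kernel \<sigma> x y"
proof -
  have "max_mixed dA \<in> carrier_mat dA dA" by (simp add: max_mixed_def)
  from kron_index[OF this assms(1), of "fst x" "fst y" "snd x" "snd y"] assms(2,3)
  show ?thesis
    by (auto simp: pair_kernel_def prod_kernel_def max_mixed_def)
qed

lemma psd_pair_kernel_diff:
  assumes "loewner_le (n * m) X Y"
    and "\<And>x y. x \<in> {..<n} \<times> {..<m} \<Longrightarrow> y \<in> {..<n} \<times> {..<m} \<Longrightarrow> pair_kernel m Y x y - pair_kernel m X x y = f x y"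
  shows "psd_on ({..<n} \<times> {..<m}) f"
proof -
  have "psd_on ({..<n} \<times> {..<m}) (pair_kernel m (Y - X))"
    using assms(1) by (intro psd_pair_kernel) (simp add: loewner_le_def)
  moreover have "pair_kernel m (Y - X) x y = f x y" if "x \<in> {..<n} \<times> {..<m}" "y \<in> {..<n} \<times> {..<m}" for x y
    using assms(2)[OF that] assms(1) that by (auto simp: pair_kernel_def pair_index_less loewner_le_def)
  ultimately show ?thesis by (subst psd_on_cong[symmetric]) auto
qed

lemma converse_bound:
  assumes dims: "dA \<ge> 1" "dB \<ge> 1" "dM \<ge> 1" "dL \<ge> 1" and N: "cp_map dA dB N"
    and adm: "admissible_strategy dM dL dA dB E D N" and q: "q_infid dM dL dA dB E D N \<le> \<epsilon>"
    and eps: "0 < \<epsilon>" "\<epsilon> < 1"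
    and \<sigma>: "state dB \<sigma>"
    and le1: "loewner_le (dA * dB) (choi dA dB N) (complex_of_real \<kappa> \<cdot>\<^sub>m kron (max_mixed dA) \<sigma>)"
    and \<tau>: "aff_state dB \<tau>"
    and le2: "loewner_le (dA * dB) (kron (max_mixed dA) \<tau>) (complex_of_real \<mu> \<cdot>\<^sub>m choi dA dB N)"
    and "\<mu> > 0"
  shows "(1 - \<epsilon>) * ((real dM)\<^sup>2 - 1) \<le> \<epsilon> * (\<kappa> * \<mu>)"
proof -
  have chE: "channel (dM * dL) dA E" and chD: "channel dB (dM * dL) D"
    using adm unfolding admissible_strategy_def by auto
  then have cpE: "cp_map (dM * dL) dA E" and cpD: "cp_map dB (dM * dL) D"
    unfolding channel_def by auto
  have "dM * dL \<ge> 1" using dims by simp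
  obtain VE where VE: "\<And>X. X \<in> carrier_mat (dM * dL) (dM * dL) \<Longrightarrow>
      E X = kraus ({..<dM * dL} \<times> {..<dA}) VE (dM * dL) dA X"
    using cp_map_obtain_kraus[OF cpE \<open>dM * dL \<ge> 1\<close>] by blast
  obtain VD where VD: "\<And>X. X \<in> carrier_mat dB dB \<Longrightarrow>
      D X = kraus ({..<dB} \<times> {..<dM * dL}) VD dB (dM * dL) X"
    using cp_map_obtain_kraus[OF cpD dims(2)] by blast
  have linD: "linear_op_map dB (dM * dL) D" using cpD unfolding cp_map_def by blast
  interpret kraus_strategy dA dB dM dL N E D "{..<dM * dL} \<times> {..<dA}" VE "{..<dB} \<times> {..<dM * dL}" VD
    by unfold_locales (use dims N linD VD VE in auto)
  note cE = kraus_channel_completeness[OF chE VE]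
  have trD: "mtrace (D X) = mtrace X" if "X \<in> carrier_mat dB dB" for X
    using chD that unfolding channel_def by blast
  have \<sigma>c: "\<sigma> \<in> carrier_mat dB dB" "mtrace \<sigma> = 1"
    using \<sigma> unfolding state_def psd_def hermitian_op_def by auto
  have \<tau>c: "\<tau> \<in> carrier_mat dB dB" "mtrace \<tau> = 1"
    using \<tau> unfolding aff_state_def hermitian_op_def by auto
  have p\<sigma>: "num (prod_kernel \<sigma>) = 1"
    by (rule prod_kernel_traces(1)[OF cE \<sigma>c(1)]) (use trD \<sigma>c in auto)
  have p\<tau>1: "num (prod_kernel \<tau>) = 1"
    by (rule prod_kernel_traces(1)[OF cE \<tau>c(1)]) (use trD \<tau>c in auto)
  have p\<tau>2: "den (prod_kernel \<tau>) = of_nat dM"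
    by (rule prod_kernel_traces(2)[OF cE \<tau>c(1)]) (use trD \<tau>c in auto)
  have mm: "max_mixed dA \<in> carrier_mat dA dA" by (simp add: max_mixed_def)
  have kc: "kron (max_mixed dA) \<sigma> \<in> carrier_mat (dA * dB) (dA * dB)"
    "kron (max_mixed dA) \<tau> \<in> carrier_mat (dA * dB) (dA * dB)"
    using kron_carrier[OF mm \<sigma>c(1)] kron_carrier[OF mm \<tau>c(1)] by auto
  have "psd_on AB (\<lambda>x y. complex_of_real (\<kappa> / real dA) * prod_kernel \<sigma> x y - 1 * J x y)"
    unfolding AB_def
    by (rule psd_pair_kernel_diff[OF le1], use kc(1) pair_kernel_kron_max_mixed[OF \<sigma>c(1)] in
        \<open>auto simp: J_def pair_kernel_def pair_index_less\<close>)
  from num_nonneg[OF this] have num_le: "Re (num J) \<le> \<kappa> / real dA"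
    unfolding num_lincomb p\<sigma> by simp
  have "psd_on AB (\<lambda>x y. complex_of_real \<mu> * J x y - complex_of_real (1 / real dA) * prod_kernel \<tau> x y)"
    unfolding AB_def
    by (rule psd_pair_kernel_diff[OF le2], use choi_carrier[of dA dB N] pair_kernel_kron_max_mixed[OF \<tau>c(1)] in
        \<open>auto simp: J_def pair_kernel_def pair_index_less\<close>)
  \<comment> \<open>The difference dM den - num is proportional to the weight of failure. It is
    nonnegative at \<mu> J - \<pi> (x) \<tau> and equals (dM^2 - 1) / dA at \<pi> (x)
    \<tau>.\<close>
  from num_le_den[OF this]
  have gap: "\<mu> * Re (num J) - 1 / real dA \<le> real dM * (\<mu> * Re (den J) - real dM / real dA)"
    unfolding num_lincomb den_lincomb p\<tau>1 p\<tau>2 by simp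
  let ?\<phi> = "max_ent dM"
  have pure: "pure_state (dM * dM) ?\<phi>" by (rule pure_state_max_ent[OF dims(3)])
  note fq = fidelity_quotient[OF pure]
  have n: "Re (mtrace (?\<phi> * G dM ?\<phi>)) = Re (num J) / (real dA * (real dM)\<^sup>2)"
    "Re (mtrace (G dM ?\<phi>)) = Re (den J) / (real dA * real dM)"
  proof -
    have "num J / (of_nat dA * (of_nat dM)\<^sup>2) = num J / complex_of_real (real dA * (real dM)\<^sup>2)"
      "den J / (of_nat dA * of_nat dM) = den J / complex_of_real (real dA * real dM)" by simp_all
    then show "Re (mtrace (?\<phi> * G dM ?\<phi>)) = Re (num J) / (real dA * (real dM)\<^sup>2)"
      "Re (mtrace (G dM ?\<phi>)) = Re (den J) / (real dA * real dM)"
      unfolding mtrace_num mtrace_den by (simp_all only: Re_divide_of_real)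
  qed
  have "mtrace (G dM ?\<phi>) \<noteq> 0"
    using adm pure dims(3) unfolding admissible_strategy_def by blast
  then have "Re (mtrace (G dM ?\<phi>)) > 0"
    using fq(3,4) by (metis less_eq_real_def of_real_0)
  moreover have "real dA * real dM > 0" using dims by simp
  ultimately have d0: "Re (den J) > 0" unfolding n by (metis zero_less_divide_iff less_asym)
  have "1 - \<epsilon> \<le> Re (mtrace (?\<phi> * G dM ?\<phi>) / mtrace (G dM ?\<phi>))"
  proof -
    let ?S = "{Re (mtrace (\<psi> * G dR \<psi>) / mtrace (G dR \<psi>)) | dR \<psi>. dR \<ge> 1 \<and> pure_state (dR * dM) \<psi>}"
    have "bdd_below ?S" by (rule bdd_belowI[of _ 0]) (use fidelity_quotient(1) in blast)
    moreover have "Re (mtrace (?\<phi> * G dM ?\<phi>) / mtrace (G dM ?\<phi>)) \<in> ?S" using pure dims(3) by blast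
    ultimately have "Inf ?S \<le> Re (mtrace (?\<phi> * G dM ?\<phi>) / mtrace (G dM ?\<phi>))" by (intro cInf_lower)
    then show ?thesis using q unfolding q_infid_def by linarith
  qed
  also have "\<dots> = Re (num J) / (real dM * Re (den J))"
  proof -
    have "mtrace (?\<phi> * G dM ?\<phi>) / mtrace (G dM ?\<phi>)
        = complex_of_real (Re (mtrace (?\<phi> * G dM ?\<phi>)) / Re (mtrace (G dM ?\<phi>)))"
      unfolding of_real_divide fq(2)[symmetric] fq(3)[symmetric] ..
    then have "Re (mtrace (?\<phi> * G dM ?\<phi>) / mtrace (G dM ?\<phi>))
        = Re (mtrace (?\<phi> * G dM ?\<phi>)) / Re (mtrace (G dM ?\<phi>))"
      by (simp only: Re_complex_of_real)
    then show ?thesis unfolding n using dims d0 by (simp add: field_simps power2_eq_square)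
  qed
  finally have fid: "(1 - \<epsilon>) * (real dM * Re (den J)) \<le> Re (num J)"
    using dims d0 by (simp add: field_simps)
  \<comment> \<open>The chain of weights: failure is at least (dM^2 - 1) / (\<mu> dA) by
    \<open>gap\<close> and at most \<epsilon> / (1 - \<epsilon>) times success by
    \<open>fid\<close>, while success is at most \<kappa> / dA by \<open>num_le\<close>.\<close>
  have "(1 - \<epsilon>) * ((real dM)\<^sup>2 - 1) / real dA
      \<le> (1 - \<epsilon>) * (\<mu> * (real dM * Re (den J) - Re (num J)))"
  proof -
    have "((real dM)\<^sup>2 - 1) / real dA \<le> \<mu> * (real dM * Re (den J) - Re (num J))"
      using gap by (simp add: algebra_simps power2_eq_square diff_divide_distrib)
    then have "(1 - \<epsilon>) * (((real dM)\<^sup>2 - 1) / real dA) \<le> (1 - \<epsilon>) * (\<mu> * (real dM * Re (den J) - Re (num J)))"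
      using eps by (intro mult_left_mono) auto
    then show ?thesis by simp
  qed
  also have "\<dots> = \<mu> * ((1 - \<epsilon>) * (real dM * Re (den J)) - (1 - \<epsilon>) * Re (num J))"
    by (simp add: algebra_simps)
  also have "\<dots> \<le> \<mu> * (\<epsilon> * Re (num J))"
    using fid \<open>\<mu> > 0\<close> by (intro mult_left_mono) (auto simp: algebra_simps)
  also have "\<dots> \<le> \<mu> * (\<epsilon> * (\<kappa> / real dA))"
    using num_le \<open>\<mu> > 0\<close> eps by (intro mult_left_mono) auto
  finally have "(1 - \<epsilon>) * ((real dM)\<^sup>2 - 1) / real dA \<le> \<epsilon> * (\<kappa> * \<mu>) / real dA"
    by (simp add: mult_ac)
  then show ?thesis using dims(1) by (simp add: divide_le_cancel)
qed

subsection \<open>Achievability\<close>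

lemma channel_kraus:
  assumes "finite K"
    and c: "\<And>p q. p < n \<Longrightarrow> q < n \<Longrightarrow> (\<Sum>k\<in>K. \<Sum>i<m. V k i p * cnj (V k i q)) = (if p = q then 1 else 0)"
  shows "channel n m (kraus K V n m)"
  unfolding channel_def
proof (intro conjI ballI cp_map_kraus[OF assms(1)])
  fix X :: "complex mat" assume X: "X \<in> carrier_mat n n"
  have "mtrace (kraus K V n m X) = (\<Sum>i<m. \<Sum>k\<in>K. \<Sum>p<n. \<Sum>q<n. V k i p * X $$ (p, q) * cnj (V k i q))"
    by (simp add: mtrace_def kraus_def)
  also have "\<dots> = (\<Sum>p<n. \<Sum>q<n. \<Sum>k\<in>K. \<Sum>i<m. V k i p * X $$ (p, q) * cnj (V k i q))"
    unfolding sum.cartesian_product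
    by (rule sum.reindex_bij_witness[of _ "\<lambda>(p, q, k, i). (i, k, p, q)" "\<lambda>(i, k, p, q). (p, q, k, i)"]) auto
  also have "\<dots> = (\<Sum>p<n. \<Sum>q<n. X $$ (p, q) * (\<Sum>k\<in>K. \<Sum>i<m. V k i p * cnj (V k i q)))"
    by (simp add: sum_distrib_left mult_ac)
  also have "\<dots> = (\<Sum>p<n. \<Sum>q<n. if q = p then X $$ (p, p) else 0)"
    by (intro sum.cong refl) (use c in auto)
  also have "\<dots> = mtrace X" using X by (simp add: mtrace_def)
  finally show "mtrace (kraus K V n m X) = mtrace X" .
qed

section \<open>Isotropic effective maps\<close>

context kraus_strategy
begin

text \<open>The effective map is X |-> (\<alpha> X + \<beta> Tr(X) 1) / dA, a combination of the
  identity and the completely depolarising map, tested on the matrix units |m><m'|.\<close>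

definition "isotropic \<alpha> \<beta> \<longleftrightarrow> (\<forall>f<dM. \<forall>g<dM. \<forall>m<dM. \<forall>m'<dM.
  (\<Sum>k\<in>KE \<times> KD. bform AB J (\<theta> k f m) (\<theta> k g m'))
  = (if m = f \<and> m' = g then complex_of_real \<alpha> else 0) + (if m = m' \<and> f = g then complex_of_real \<beta> else 0))"

lemma isotropic_index:
  assumes key: "isotropic \<alpha> \<beta>"
    and \<rho>: "\<rho> \<in> carrier_mat (dR * dM) (dR * dM)"
    and rs: "r < dR" "s < dR" and fg: "f < dM" "g < dM"
  shows "G dR \<rho> $$ (r * dM + f, s * dM + g) = (complex_of_real \<alpha> * \<rho> $$ (r * dM + f, s * dM + g)
    + (if f = g then complex_of_real \<beta> * (\<Sum>m<dM. \<rho> $$ (r * dM + m, s * dM + m)) else 0)) / of_nat dA"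
proof -
  let ?\<rho> = "\<lambda>m m'. \<rho> $$ (r * dM + m, s * dM + m')"
  have "(\<Sum>m<dM. \<Sum>m'<dM. ?\<rho> m m' * (\<Sum>k\<in>KE \<times> KD. bform AB J (\<theta> k f m) (\<theta> k g m')))
      = (\<Sum>m<dM. \<Sum>m'<dM. (if m' = g then (if m = f then complex_of_real \<alpha> * ?\<rho> f g else 0) else 0)
          + (if m' = m then (if f = g then complex_of_real \<beta> * ?\<rho> m m else 0) else 0))"
    by (intro sum.cong refl) (use fg in \<open>auto simp: key[unfolded isotropic_def, rule_format] algebra_simps\<close>)
  also have "\<dots> = (\<Sum>m<dM. (if m = f then complex_of_real \<alpha> * ?\<rho> f g else 0)
      + (if f = g then complex_of_real \<beta> * ?\<rho> m m else 0))"
    by (intro sum.cong refl) (use fg in \<open>simp add: sum.distrib\<close>)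
  also have "\<dots> = complex_of_real \<alpha> * ?\<rho> f g + (if f = g then complex_of_real \<beta> * (\<Sum>m<dM. ?\<rho> m m) else 0)"
    using fg by (simp add: sum.distrib sum_distrib_left)
  finally show ?thesis unfolding G_index[OF \<rho> rs fg] by simp
qed

text \<open>The trace is the same for all inputs. In the numerator \<beta> is multiplied by
  \<open>T\<close>, the purity of the reduced state on M, which is at least 1/dM with equality for
  the maximally entangled input. One bound therefore serves all reference systems.\<close>

lemma isotropic_fidelity:
  assumes key: "isotropic \<alpha> \<beta>"
    and pure: "pure_state (dR * dM) \<psi>" and "\<beta> \<ge> 0"
  shows "mtrace (G dR \<psi>) = complex_of_real ((\<alpha> + real dM * \<beta>) / real dA)"
    "Re (mtrace (\<psi> * G dR \<psi>)) \<ge> (\<alpha> + \<beta> / real dM) / real dA"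
proof -
  obtain w where w: "w \<in> carrier_vec (dR * dM)" "w \<bullet>c w = 1"
    "\<psi> = mat (dR * dM) (dR * dM) (\<lambda>(i, j). w $ i * conjugate (w $ j))"
    using pure unfolding pure_state_def by blast
  define v where "v = (\<lambda>i. w $ i)"
  have \<psi>: "\<psi> \<in> carrier_mat (dR * dM) (dR * dM)" by (simp add: w(3))
  have \<psi>v: "\<psi> $$ (i, j) = v i * cnj (v j)" if "i < dR * dM" "j < dR * dM" for i j
    using that by (simp add: w(3) v_def)
  have norm: "(\<Sum>r<dR. \<Sum>f<dM. v (r * dM + f) * cnj (v (r * dM + f))) = 1"
  proof -
    have "w \<bullet>c w = (\<Sum>i<dR * dM. v i * cnj (v i))"
      using w(1) by (simp add: scalar_prod_def v_def atLeast0LessThan)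
    then show ?thesis using w(2) by (simp add: sum_lessThan_mult)
  qed
  have \<psi>': "\<psi> $$ (r * dM + f, s * dM + g) = v (r * dM + f) * cnj (v (s * dM + g))"
    if "r < dR" "s < dR" "f < dM" "g < dM" for r s f g
    by (intro \<psi>v pair_index_less that)
  have Gi: "G dR \<psi> $$ (r * dM + f, s * dM + g) = (complex_of_real \<alpha> * (v (r * dM + f) * cnj (v (s * dM + g)))
    + (if f = g then complex_of_real \<beta> * (\<Sum>m<dM. v (r * dM + m) * cnj (v (s * dM + m))) else 0)) / of_nat dA"
    if "r < dR" "s < dR" "f < dM" "g < dM" for r s f g
    using isotropic_index[OF key \<psi> that] \<psi>' that by simp
  have "mtrace (G dR \<psi>) = (\<Sum>i<dR * dM. G dR \<psi> $$ (i, i))"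
    using G_carrier[of dR \<psi>] by (simp add: mtrace_def)
  also have "\<dots> = (\<Sum>r<dR. \<Sum>f<dM. (complex_of_real \<alpha> * (v (r * dM + f) * cnj (v (r * dM + f)))
    + complex_of_real \<beta> * (\<Sum>m<dM. v (r * dM + m) * cnj (v (r * dM + m)))) / of_nat dA)"
    unfolding sum_lessThan_mult by (intro sum.cong refl) (simp add: Gi)
  also have "\<dots> = (complex_of_real \<alpha> * (\<Sum>r<dR. \<Sum>f<dM. v (r * dM + f) * cnj (v (r * dM + f)))
     + of_nat dM * complex_of_real \<beta> * (\<Sum>r<dR. \<Sum>m<dM. v (r * dM + m) * cnj (v (r * dM + m)))) / of_nat dA"
    by (simp add: sum_divide_distrib[symmetric] sum.distrib sum_distrib_left mult.assoc)
  finally show "mtrace (G dR \<psi>) = complex_of_real ((\<alpha> + real dM * \<beta>) / real dA)"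
    unfolding norm by simp
  define z where "z = (\<lambda>f m. \<Sum>r<dR. cnj (v (r * dM + f)) * v (r * dM + m))"
  define T where "T = (\<Sum>f<dM. \<Sum>m<dM. (cmod (z f m))\<^sup>2)"
  have "mtrace (\<psi> * G dR \<psi>) = qform {..<dR * dM} (\<lambda>i j. G dR \<psi> $$ (i, j)) v"
    by (rule mtrace_pure_mult[OF G_carrier \<psi>]) (rule \<psi>v)
  also have "\<dots> = (\<Sum>r<dR. \<Sum>f<dM. \<Sum>s<dR. \<Sum>g<dM. cnj (v (r * dM + f)) * G dR \<psi> $$ (r * dM + f, s * dM + g) * v (s * dM + g))"
    unfolding qform_def sum_lessThan_mult ..
  also have "\<dots> = (\<Sum>r<dR. \<Sum>f<dM. \<Sum>s<dR. \<Sum>g<dM.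
      complex_of_real (\<alpha> / real dA) * ((v (r * dM + f) * cnj (v (r * dM + f))) * (v (s * dM + g) * cnj (v (s * dM + g))))
      + (if g = f then complex_of_real (\<beta> / real dA) * (\<Sum>m<dM. (cnj (v (r * dM + f)) * v (r * dM + m)) *
          cnj (cnj (v (s * dM + f)) * v (s * dM + m))) else 0))"
  proof (intro sum.cong refl)
    fix r f s g assume "r \<in> {..<dR}" "f \<in> {..<dM}" "s \<in> {..<dR}" "g \<in> {..<dM}"
    then have *: "r < dR" "s < dR" "f < dM" "g < dM" by auto
    show "cnj (v (r * dM + f)) * G dR \<psi> $$ (r * dM + f, s * dM + g) * v (s * dM + g) =
      complex_of_real (\<alpha> / real dA) * ((v (r * dM + f) * cnj (v (r * dM + f))) * (v (s * dM + g) * cnj (v (s * dM + g))))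
      + (if g = f then complex_of_real (\<beta> / real dA) * (\<Sum>m<dM. (cnj (v (r * dM + f)) * v (r * dM + m)) *
          cnj (cnj (v (s * dM + f)) * v (s * dM + m))) else 0)"
      unfolding Gi[OF *]
      by (cases "g = f") (simp_all add: sum_distrib_left sum_distrib_right sum_divide_distrib add_divide_distrib distrib_left distrib_right mult_ac)
  qed
  also have "\<dots> = complex_of_real (\<alpha> / real dA) * ((\<Sum>r<dR. \<Sum>f<dM. v (r * dM + f) * cnj (v (r * dM + f))) *
        (\<Sum>s<dR. \<Sum>g<dM. v (s * dM + g) * cnj (v (s * dM + g))))
      + complex_of_real (\<beta> / real dA) * (\<Sum>r<dR. \<Sum>f<dM. \<Sum>s<dR. \<Sum>m<dM. (cnj (v (r * dM + f)) * v (r * dM + m)) *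
          cnj (cnj (v (s * dM + f)) * v (s * dM + m)))"
  proof -
    have P: "(\<Sum>r<dR. \<Sum>f<dM. a r f) * (\<Sum>s<dR. \<Sum>g<dM. a s g) = (\<Sum>r<dR. \<Sum>f<dM. \<Sum>s<dR. \<Sum>g<dM. a r f * a s g)"
      for a :: "nat \<Rightarrow> nat \<Rightarrow> complex"
      by (subst sum_distrib_right)+ (simp only: sum_distrib_right sum_distrib_left)
    have Q: "(\<Sum>r<dR. \<Sum>f<dM. \<Sum>s<dR. \<Sum>g<dM. if g = f then b r f s else 0) = (\<Sum>r<dR. \<Sum>f<dM. \<Sum>s<dR. b r f s)"
      for b :: "nat \<Rightarrow> nat \<Rightarrow> nat \<Rightarrow> complex"
      by (intro sum.cong refl) simp
    show ?thesis unfolding P by (simp only: sum.distrib Q sum_distrib_left)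
  qed
  also have "(\<Sum>r<dR. \<Sum>f<dM. \<Sum>s<dR. \<Sum>m<dM. (cnj (v (r * dM + f)) * v (r * dM + m)) *
          cnj (cnj (v (s * dM + f)) * v (s * dM + m)))
      = (\<Sum>f<dM. \<Sum>m<dM. \<Sum>r<dR. \<Sum>s<dR. (cnj (v (r * dM + f)) * v (r * dM + m)) *
          cnj (cnj (v (s * dM + f)) * v (s * dM + m)))"
    unfolding sum.cartesian_product
    by (rule sum.reindex_bij_witness[of _ "\<lambda>(f, m, r, s). (r, f, s, m)" "\<lambda>(r, f, s, m). (f, m, r, s)"]) auto
  also have "\<dots> = complex_of_real T"
    unfolding T_def z_def of_real_sum complex_norm_square cnj_sum sum_product ..
  finally have num: "mtrace (\<psi> * G dR \<psi>) = complex_of_real ((\<alpha> + \<beta> * T) / real dA)"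
    unfolding norm by (simp add: add_divide_distrib)
  \<comment> \<open>Cauchy-Schwarz on the dM diagonal entries of \<open>z\<close>, which sum to 1;
    the off-diagonal ones can only increase \<open>T\<close>.\<close>
  have "1 \<le> real dM * T"
  proof -
    have "(\<Sum>f<dM. 1 * z f f) = (1 :: complex)"
    proof -
      have "(\<Sum>f<dM. 1 * z f f) = (\<Sum>r<dR. \<Sum>f<dM. cnj (v (r * dM + f)) * v (r * dM + f))"
        unfolding z_def mult_1 by (rule sum.swap)
      then show ?thesis using norm by (simp add: mult.commute)
    qed
    then have "1 = (cmod (\<Sum>f<dM. 1 * z f f))\<^sup>2" by simp
    also have "\<dots> \<le> (\<Sum>f<dM. (cmod 1)\<^sup>2) * (\<Sum>f<dM. (cmod (z f f))\<^sup>2)"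
      by (rule cmod_sum_mult_le)
    also have "\<dots> = real dM * (\<Sum>f<dM. (cmod (z f f))\<^sup>2)" by simp
    also have "\<dots> \<le> real dM * T"
      unfolding T_def by (intro mult_left_mono sum_mono member_le_sum) auto
    finally show ?thesis .
  qed
  then have "1 / real dM \<le> T" using dM by (simp add: field_simps)
  then have "\<beta> * (1 / real dM) \<le> \<beta> * T" using \<open>\<beta> \<ge> 0\<close> by (intro mult_left_mono)
  then show "Re (mtrace (\<psi> * G dR \<psi>)) \<ge> (\<alpha> + \<beta> / real dM) / real dA"
    unfolding num Re_complex_of_real by (intro divide_right_mono) auto
qed

lemma isotropic_infidelity:
  assumes key: "isotropic \<alpha> \<beta>"
    and "\<beta> \<ge> 0" and pos: "\<alpha> + real dM * \<beta> > 0"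
    and le: "(1 - \<epsilon>) * (\<alpha> + real dM * \<beta>) \<le> \<alpha> + \<beta> / real dM"
    and chE: "channel (dM * dL) dA E" and chD: "channel dB (dM * dL) D"
  shows "admissible_strategy dM dL dA dB E D N" "q_infid dM dL dA dB E D N \<le> \<epsilon>"
proof -
  note fid = isotropic_fidelity[OF key _ \<open>\<beta> \<ge> 0\<close>]
  have dpos: "(\<alpha> + real dM * \<beta>) / real dA > 0" using pos dA by simp
  show "admissible_strategy dM dL dA dB E D N"
    unfolding admissible_strategy_def
  proof (intro conjI chE chD allI impI)
    fix dR \<psi> assume "dR \<ge> 1 \<and> pure_state (dR * dM) \<psi>"
    then have "mtrace (G dR \<psi>) = complex_of_real ((\<alpha> + real dM * \<beta>) / real dA)"
      by (intro fid(1)) auto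
    then show "mtrace (G dR \<psi>) \<noteq> 0" using dpos by (metis less_irrefl of_real_eq_0_iff)
  qed
  let ?S = "{Re (mtrace (\<psi> * G dR \<psi>) / mtrace (G dR \<psi>)) | dR \<psi>. dR \<ge> 1 \<and> pure_state (dR * dM) \<psi>}"
  have "1 - \<epsilon> \<le> Inf ?S"
  proof (rule cInf_greatest)
    show "?S \<noteq> {}" using pure_state_max_ent[OF dM] dM by blast
    fix x assume "x \<in> ?S"
    then obtain dR \<psi> where x: "x = Re (mtrace (\<psi> * G dR \<psi>) / mtrace (G dR \<psi>))" "pure_state (dR * dM) \<psi>"
      by blast
    have d: "mtrace (G dR \<psi>) = complex_of_real ((\<alpha> + real dM * \<beta>) / real dA)"
      by (rule isotropic_fidelity(1)[OF key x(2) \<open>\<beta> \<ge> 0\<close>])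
    have n: "Re (mtrace (\<psi> * G dR \<psi>)) \<ge> (\<alpha> + \<beta> / real dM) / real dA"
      by (rule isotropic_fidelity(2)[OF key x(2) \<open>\<beta> \<ge> 0\<close>])
    have "(1 - \<epsilon>) * ((\<alpha> + real dM * \<beta>) / real dA) \<le> (\<alpha> + \<beta> / real dM) / real dA"
      using le dA by (simp add: divide_right_mono)
    also note n
    finally show "1 - \<epsilon> \<le> x"
      unfolding x(1) d Re_divide_of_real using dpos by (subst pos_le_divide_eq) auto
  qed
  then show "q_infid dM dL dA dB E D N \<le> \<epsilon>"
    unfolding q_infid_def by linarith
qed

end

section \<open>The teleportation strategy\<close>

lemma bform_scale:
  "bform S f (\<lambda>x. \<alpha> * v x) (\<lambda>x. \<beta> * w x) = cnj \<alpha> * \<beta> * bform S f v w"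
  by (simp add: bform_def sum_distrib_left mult_ac)

lemma bform_cong:
  assumes "\<And>x. x \<in> S \<Longrightarrow> v x = v' x" "\<And>x. x \<in> S \<Longrightarrow> w x = w' x"
  shows "bform S f v w = bform S f v' w'"
  unfolding bform_def using assms by (intro sum.cong refl) auto

text \<open>Matrix elements of the projector onto the complement of the maximally entangled state.\<close>

definition compl_ent :: "nat \<Rightarrow> nat \<Rightarrow> nat \<Rightarrow> nat \<Rightarrow> nat \<Rightarrow> complex" where
  "compl_ent d p q m n = (if p = m \<and> q = n then 1 else 0) - (if p = q \<and> m = n then 1 / of_nat d else 0)"

lemma compl_ent_cnj: "cnj (compl_ent d p q m n) = compl_ent d p q m n"
  by (simp add: compl_ent_def)

lemma compl_ent_idem:
  assumes "m < d" "f < d" "m' < d" "g < d"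
  shows "(\<Sum>p<d. \<Sum>q<d. compl_ent d p q m f * compl_ent d p q m' g)
    = (if m = m' \<and> f = g then 1 else 0) - (if m = f \<and> m' = g then 1 / of_nat d else 0)"
proof -
  \<comment> \<open>Of the four products the first sums to A, each cross term to -X and the last to
    +X, so that A - X remains.\<close>
  define X :: complex where "X = (if m = f \<and> m' = g then 1 / of_nat d else 0)"
  define A :: complex where "A = (if m = m' \<and> f = g then 1 else 0)"
  have "(\<Sum>p<d. \<Sum>q<d. compl_ent d p q m f * compl_ent d p q m' g)
      = (\<Sum>p<d. \<Sum>q<d. (if q = f then (if p = m then A - X else 0) else 0)
          - (if q = g then (if p = m' then X else 0) else 0) + (if q = p then X / of_nat d else 0))"
    by (intro sum.cong refl) (auto simp: compl_ent_def A_def X_def diff_divide_distrib algebra_simps)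
  also have "\<dots> = (\<Sum>p<d. (if p = m then A - X else 0) - (if p = m' then X else 0) + X / of_nat d)"
    using assms by (intro sum.cong refl) (simp add: sum.distrib sum_subtractf)
  also have "\<dots> = A - X"
    using assms by (simp add: sum.distrib sum_subtractf)
  finally show ?thesis by (simp add: A_def X_def)
qed

text \<open>The constraint Tr_A X = 1 read as a completeness relation: the conjugated Gram vectors
  are Kraus operators of a channel from B to A.\<close>

lemma channel_kernel_gram_complete:
  assumes X: "channel_kernel A B X" and b: "b \<in> B" "b' \<in> B"
    and u: "\<And>x y. x \<in> A \<times> B \<Longrightarrow> y \<in> A \<times> B \<Longrightarrow> X x y = (\<Sum>k\<in>K. u k x * cnj (u k y))"
  shows "(\<Sum>k\<in>K. \<Sum>a\<in>A. cnj (u k (a, b)) * u k (a, b')) = (if b = b' then 1 else 0)"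
proof -
  have "(\<Sum>k\<in>K. \<Sum>a\<in>A. cnj (u k (a, b)) * u k (a, b')) = (\<Sum>a\<in>A. \<Sum>k\<in>K. cnj (u k (a, b)) * u k (a, b'))"
    by (rule sum.swap)
  also have "\<dots> = marg A X b' b"
    unfolding marg_def by (intro sum.cong refl) (use b in \<open>simp add: u mult.commute\<close>)
  finally show ?thesis using X b unfolding channel_kernel_def by auto
qed

text \<open>The decoder attaches a maximally entangled pair \<open>M M'\<close> to \<open>B\<close>, and the encoder tests whether the
  input and \<open>M'\<close> are maximally entangled (so that the message is teleported to \<open>M\<close>). On success it applies
  the channel with kernel \<open>X1\<close> to \<open>B\<close>, which gives a large loop weight; on failure the one with kernel
  \<open>X2\<close>, which gives a small one.\<close>

lemma achievability:
  assumes dims: "dA \<ge> 1" "dB \<ge> 1" "dM \<ge> 1" and N: "cp_map dA dB N"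
    and X1: "channel_kernel {..<dA} {..<dB} X1" and X2: "channel_kernel {..<dA} {..<dB} X2"
    and p1: "pairing ({..<dA} \<times> {..<dB}) (pair_kernel dB (choi dA dB N)) X1 = complex_of_real p1"
    and p2: "pairing ({..<dA} \<times> {..<dB}) (pair_kernel dB (choi dA dB N)) X2 = complex_of_real p2"
    and "p1 > 0" "p2 \<ge> 0"
    and le: "(1 - \<epsilon>) * (p2 * ((real dM)\<^sup>2 - 1)) \<le> \<epsilon> * p1"
  shows "\<exists>dL E D. dL \<ge> 1 \<and> admissible_strategy dM dL dA dB E D N \<and> q_infid dM dL dA dB E D N \<le> \<epsilon>"
proof -
  let ?S = "{..<dA} \<times> {..<dB}"
  let ?J = "pair_kernel dB (choi dA dB N)"
  have finS: "finite ?S" by simp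
  obtain u1 where u1: "\<And>x y. x \<in> ?S \<Longrightarrow> y \<in> ?S \<Longrightarrow> X1 x y = (\<Sum>k\<in>?S. u1 k x * cnj (u1 k y))"
    using psd_on_obtain_gram[OF finS] X1 unfolding channel_kernel_def by blast
  obtain u2 where u2: "\<And>x y. x \<in> ?S \<Longrightarrow> y \<in> ?S \<Longrightarrow> X2 x y = (\<Sum>k\<in>?S. u2 k x * cnj (u2 k y))"
    using psd_on_obtain_gram[OF finS] X2 unfolding channel_kernel_def by blast
  have q1: "(\<Sum>k\<in>?S. qform ?S ?J (u1 k)) = complex_of_real p1"
    unfolding p1[symmetric] by (rule pairing_gram[symmetric]) (rule u1)
  have q2: "(\<Sum>k\<in>?S. qform ?S ?J (u2 k)) = complex_of_real p2"
    unfolding p2[symmetric] by (rule pairing_gram[symmetric]) (rule u2)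
  \<comment> \<open>The memory L consists of M' and B: an index of M L is m * dL + (n * dB + b),
    with message m, index n of M' and b of B.\<close>
  define dL where "dL = dM * dB"
  have dL: "dL \<ge> 1" using dims by (simp add: dL_def)
  define c where "c = complex_of_real (1 / sqrt (real dM))"
  have cc: "c * c = 1 / of_nat dM" "cnj c = c"
    unfolding c_def of_real_mult[symmetric] by simp_all
  define Q where "Q = {..<dM} \<times> {..<dM}"
  define KE where "KE = ?S <+> (?S \<times> Q)"
  \<comment> \<open>\<open>Inl\<close> is success: the projection of M M' onto the maximally
    entangled vector, with amplitude c, followed by the channel of \<open>X1\<close>.
    \<open>Inr\<close> is failure: row (p, q) of \<open>compl_ent\<close>, followed by the channel
    of \<open>X2\<close>. One Kraus operator per row is needed because the output A does not keep M
    M'.\<close>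
  define VE where "VE = (\<lambda>e a i. case e of
      Inl k \<Rightarrow> (if i div dL = i mod dL div dB then c * cnj (u1 k (a, i mod dL mod dB)) else 0)
    | Inr (k, p, q) \<Rightarrow> compl_ent dM p q (i div dL) (i mod dL div dB) * cnj (u2 k (a, i mod dL mod dB)))"
  \<comment> \<open>An isometry, hence a single Kraus operator: it passes B on to L and creates the
    entangled pair of output message and M', with amplitude c = 1 / sqrt dM per term.\<close>
  define VD where "VD = (\<lambda>(d :: unit) i x. if i div dL = i mod dL div dB \<and> i mod dL mod dB = x then c else (0 :: complex))"
  have finKE: "finite KE" by (simp add: KE_def Q_def)
  have sumKE: "(\<Sum>e\<in>KE. F e) = (\<Sum>k\<in>?S. F (Inl k)) + (\<Sum>k\<in>?S. \<Sum>p<dM. \<Sum>q<dM. F (Inr (k, p, q)))"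
    for F :: "_ \<Rightarrow> complex"
    unfolding KE_def Q_def by (subst sum.Plus) (simp_all add: sum.cartesian_product')
  have idx: "(m * dL + (n * dB + b)) div dL = m" "(m * dL + (n * dB + b)) mod dL = n * dB + b"
    "(n * dB + b) div dB = n" "(n * dB + b) mod dB = b" if "n < dM" "b < dB" for m n b
  proof -
    have "n * dB + b < dL" unfolding dL_def by (rule pair_index_less[OF that])
    then show "(m * dL + (n * dB + b)) div dL = m" "(m * dL + (n * dB + b)) mod dL = n * dB + b" by simp_all
    show "(n * dB + b) div dB = n" "(n * dB + b) mod dB = b" using that by simp_all
  qed
  have VE1: "VE (Inl k) a (m * dL + (n * dB + b)) = (if m = n then c * cnj (u1 k (a, b)) else 0)"
    and VE2: "VE (Inr (k, p, q)) a (m * dL + (n * dB + b)) = compl_ent dM p q m n * cnj (u2 k (a, b))"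
    and VD1: "VD d (m * dL + (n * dB + b)) x = (if m = n \<and> b = x then c else 0)"
    if "n < dM" "b < dB" for k p q a m n b d x
    unfolding VE_def VD_def idx[OF that] by simp_all
  \<comment> \<open>The projectors of success and failure add up to the identity on M M', so the
    terms 1/dM in \<open>s1\<close> and \<open>s2\<close> cancel.\<close>
  have cE: "(\<Sum>e\<in>KE. \<Sum>a<dA. VE e a i * cnj (VE e a j)) = (if i = j then 1 else 0)"
    if ij: "i < dM * dL" "j < dM * dL" for i j
  proof -
    obtain m l where m: "m < dM" "l < dL" "i = m * dL + l" using ij(1) by (rule pair_index_cases)
    obtain n b where l: "n < dM" "b < dB" "l = n * dB + b" using m(2) unfolding dL_def by (rule pair_index_cases)
    obtain m' l' where m': "m' < dM" "l' < dL" "j = m' * dL + l'" using ij(2) by (rule pair_index_cases)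
    obtain n' b' where l': "n' < dM" "b' < dB" "l' = n' * dB + b'" using m'(2) unfolding dL_def by (rule pair_index_cases)
    have c1: "(\<Sum>k\<in>?S. \<Sum>a<dA. cnj (u1 k (a, b)) * u1 k (a, b')) = (if b = b' then 1 else 0)"
      by (rule channel_kernel_gram_complete[OF X1]) (use l l' u1 in auto)
    have c2: "(\<Sum>k\<in>?S. \<Sum>a<dA. cnj (u2 k (a, b)) * u2 k (a, b')) = (if b = b' then 1 else 0)"
      by (rule channel_kernel_gram_complete[OF X2]) (use l l' u2 in auto)
    have s1: "(\<Sum>k\<in>?S. \<Sum>a<dA. VE (Inl k) a i * cnj (VE (Inl k) a j))
        = (if m = n \<and> m' = n' then 1 / of_nat dM else 0) * (if b = b' then 1 else 0)"
    proof -
      have "VE (Inl k) a i * cnj (VE (Inl k) a j)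
          = (if m = n \<and> m' = n' then 1 / of_nat dM else 0) * (cnj (u1 k (a, b)) * u1 k (a, b'))" for k a
      proof -
        have "c * x * (c * y) = 1 / of_nat dM * (x * y)" for x y :: complex
          unfolding cc(1)[symmetric] by (simp add: mult_ac)
        then show ?thesis unfolding m(3) m'(3) l(3) l'(3) VE1[OF l(1,2)] VE1[OF l'(1,2)] by (simp add: cc(2))
      qed
      then show ?thesis by (simp only: sum_distrib_left[symmetric] c1)
    qed
    have s2: "(\<Sum>k\<in>?S. \<Sum>p<dM. \<Sum>q<dM. \<Sum>a<dA. VE (Inr (k, p, q)) a i * cnj (VE (Inr (k, p, q)) a j))
        = ((if m = m' \<and> n = n' then 1 else 0) - (if m = n \<and> m' = n' then 1 / of_nat dM else 0)) * (if b = b' then 1 else 0)"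
      (is "?L = _")
    proof -
      have "VE (Inr (k, p, q)) a i * cnj (VE (Inr (k, p, q)) a j)
          = (compl_ent dM p q m n * compl_ent dM p q m' n') * (cnj (u2 k (a, b)) * u2 k (a, b'))" for k p q a
        unfolding m(3) m'(3) l(3) l'(3) VE2[OF l(1,2)] VE2[OF l'(1,2)] by (simp add: compl_ent_cnj mult_ac)
      then have "?L = (\<Sum>k\<in>?S. \<Sum>p<dM. \<Sum>q<dM. (compl_ent dM p q m n * compl_ent dM p q m' n') * (\<Sum>a<dA. cnj (u2 k (a, b)) * u2 k (a, b')))"
        by (simp only: sum_distrib_left)
      also have "\<dots> = (\<Sum>p<dM. \<Sum>q<dM. compl_ent dM p q m n * compl_ent dM p q m' n') *
          (\<Sum>k\<in>?S. \<Sum>a<dA. cnj (u2 k (a, b)) * u2 k (a, b'))"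
        by (simp only: sum_distrib_right[symmetric] sum_distrib_left[symmetric])
      finally show ?thesis unfolding c2 compl_ent_idem[OF m(1) l(1) m'(1) l'(1)] .
    qed
    have "(i = j) = (m = m' \<and> n = n' \<and> b = b')"
      using m m' l l' idx[OF l(1,2)] idx[OF l'(1,2)] by metis
    then show ?thesis unfolding sumKE s1 s2 by auto
  qed
  have cD: "(\<Sum>d\<in>{()}. \<Sum>i<dM * dL. VD d i x * cnj (VD d i y)) = (if x = y then 1 else 0)"
    if xy: "x < dB" "y < dB" for x y
  proof -
    have "(\<Sum>d\<in>{()}. \<Sum>i<dM * dL. VD d i x * cnj (VD d i y))
        = (\<Sum>m<dM. \<Sum>n<dM. \<Sum>b<dB. VD () (m * dL + (n * dB + b)) x * cnj (VD () (m * dL + (n * dB + b)) y))"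
      by (simp add: sum_lessThan_mult[of _ dM dL]) (simp add: dL_def sum_lessThan_mult)
    also have "\<dots> = (\<Sum>m<dM. \<Sum>n<dM. \<Sum>b<dB. if b = x then (if n = m then (if x = y then 1 / of_nat dM else 0) else 0) else 0)"
      by (intro sum.cong refl) (auto simp: VD1 cc)
    also have "\<dots> = (if x = y then 1 else 0)" using xy dims by simp
    finally show ?thesis .
  qed
  define E where "E = kraus KE VE (dM * dL) dA"
  define D where "D = kraus {()} VD dB (dM * dL)"
  have chE: "channel (dM * dL) dA E" unfolding E_def by (rule channel_kraus[OF finKE cE])
  have chD: "channel dB (dM * dL) D" unfolding D_def by (rule channel_kraus[OF _ cD]) simp
  interpret kraus_strategy dA dB dM dL N E D KE VE "{()}" VD
    by unfold_locales (use dims N in \<open>auto simp: E_def D_def linear_op_map_kraus\<close>)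
  \<comment> \<open>The pair created by the decoder forces n = f: the output message index reappears
    as the M' index in the test of the encoder.\<close>
  have eff_eq: "\<theta> (e, ()) f m (a, x) = c * cnj (VE e a (m * dL + (f * dB + x)))" if "f < dM" "x < dB" for e f m a x
  proof -
    have "(\<Sum>l<dL. VE e a (m * dL + l) * VD () (f * dL + l) x)
        = (\<Sum>n<dM. \<Sum>b<dB. VE e a (m * dL + (n * dB + b)) * VD () (f * dL + (n * dB + b)) x)"
      unfolding dL_def sum_lessThan_mult ..
    also have "\<dots> = (\<Sum>n<dM. \<Sum>b<dB. if b = x then (if n = f then c * VE e a (m * dL + (f * dB + x)) else 0) else 0)"
      by (intro sum.cong refl) (auto simp: VD1)
    also have "\<dots> = c * VE e a (m * dL + (f * dB + x))" using that by simp
    finally show ?thesis by (simp add: eff_def cc)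
  qed
  \<comment> \<open>Success contributes p1 / dM^2 to the identity part. Failure carries p2 / dM
    times the complement of the entangled projector, that is p2 / dM for the depolarising part and
    -p2 / dM^2 for the identity part.\<close>
  define \<alpha> where "\<alpha> = (p1 - p2) / (real dM)\<^sup>2"
  define \<beta> where "\<beta> = p2 / real dM"
  have key: "isotropic \<alpha> \<beta>"
    unfolding isotropic_def
  proof (intro allI impI)
    fix f g m m' assume f: "f < dM" and g: "g < dM" and m: "m < dM" and m': "m' < dM"
    let ?\<delta> = "if m = f \<and> m' = g then 1 / (of_nat dM)\<^sup>2 else 0 :: complex"
    have t1: "bform AB J (\<theta> (Inl k, ()) f m) (\<theta> (Inl k, ()) g m')
        = ?\<delta> * qform ?S ?J (u1 k)" for k
    proof -
      have e: "\<theta> (Inl k, ()) f m x = (if m = f then 1 / of_nat dM else 0) * u1 k x" if xf: "x \<in> AB" "f < dM" for x f m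
      proof -
        obtain a b where x: "x = (a, b)" "b < dB" using xf(1) by (auto simp: AB_def)
        have "c * (c * y) = 1 / of_nat dM * y" for y :: complex unfolding cc(1)[symmetric] by (simp add: mult_ac)
        then show ?thesis unfolding x(1) eff_eq[OF xf(2) x(2)] VE1[OF xf(2) x(2)] by (simp add: cc(2))
      qed
      have "bform AB J (\<theta> (Inl k, ()) f m) (\<theta> (Inl k, ()) g m')
          = bform AB J (\<lambda>x. (if m = f then 1 / of_nat dM else 0) * u1 k x) (\<lambda>x. (if m' = g then 1 / of_nat dM else 0) * u1 k x)"
        by (rule bform_cong) (use e f g in auto)
      then show ?thesis unfolding bform_scale qform_bform AB_def J_def by (simp add: power2_eq_square)
    qed
    have t2: "bform AB J (\<theta> (Inr (k, p, q), ()) f m) (\<theta> (Inr (k, p, q), ()) g m')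
        = 1 / of_nat dM * (compl_ent dM p q m f * compl_ent dM p q m' g) * qform ?S ?J (u2 k)" for k p q
    proof -
      have e: "\<theta> (Inr (k, p, q), ()) f m x = (c * compl_ent dM p q m f) * u2 k x" if xf: "x \<in> AB" "f < dM" for x f m
      proof -
        obtain a b where x: "x = (a, b)" "b < dB" using xf(1) by (auto simp: AB_def)
        show ?thesis unfolding x(1) eff_eq[OF xf(2) x(2)] VE2[OF xf(2) x(2)] by (simp add: compl_ent_cnj)
      qed
      have "bform AB J (\<theta> (Inr (k, p, q), ()) f m) (\<theta> (Inr (k, p, q), ()) g m')
          = bform AB J (\<lambda>x. (c * compl_ent dM p q m f) * u2 k x) (\<lambda>x. (c * compl_ent dM p q m' g) * u2 k x)"
        by (rule bform_cong) (use e f g in auto)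
      then show ?thesis
        unfolding bform_scale qform_bform AB_def J_def cc(1)[symmetric]
        by (simp add: compl_ent_cnj cc(2) mult_ac)
    qed
    have "(\<Sum>k\<in>KE \<times> {()}. bform AB J (\<theta> k f m) (\<theta> k g m'))
        = (\<Sum>e\<in>KE. bform AB J (\<theta> (e, ()) f m) (\<theta> (e, ()) g m'))"
      by (simp add: sum.cartesian_product')
    also have "\<dots> = (\<Sum>k\<in>?S. ?\<delta> * qform ?S ?J (u1 k))
        + (\<Sum>k\<in>?S. \<Sum>p<dM. \<Sum>q<dM. 1 / of_nat dM * (compl_ent dM p q m f * compl_ent dM p q m' g) * qform ?S ?J (u2 k))"
      unfolding sumKE t1 t2 ..
    also have "(\<Sum>k\<in>?S. ?\<delta> * qform ?S ?J (u1 k))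
        = ?\<delta> * complex_of_real p1"
      unfolding sum_distrib_left[symmetric] q1 ..
    also have "(\<Sum>k\<in>?S. \<Sum>p<dM. \<Sum>q<dM. 1 / of_nat dM * (compl_ent dM p q m f * compl_ent dM p q m' g) * qform ?S ?J (u2 k))
        = 1 / of_nat dM * (\<Sum>p<dM. \<Sum>q<dM. compl_ent dM p q m f * compl_ent dM p q m' g) * complex_of_real p2"
      unfolding sum_distrib_right[symmetric] sum_distrib_left[symmetric] q2 ..
    also have "?\<delta> * complex_of_real p1
        + 1 / of_nat dM * (\<Sum>p<dM. \<Sum>q<dM. compl_ent dM p q m f * compl_ent dM p q m' g) * complex_of_real p2
        = (if m = f \<and> m' = g then complex_of_real \<alpha> else 0) + (if m = m' \<and> f = g then complex_of_real \<beta> else 0)"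
      unfolding compl_ent_idem[OF m f m' g] using dims(3)
      by (simp add: \<alpha>_def \<beta>_def field_simps power2_eq_square)
    finally show "(\<Sum>k\<in>KE \<times> {()}. bform AB J (\<theta> k f m) (\<theta> k g m'))
      = (if m = f \<and> m' = g then complex_of_real \<alpha> else 0) + (if m = m' \<and> f = g then complex_of_real \<beta> else 0)" .
  qed
  have r1: "1 \<le> (real dM)\<^sup>2" using dims(3) by simp
  have \<alpha>\<beta>: "\<alpha> + real dM * \<beta> = (p1 + p2 * ((real dM)\<^sup>2 - 1)) / (real dM)\<^sup>2" "\<alpha> + \<beta> / real dM = p1 / (real dM)\<^sup>2"
    using dims(3) by (simp_all add: \<alpha>_def \<beta>_def field_simps power2_eq_square)
  have "\<beta> \<ge> 0" using \<open>p2 \<ge> 0\<close> by (simp add: \<beta>_def)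
  moreover have "\<alpha> + real dM * \<beta> > 0"
    unfolding \<alpha>\<beta> using \<open>p1 > 0\<close> \<open>p2 \<ge> 0\<close> r1 dims(3) by (intro divide_pos_pos add_pos_nonneg) auto
  moreover have "(1 - \<epsilon>) * (\<alpha> + real dM * \<beta>) \<le> \<alpha> + \<beta> / real dM"
  proof -
    have "(1 - \<epsilon>) * (p1 + p2 * ((real dM)\<^sup>2 - 1)) \<le> p1" using le by (simp add: algebra_simps)
    then show ?thesis unfolding \<alpha>\<beta> by (simp add: divide_right_mono)
  qed
  ultimately show ?thesis
    using isotropic_infidelity[OF key _ _ _ chE chD] dL by blast
qed

subsection \<open>Dual solutions and the capacity formula\<close>

text \<open>The form of 1_A (x) T; it links the sums over slices in the duality lemmas to operators
  on A x B.\<close>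

lemma qform_block_diagonal:
  fixes T :: "'b \<Rightarrow> 'b \<Rightarrow> complex"
  assumes "finite A"
  shows "qform (A \<times> B) (\<lambda>p q. if fst p = fst q then T (snd p) (snd q) else 0) l
    = (\<Sum>a\<in>A. qform B T (\<lambda>b. l (a, b)))"
proof -
  have "qform (A \<times> B) (\<lambda>p q. if fst p = fst q then T (snd p) (snd q) else 0) l
      = (\<Sum>a\<in>A. \<Sum>b\<in>B. \<Sum>a'\<in>A. if a' = a then (\<Sum>b'\<in>B. cnj (l (a, b)) * T b b' * l (a, b')) else 0)"
    unfolding qform_def sum.cartesian_product' fst_conv snd_conv
  proof (intro sum.cong refl)
    fix a b a'
    show "(\<Sum>b'\<in>B. cnj (l (a, b)) * (if a = a' then T b b' else 0) * l (a', b'))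
        = (if a' = a then \<Sum>b'\<in>B. cnj (l (a, b)) * T b b' * l (a, b') else 0)"
      by (cases "a = a'") simp_all
  qed
  also have "\<dots> = (\<Sum>a\<in>A. qform B T (\<lambda>b. l (a, b)))"
    unfolding qform_def
    by (rule sum.cong[OF refl], rule sum.cong[OF refl]) (use assms in simp)
  finally show ?thesis .
qed

lemma pair_kernel_kron:
  assumes "x \<in> {..<dA} \<times> {..<dB}" "y \<in> {..<dA} \<times> {..<dB}"
  shows "pair_kernel dB (kron (max_mixed dA) (mat dB dB (\<lambda>(b, b'). T b b'))) x y
    = (1 / of_nat dA) * (if fst x = fst y then T (snd x) (snd y) else 0)"
  using pair_kernel_kron_max_mixed[of "mat dB dB (\<lambda>(b, b'). T b b')" dB x dA y] assms
  by (auto simp: prod_kernel_def)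

lemma trace_kron_max_mixed:
  assumes "dA \<ge> 1" "\<sigma> \<in> carrier_mat dB dB"
  shows "mtrace (kron (max_mixed dA) \<sigma>) = mtrace \<sigma>"
proof -
  have mm: "max_mixed dA \<in> carrier_mat dA dA" by (simp add: max_mixed_def)
  have "mtrace (kron (max_mixed dA) \<sigma>)
      = (\<Sum>a<dA. \<Sum>b<dB. kron (max_mixed dA) \<sigma> $$ (a * dB + b, a * dB + b))"
    using kron_carrier[OF mm assms(2)] by (simp add: mtrace_def sum_lessThan_mult)
  also have "\<dots> = (\<Sum>a<dA. \<Sum>b<dB. 1 / of_nat dA * \<sigma> $$ (b, b))"
    by (intro sum.cong refl) (simp add: kron_index[OF mm assms(2)], simp add: max_mixed_def)
  also have "\<dots> = mtrace \<sigma>" using assms by (simp add: mtrace_def sum_divide_distrib[symmetric])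
  finally show ?thesis .
qed

lemma mtrace_smult:
  assumes "X \<in> carrier_mat n n"
  shows "mtrace (c \<cdot>\<^sub>m X) = c * mtrace X"
  using assms by (simp add: mtrace_def sum_distrib_left)

lemma loewner_trace_le:
  assumes "loewner_le n X Y"
  shows "Re (mtrace X) \<le> Re (mtrace Y)"
proof -
  have c: "X \<in> carrier_mat n n" "Y \<in> carrier_mat n n" and p: "psd n (Y - X)"
    using assms unfolding loewner_le_def by auto
  have "mtrace (Y - X) = mtrace Y - mtrace X" using c by (simp add: mtrace_def sum_subtractf)
  then show ?thesis using mtrace_psd_real(2)[OF p] by simp
qed

text \<open>A positive operator of trace zero has only zero Gram vectors, and a vanishing Choi
  operator forces N = 0 by expansion in matrix units. The positive trace is what keeps the feasible
  values of both programs away from 0.\<close>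

lemma trace_choi_pos:
  assumes N: "cp_map dA dB N" and "dA \<ge> 1" and nz: "\<exists>X \<in> carrier_mat dA dA. N X \<noteq> 0\<^sub>m dB dB"
  shows "Re (mtrace (choi dA dB N)) > 0"
proof (rule ccontr)
  let ?C = "choi dA dB N"
  let ?n = "dA * dB"
  assume "\<not> Re (mtrace ?C) > 0"
  then have t0: "Re (mtrace ?C) = 0" using mtrace_psd_real(2)[OF psd_choi[OF N]] by simp
  have lin: "linear_op_map dA dB N" using N unfolding cp_map_def by blast
  have p: "psd_on {..<?n} (\<lambda>i j. ?C $$ (i, j))" using psd_choi[OF N] by (simp add: psd_iff)
  obtain u where u: "\<And>i j. i < ?n \<Longrightarrow> j < ?n \<Longrightarrow> ?C $$ (i, j) = (\<Sum>k<?n. u k i * cnj (u k j))"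
    using psd_on_obtain_gram[OF _ p] by auto
  have "Re (mtrace ?C) = (\<Sum>i<?n. \<Sum>k<?n. (cmod (u k i))\<^sup>2)"
  proof -
    have "mtrace ?C = (\<Sum>i<?n. \<Sum>k<?n. complex_of_real ((cmod (u k i))\<^sup>2))"
      using choi_carrier[of dA dB N] by (simp add: mtrace_def u complex_norm_square del: of_real_power)
    then show ?thesis by (simp del: of_real_power)
  qed
  then have "(\<Sum>i<?n. \<Sum>k<?n. (cmod (u k i))\<^sup>2) = 0" using t0 by simp
  then have u0: "u k i = 0" if "i < ?n" "k < ?n" for k i
    using that by (simp add: sum_nonneg_eq_0_iff sum_nonneg)
  have C0: "?C $$ (i, j) = 0" if "i < ?n" "j < ?n" for i j
    using u[OF that] u0 that by simp
  obtain X where X: "X \<in> carrier_mat dA dA" "N X \<noteq> 0\<^sub>m dB dB" using nz by blast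
  have "N X = 0\<^sub>m dB dB"
  proof (rule eq_matI)
    have "N X \<in> carrier_mat dB dB" using lin X unfolding linear_op_map_def by blast
    then show "dim_row (N X) = dim_row (0\<^sub>m dB dB)" "dim_col (N X) = dim_col (0\<^sub>m dB dB)" by auto
    fix i j assume "i < dim_row (0\<^sub>m dB dB)" "j < dim_col (0\<^sub>m dB dB)"
    then have ij: "i < dB" "j < dB" by auto
    have "N (munit dA p q) $$ (i, j) = 0" if pq: "p < dA" "q < dA" for p q
      using choi_index[OF lin pq ij] C0[OF pair_index_less[OF pq(1) ij(1)] pair_index_less[OF pq(2) ij(2)]] \<open>dA \<ge> 1\<close> by simp
    then show "N X $$ (i, j) = 0\<^sub>m dB dB $$ (i, j)"
      using linear_op_map_expand[OF lin X(1) ij] ij by simp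
  qed
  then show False using X by blast
qed

lemma hermitian_block_kernel:
  assumes "\<And>b b'. T b' b = cnj (T b b')"
  shows "mat_adjoint (mat d d (\<lambda>(b, b'). complex_of_real c * T b b')) = mat d d (\<lambda>(b, b'). complex_of_real c * T b b')"
proof -
  have "hermitian_op d (mat d d (\<lambda>(b, b'). complex_of_real c * T b b'))"
    unfolding hermitian_op_iff
  proof (intro conjI allI impI)
    fix i j assume "i < d" "j < d"
    moreover have "complex_of_real c * T j i = cnj (complex_of_real c * T i j)"
      by (subst assms[of j i]) simp
    ultimately show "mat d d (\<lambda>(b, b'). complex_of_real c * T b b') $$ (j, i)
        = cnj (mat d d (\<lambda>(b, b'). complex_of_real c * T b b') $$ (i, j))" by simp
  qed simp
  then show ?thesis unfolding hermitian_op_def by blast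
qed

text \<open>Comparison by real parts of forms matches the shape of the dual constraints. Symmetry of
  f and g is supplied separately, since the real part of a form does not see the anti-Hermitian
  part.\<close>

lemma loewner_le_pair_kernelI:
  assumes X: "X \<in> carrier_mat (n * m) (n * m)" and Y: "Y \<in> carrier_mat (n * m) (n * m)"
    and f: "\<And>x y. x \<in> {..<n} \<times> {..<m} \<Longrightarrow> y \<in> {..<n} \<times> {..<m} \<Longrightarrow> pair_kernel m X x y = f x y"
    and g: "\<And>x y. x \<in> {..<n} \<times> {..<m} \<Longrightarrow> y \<in> {..<n} \<times> {..<m} \<Longrightarrow> pair_kernel m Y x y = g x y"
    and herm: "\<And>x y. x \<in> {..<n} \<times> {..<m} \<Longrightarrow> y \<in> {..<n} \<times> {..<m} \<Longrightarrow> f y x = cnj (f x y)"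
      "\<And>x y. x \<in> {..<n} \<times> {..<m} \<Longrightarrow> y \<in> {..<n} \<times> {..<m} \<Longrightarrow> g y x = cnj (g x y)"
    and le: "\<And>l. Re (qform ({..<n} \<times> {..<m}) f l) \<le> Re (qform ({..<n} \<times> {..<m}) g l)"
  shows "loewner_le (n * m) X Y"
  unfolding loewner_le_def
proof (intro conjI X Y psd_pair_kernelI)
  show "Y - X \<in> carrier_mat (n * m) (n * m)" by (rule minus_carrier_mat[OF X])
  have d: "pair_kernel m (Y - X) x y = g x y - f x y" if "x \<in> {..<n} \<times> {..<m}" "y \<in> {..<n} \<times> {..<m}" for x y
    using f[OF that] g[OF that] that X Y by (auto simp: pair_kernel_def pair_index_less)
  fix a b a' b' assume "a < n" "b < m" "a' < n" "b' < m"
  then have m: "(a, b) \<in> {..<n} \<times> {..<m}" "(a', b') \<in> {..<n} \<times> {..<m}" by auto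
  have "pair_kernel m (Y - X) (a', b') (a, b) = cnj (pair_kernel m (Y - X) (a, b) (a', b'))"
    unfolding d[OF m] d[OF m(2,1)] herm(1)[OF m] herm(2)[OF m] by simp
  then show "(Y - X) $$ (a' * m + b', a * m + b) = cnj ((Y - X) $$ (a * m + b, a' * m + b'))"
    by (simp add: pair_kernel_def)
next
  fix l
  have "qform ({..<n} \<times> {..<m}) (pair_kernel m (Y - X)) l = qform ({..<n} \<times> {..<m}) (\<lambda>x y. g x y - f x y) l"
    by (rule qform_cong) (use f g X Y in \<open>auto simp: pair_kernel_def pair_index_less\<close>)
  also have "\<dots> = qform ({..<n} \<times> {..<m}) g l - qform ({..<n} \<times> {..<m}) f l"
    unfolding qform_def sum_subtractf[symmetric] by (intro sum.cong refl) (simp add: algebra_simps)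
  finally show "0 \<le> Re (qform ({..<n} \<times> {..<m}) (pair_kernel m (Y - X)) l)" using le[of l] by simp
qed

text \<open>The normalised operator T / p is the state; the value dA p contains dA because
  \<open>max_mixed\<close> is 1 / dA.\<close>

lemma dual_feasible_max:
  assumes dims: "dA \<ge> 1" "dB \<ge> 1" and N: "cp_map dA dB N"
    and T: "\<And>b b'. T b' b = cnj (T b b')" "(\<Sum>b<dB. T b b) = complex_of_real p" and "p > 0"
    and le: "\<And>l. Re (qform ({..<dA} \<times> {..<dB}) (pair_kernel dB (choi dA dB N)) l)
      \<le> (\<Sum>a<dA. Re (qform {..<dB} T (\<lambda>b. l (a, b))))"
  shows "\<exists>\<sigma>. state dB \<sigma> \<and>
    loewner_le (dA * dB) (choi dA dB N) (complex_of_real (real dA * p) \<cdot>\<^sub>m kron (max_mixed dA) \<sigma>)"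
proof -
  let ?S = "{..<dA} \<times> {..<dB}"
  let ?J = "pair_kernel dB (choi dA dB N)"
  have psdJ: "psd_on ?S ?J" by (rule psd_pair_kernel[OF psd_choi[OF N]])
  define \<sigma> where "\<sigma> = mat dB dB (\<lambda>(b, b'). complex_of_real (1 / p) * T b b')"
  have \<sigma>c: "\<sigma> \<in> carrier_mat dB dB" by (simp add: \<sigma>_def)
  have "mtrace \<sigma> = complex_of_real (1 / p) * (\<Sum>b<dB. T b b)"
    by (simp add: mtrace_def \<sigma>_def sum_distrib_left)
  then have tr: "mtrace \<sigma> = 1" unfolding T(2) using \<open>p > 0\<close> by simp
  have "psd_on {..<dB} (\<lambda>i j. \<sigma> $$ (i, j))"
    unfolding psd_on_def
  proof (intro conjI ballI allI)
    fix i j assume "i \<in> {..<dB}" "j \<in> {..<dB}"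
    then show "\<sigma> $$ (j, i) = cnj (\<sigma> $$ (i, j))"
      using hermitian_block_kernel[where T = T, OF T(1), of dB "1 / p"] \<sigma>c
      unfolding \<sigma>_def[symmetric] by (metis hermitian_op_def hermitian_op_iff lessThan_iff)
  next
    fix w :: "nat \<Rightarrow> complex"
    \<comment> \<open>For a vector supported on the slice a = 0 the dual constraint reads: T
      dominates a diagonal block of J, and that block is positive.\<close>
    let ?l = "\<lambda>x :: nat \<times> nat. if fst x = 0 then w (snd x) else 0"
    have "0 \<le> Re (qform ?S ?J ?l)" by (rule psd_on_Re_nonneg[OF psdJ])
    also have "\<dots> \<le> (\<Sum>a<dA. Re (qform {..<dB} T (\<lambda>b. ?l (a, b))))" by (rule le)
    also have "\<dots> = (\<Sum>a<dA. if a = 0 then Re (qform {..<dB} T w) else 0)"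
      by (rule sum.cong) (auto simp: qform_def)
    also have "\<dots> = Re (qform {..<dB} T w)" using dims by simp
    finally have "0 \<le> Re (qform {..<dB} T w)" .
    moreover have "qform {..<dB} (\<lambda>i j. \<sigma> $$ (i, j)) w = complex_of_real (1 / p) * qform {..<dB} T w"
      by (simp add: qform_def \<sigma>_def sum_distrib_left mult_ac)
    ultimately show "0 \<le> Re (qform {..<dB} (\<lambda>i j. \<sigma> $$ (i, j)) w)" using \<open>p > 0\<close> by simp
  qed
  then have st: "state dB \<sigma>" unfolding state_def psd_iff using \<sigma>c tr by blast
  have mm: "max_mixed dA \<in> carrier_mat dA dA" by (simp add: max_mixed_def)
  have kc: "kron (max_mixed dA) \<sigma> \<in> carrier_mat (dA * dB) (dA * dB)" by (rule kron_carrier[OF mm \<sigma>c])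
  have "loewner_le (dA * dB) (choi dA dB N) (complex_of_real (real dA * p) \<cdot>\<^sub>m kron (max_mixed dA) \<sigma>)"
  proof (rule loewner_le_pair_kernelI[where f = ?J and g = "\<lambda>x y. if fst x = fst y then T (snd x) (snd y) else 0"])
    fix x y assume xy: "x \<in> ?S" "y \<in> ?S"
    show "pair_kernel dB (complex_of_real (real dA * p) \<cdot>\<^sub>m kron (max_mixed dA) \<sigma>) x y
        = (if fst x = fst y then T (snd x) (snd y) else 0)"
    proof -
      have "pair_kernel dB (complex_of_real (real dA * p) \<cdot>\<^sub>m kron (max_mixed dA) \<sigma>) x y
          = complex_of_real (real dA * p) * pair_kernel dB (kron (max_mixed dA) \<sigma>) x y"
        using xy kc by (auto simp: pair_kernel_def pair_index_less)
      also have "\<dots> = complex_of_real (real dA * p) * (1 / of_nat dA * (if fst x = fst y then complex_of_real (1 / p) * T (snd x) (snd y) else 0))"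
        unfolding \<sigma>_def pair_kernel_kron[OF xy] ..
      finally show ?thesis using \<open>p > 0\<close> dims by simp
    qed
    show "?J y x = cnj (?J x y)" by (rule psd_on_herm[OF psdJ xy])
    show "(if fst y = fst x then T (snd y) (snd x) else 0) = cnj (if fst x = fst y then T (snd x) (snd y) else 0)"
      using T(1)[of "snd y" "snd x"] by simp
  next
    fix l show "Re (qform ?S ?J l) \<le> Re (qform ?S (\<lambda>x y. if fst x = fst y then T (snd x) (snd y) else 0) l)"
      using le[of l] by (simp add: qform_block_diagonal)
  qed (use kc choi_carrier in auto)
  then show ?thesis using st by blast
qed

text \<open>From 1_A (x) T <= J the operator T is only known to be Hermitian, so T / p is an affine
  state. The value is the reciprocal 1 / (dA p) because in the Doeblin information the factor stands
  on the side of the Choi operator.\<close>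

lemma dual_feasible_min:
  assumes dims: "dA \<ge> 1" "dB \<ge> 1" and N: "cp_map dA dB N"
    and T: "\<And>b b'. T b' b = cnj (T b b')" "(\<Sum>b<dB. T b b) = complex_of_real p" and "p > 0"
    and le: "\<And>l. (\<Sum>a<dA. Re (qform {..<dB} T (\<lambda>b. l (a, b))))
      \<le> Re (qform ({..<dA} \<times> {..<dB}) (pair_kernel dB (choi dA dB N)) l)"
  shows "\<exists>\<tau>. aff_state dB \<tau> \<and>
    loewner_le (dA * dB) (kron (max_mixed dA) \<tau>) (complex_of_real (1 / (real dA * p)) \<cdot>\<^sub>m choi dA dB N)"
proof -
  let ?S = "{..<dA} \<times> {..<dB}"
  let ?J = "pair_kernel dB (choi dA dB N)"
  let ?c = "complex_of_real (1 / (real dA * p))"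
  have psdJ: "psd_on ?S ?J" by (rule psd_pair_kernel[OF psd_choi[OF N]])
  define \<tau> where "\<tau> = mat dB dB (\<lambda>(b, b'). complex_of_real (1 / p) * T b b')"
  have \<tau>c: "\<tau> \<in> carrier_mat dB dB" by (simp add: \<tau>_def)
  have "mtrace \<tau> = complex_of_real (1 / p) * (\<Sum>b<dB. T b b)"
    by (simp add: mtrace_def \<tau>_def sum_distrib_left)
  then have tr: "mtrace \<tau> = 1" unfolding T(2) using \<open>p > 0\<close> by simp
  have st: "aff_state dB \<tau>"
    unfolding aff_state_def hermitian_op_def
    using hermitian_block_kernel[where T = T, OF T(1), of dB "1 / p"] \<tau>c tr unfolding \<tau>_def[symmetric] by blast
  have mm: "max_mixed dA \<in> carrier_mat dA dA" by (simp add: max_mixed_def)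
  have kc: "kron (max_mixed dA) \<tau> \<in> carrier_mat (dA * dB) (dA * dB)" by (rule kron_carrier[OF mm \<tau>c])
  have "loewner_le (dA * dB) (kron (max_mixed dA) \<tau>) (?c \<cdot>\<^sub>m choi dA dB N)"
  proof (rule loewner_le_pair_kernelI[where g = "\<lambda>x y. ?c * ?J x y" and f = "\<lambda>x y. ?c * (if fst x = fst y then T (snd x) (snd y) else 0)"])
    fix x y assume xy: "x \<in> ?S" "y \<in> ?S"
    show "pair_kernel dB (kron (max_mixed dA) \<tau>) x y = ?c * (if fst x = fst y then T (snd x) (snd y) else 0)"
      unfolding \<tau>_def pair_kernel_kron[OF xy] by simp
    show "pair_kernel dB (?c \<cdot>\<^sub>m choi dA dB N) x y = ?c * ?J x y"
      using xy choi_carrier[of dA dB N] by (auto simp: pair_kernel_def pair_index_less)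
    have "?J y x = cnj (?J x y)" by (rule psd_on_herm[OF psdJ xy])
    then show "?c * ?J y x = cnj (?c * ?J x y)" by simp
    show "?c * (if fst y = fst x then T (snd y) (snd x) else 0) = cnj (?c * (if fst x = fst y then T (snd x) (snd y) else 0))"
      using T(1)[of "snd y" "snd x"] by simp
  next
    fix l
    have s: "qform ?S (\<lambda>x y. ?c * f x y) l = ?c * qform ?S f l" for f
      by (simp add: qform_def sum_distrib_left mult_ac)
    have c0: "1 / (real dA * p) \<ge> 0" using \<open>p > 0\<close> by simp
    show "Re (qform ?S (\<lambda>x y. ?c * (if fst x = fst y then T (snd x) (snd y) else 0)) l) \<le> Re (qform ?S (\<lambda>x y. ?c * ?J x y) l)"
      unfolding s qform_block_diagonal[OF finite_lessThan] times_complex.sel Re_complex_of_real Im_complex_of_real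
      using mult_left_mono[OF le[of l] c0] by (simp add: Re_sum)
  qed (use kc choi_carrier in auto)
  then show ?thesis using st by blast
qed

lemma nat_le_floor_sqrt:
  assumes "(real n)\<^sup>2 \<le> y"
  shows "real n \<le> of_int \<lfloor>sqrt y\<rfloor>"
proof -
  have "real n \<le> sqrt y" by (rule real_le_rsqrt[OF assms])
  then have "int n \<le> \<lfloor>sqrt y\<rfloor>" by (simp add: le_floor_iff)
  then show ?thesis by linarith
qed

theorem theorem1:
  fixes N :: "complex mat \<Rightarrow> complex mat" and dA dB :: nat and \<epsilon> :: real
  assumes "dA \<ge> 1" and "dB \<ge> 1"
    and "cp_map dA dB N"
    and "\<exists>X \<in> carrier_mat dA dA. N X \<noteq> 0\<^sub>m dB dB"
    and "0 < \<epsilon>" and "\<epsilon> < 1"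
  shows "Q_retro \<epsilon> dA dB N =
    elog2 (efloor (esqrt (ereal (\<epsilon> / (1 - \<epsilon>)) * epow2 (I_max dA dB N + I_doe dA dB N) + 1)))"
proof -
  let ?S = "{..<dA} \<times> {..<dB}"
  let ?C = "choi dA dB N"
  let ?J = "pair_kernel dB ?C"
  let ?max = "\<lambda>l \<sigma>. state dB \<sigma> \<and> loewner_le (dA * dB) ?C (complex_of_real l \<cdot>\<^sub>m kron (max_mixed dA) \<sigma>)"
  let ?doe = "\<lambda>l \<tau>. aff_state dB \<tau> \<and> loewner_le (dA * dB) (kron (max_mixed dA) \<tau>) (complex_of_real l \<cdot>\<^sub>m ?C)"
  let ?i = "I_max dA dB N" and ?j = "I_doe dA dB N"
  define c where "c = \<epsilon> / (1 - \<epsilon>)"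
  have c: "c > 0" using assms(5,6) by (simp add: c_def)
  define R where "R = elog2 (efloor (esqrt (ereal c * epow2 (?i + ?j) + 1)))"
  define t where "t = Re (mtrace ?C)"
  have t: "t > 0" unfolding t_def by (rule trace_choi_pos[OF assms(3,1,4)])
  have psdJ: "psd_on ?S ?J" by (rule psd_pair_kernel[OF psd_choi[OF assms(3)]])
  have finS: "finite ?S" by simp
  have neA: "{..<dA} \<noteq> {}" using assms(1) by (auto simp: lessThan_empty_iff)

  \<comment> \<open>Taking traces bounds every feasible l away from 0. This bounds the informations
    from below and excludes the value -\<infinity> that \<open>elog2\<close> assigns to l <=
    0.\<close>
  have max_ge: "t \<le> l" if "?max l \<sigma>" for l \<sigma>
  proof -
    have \<sigma>: "\<sigma> \<in> carrier_mat dB dB" "mtrace \<sigma> = 1"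
      using that unfolding state_def psd_iff by auto
    have "kron (max_mixed dA) \<sigma> \<in> carrier_mat (dA * dB) (dA * dB)"
      by (rule kron_carrier[OF _ \<sigma>(1)]) (simp add: max_mixed_def)
    from mtrace_smult[OF this, of "complex_of_real l"]
    have "mtrace (complex_of_real l \<cdot>\<^sub>m kron (max_mixed dA) \<sigma>) = complex_of_real l"
      unfolding trace_kron_max_mixed[OF assms(1) \<sigma>(1)] \<sigma>(2) by simp
    with loewner_trace_le[of "dA * dB" ?C "complex_of_real l \<cdot>\<^sub>m kron (max_mixed dA) \<sigma>"] that
    show ?thesis by (simp add: t_def)
  qed
  have doe_ge: "1 / t \<le> l" if "?doe l \<tau>" for l \<tau>
  proof -
    have \<tau>: "\<tau> \<in> carrier_mat dB dB" "mtrace \<tau> = 1"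
      using that unfolding aff_state_def hermitian_op_def by auto
    have "mtrace (complex_of_real l \<cdot>\<^sub>m ?C) = complex_of_real l * mtrace ?C"
      by (rule mtrace_smult[OF choi_carrier])
    with loewner_trace_le[of "dA * dB" "kron (max_mixed dA) \<tau>" "complex_of_real l \<cdot>\<^sub>m ?C"] that
    have "1 \<le> l * t" by (simp add: t_def trace_kron_max_mixed[OF assms(1) \<tau>(1)] \<tau>(2))
    then show ?thesis using t by (simp add: field_simps)
  qed
  have doe_pos: "0 < l" if "?doe l \<tau>" for l \<tau>
    using doe_ge[OF that] t by (metis less_le_trans zero_less_divide_1_iff)
  have i_ge: "x \<le> ?i" if "\<And>l \<sigma>. ?max l \<sigma> \<Longrightarrow> x \<le> ereal (log 2 l)" for x
    unfolding I_max_def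
  proof (rule Inf_greatest)
    fix y assume "y \<in> {elog2 (ereal l) | l \<sigma>. ?max l \<sigma>}"
    then obtain l \<sigma> where y: "y = elog2 (ereal l)" "?max l \<sigma>" by blast
    have "l > 0" using max_ge[OF y(2)] t by simp
    then show "x \<le> y" using that[OF y(2)] by (simp add: y(1) elog2_def)
  qed
  have j_ge: "x \<le> ?j" if "\<And>l \<tau>. ?doe l \<tau> \<Longrightarrow> x \<le> ereal (log 2 l)" for x
    unfolding I_doe_def
  proof (rule Inf_greatest)
    fix y assume "y \<in> {elog2 (ereal l) | l \<tau>. ?doe l \<tau>}"
    then obtain l \<tau> where y: "y = elog2 (ereal l)" "?doe l \<tau>" by blast
    have "l > 0" by (rule doe_pos[OF y(2)])
    then show "x \<le> y" using that[OF y(2)] by (simp add: y(1) elog2_def)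
  qed

  obtain X1 T1 where X1: "channel_kernel {..<dA} {..<dB} X1" and T1: "\<And>b b'. T1 b' b = cnj (T1 b b')"
    and trT1: "(\<Sum>b<dB. T1 b b) = pairing ?S ?J X1"
    and T1le: "\<And>l. Re (qform ?S ?J l) \<le> (\<Sum>a<dA. Re (qform {..<dB} T1 (\<lambda>b. l (a, b))))"
    using channel_duality_max[OF finite_lessThan finite_lessThan neA psdJ] by blast
  obtain X2 T2 where X2: "channel_kernel {..<dA} {..<dB} X2" and T2: "\<And>b b'. T2 b' b = cnj (T2 b b')"
    and trT2: "(\<Sum>b<dB. T2 b b) = pairing ?S ?J X2"
    and T2le: "\<And>l. (\<Sum>a<dA. Re (qform {..<dB} T2 (\<lambda>b. l (a, b)))) \<le> Re (qform ?S ?J l)"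
    using channel_duality_min[OF finite_lessThan finite_lessThan neA psdJ] by blast
  define p1 where "p1 = Re (pairing ?S ?J X1)"
  define p2 where "p2 = Re (pairing ?S ?J X2)"
  have psdX: "psd_on ?S X1" "psd_on ?S X2" using X1 X2 unfolding channel_kernel_def by auto
  have p1: "pairing ?S ?J X1 = complex_of_real p1" and p2: "pairing ?S ?J X2 = complex_of_real p2" "p2 \<ge> 0"
    unfolding p1_def p2_def
    using pairing_nonneg(2)[OF finS psdJ psdX(1)] pairing_nonneg(2)[OF finS psdJ psdX(2)]
      pairing_nonneg(1)[OF finS psdJ psdX(2)] by blast+
  \<comment> \<open>At basis vectors the dual constraint compares the diagonals of J and T1; summed
    over a and b it reads t <= dA Tr T1 = dA p1.\<close>
  have p1_pos: "p1 > 0"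
  proof -
    have diag: "Re (?J (a, b) (a, b)) \<le> Re (T1 b b)" if ab: "a < dA" "b < dB" for a b
    proof -
      have "Re (?J (a, b) (a, b)) = Re (qform ?S ?J (\<lambda>x. if x = (a, b) then 1 else 0))"
        using ab by (subst qform_single) auto
      also have "\<dots> \<le> (\<Sum>a'<dA. Re (qform {..<dB} T1 (\<lambda>b'. if (a', b') = (a, b) then 1 else 0)))"
        by (rule T1le)
      also have "\<dots> = (\<Sum>a'<dA. if a' = a then Re (qform {..<dB} T1 (\<lambda>b'. if b' = b then 1 else 0)) else 0)"
        by (rule sum.cong) (auto simp: qform_def)
      also have "\<dots> = Re (T1 b b)" using ab by (simp add: qform_single)
      finally show ?thesis .
    qed
    have "t = (\<Sum>a<dA. \<Sum>b<dB. Re (?J (a, b) (a, b)))"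
      using choi_carrier[of dA dB N] by (simp add: t_def mtrace_def sum_lessThan_mult pair_kernel_def)
    also have "\<dots> \<le> (\<Sum>a<dA. \<Sum>b<dB. Re (T1 b b))"
      by (intro sum_mono diag) auto
    also have "\<dots> = real dA * p1"
      using trT1 by (simp add: p1_def Re_sum[symmetric] del: Re_sum)
    finally have "0 < real dA * p1" using t by simp
    then show ?thesis by (simp add: zero_less_mult_iff)
  qed
  have i_le: "?i \<le> ereal (log 2 (real dA * p1))"
  proof -
    obtain \<sigma> where "?max (real dA * p1) \<sigma>"
      using dual_feasible_max[OF assms(1-3) T1 _ p1_pos T1le] trT1 p1 by auto
    then have "elog2 (ereal (real dA * p1)) \<in> {elog2 (ereal l) | l \<sigma>. ?max l \<sigma>}" by blast
    then have "?i \<le> elog2 (ereal (real dA * p1))" unfolding I_max_def by (rule Inf_lower)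
    then show ?thesis using p1_pos assms(1) by (simp add: elog2_def split: if_splits)
  qed
  have "ereal (log 2 t) \<le> ?i"
  proof (rule i_ge)
    fix l \<sigma> assume "?max l \<sigma>"
    then show "ereal (log 2 t) \<le> ereal (log 2 l)"
      unfolding ereal_less_eq using t by (intro log_mono max_ge) auto
  qed
  then obtain a where a: "?i = ereal a" using i_le by (cases ?i) auto
  have j_ne: "?j \<noteq> -\<infinity>"
  proof -
    have "ereal (log 2 (1 / t)) \<le> ?j"
    proof (rule j_ge)
      fix l \<tau> assume "?doe l \<tau>"
      then have "1 / t \<le> l" by (rule doe_ge)
      moreover have "0 < 1 / t" using t by simp
      ultimately show "ereal (log 2 (1 / t)) \<le> ereal (log 2 l)"
        unfolding ereal_less_eq by (intro log_mono) auto
    qed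
    then show ?thesis by auto
  qed

  have R_inf: "R = \<infinity>" if "?j = \<infinity>"
    using that a c by (simp add: R_def epow2_def esqrt_def efloor_def elog2_def)
  have R_fin: "R = ereal (log 2 (of_int \<lfloor>sqrt (c * 2 powr (a + b) + 1)\<rfloor>))" if b: "?j = ereal b" for b
  proof -
    \<comment> \<open>The floor is at least 1, so \<open>elog2\<close> takes its logarithmic
      branch.\<close>
    have "1 \<le> sqrt (c * 2 powr (a + b) + 1)" using c by simp
    then have "\<lfloor>sqrt (c * 2 powr (a + b) + 1)\<rfloor> \<ge> 1" by (simp add: le_floor_iff)
    then have "\<not> real_of_int \<lfloor>sqrt (c * 2 powr (a + b) + 1)\<rfloor> \<le> 0" by linarith
    then show ?thesis
      by (simp add: R_def a b epow2_def esqrt_def efloor_def elog2_def one_ereal_def)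
  qed

  have upper: "ereal (log 2 (real dM)) \<le> R"
    if dM: "dM \<ge> 1" "dL \<ge> 1" and adm: "admissible_strategy dM dL dA dB E D N"
      and q: "q_infid dM dL dA dB E D N \<le> \<epsilon>" for dM dL E D
  proof (cases ?j)
    case (real b)
    have bound: "((real dM)\<^sup>2 - 1) / c \<le> l * m" if l: "?max l \<sigma>" and m: "?doe m \<tau>" for l \<sigma> m \<tau>
    proof -
      have "m > 0" by (rule doe_pos[OF m])
      have "(1 - \<epsilon>) * ((real dM)\<^sup>2 - 1) \<le> \<epsilon> * (l * m)"
        by (rule converse_bound[OF assms(1,2) dM assms(3) adm q assms(5,6)]) (use l m \<open>m > 0\<close> in auto)
      then show ?thesis using assms(5,6) by (simp add: c_def field_simps)
    qed
    have "(real dM)\<^sup>2 \<le> c * 2 powr (a + b) + 1"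
    \<comment> \<open>For dM = 1 the number K used below is 0 and its logarithm only a default
      value.\<close>
    proof (cases "dM = 1")
      case True
      then show ?thesis using c by simp
    next
      case False
      then have "dM \<ge> 2" using dM by simp
      then have "(2 :: real)\<^sup>2 \<le> (real dM)\<^sup>2" by (intro power_mono) auto
      define K where "K = ((real dM)\<^sup>2 - 1) / c"
      have K: "K > 0" using \<open>2\<^sup>2 \<le> (real dM)\<^sup>2\<close> c by (simp add: K_def)
      \<comment> \<open>The bound holds for each feasible pair of l and m. Logarithms turn the
        product into a sum; the infimum is taken over l with m fixed, then over m.\<close>
      have "ereal (log 2 K - a) \<le> ?j"
      proof (rule j_ge)
        fix m \<tau> assume m: "?doe m \<tau>"
        have m0: "m > 0" by (rule doe_pos[OF m])
        have "ereal (log 2 K - log 2 m) \<le> ?i"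
        proof (rule i_ge)
          fix l \<sigma> assume l: "?max l \<sigma>"
          have l0: "l > 0" using max_ge[OF l] t by simp
          have "log 2 K \<le> log 2 (l * m)" using bound[OF l m] K by (intro log_mono) (auto simp: K_def)
          also have "\<dots> = log 2 l + log 2 m" using l0 m0 by (simp add: log_mult)
          finally show "ereal (log 2 K - log 2 m) \<le> ereal (log 2 l)" by simp
        qed
        then show "ereal (log 2 K - a) \<le> ereal (log 2 m)" unfolding a by simp
      qed
      then have "log 2 K \<le> a + b" unfolding real by simp
      then have "K \<le> 2 powr (a + b)" using K by (simp add: log_le_iff)
      then show ?thesis using c by (simp add: K_def field_simps)
    qed
    then have "real dM \<le> of_int \<lfloor>sqrt (c * 2 powr (a + b) + 1)\<rfloor>" by (rule nat_le_floor_sqrt)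
    then show ?thesis unfolding R_fin[OF real] ereal_less_eq using dM by (intro log_mono) auto
  qed (use R_inf j_ne in auto)
  have Q_le: "Q_retro \<epsilon> dA dB N \<le> R"
    unfolding Q_retro_def by (rule Sup_least) (use upper in blast)

  have achieve: "ereal (log 2 (real dM)) \<le> Q_retro \<epsilon> dA dB N"
    if dM: "dM \<ge> 1" and le: "(1 - \<epsilon>) * (p2 * ((real dM)\<^sup>2 - 1)) \<le> \<epsilon> * p1" for dM
  proof -
    obtain dL E D where "dL \<ge> 1" "admissible_strategy dM dL dA dB E D N" "q_infid dM dL dA dB E D N \<le> \<epsilon>"
      using achievability[OF assms(1,2) dM assms(3) X1 X2 p1 p2(1) p1_pos p2(2) le] by blast
    then show ?thesis unfolding Q_retro_def using dM by (intro Sup_upper) blast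
  qed
  have "R \<le> Q_retro \<epsilon> dA dB N"
  \<comment> \<open>With p2 = 0 the failing branch has loop weight zero, so the strategy is perfect
    for every dM and the capacity is infinite.\<close>
  proof (cases "p2 = 0")
    case True
    have "ereal x \<le> Q_retro \<epsilon> dA dB N" for x
    proof -
      obtain n :: nat where n: "x < real n" using reals_Archimedean2 by blast
      have "ereal x \<le> ereal (log 2 (real (2 ^ n)))" using n by (simp add: log_nat_power)
      also have "\<dots> \<le> Q_retro \<epsilon> dA dB N"
        by (rule achieve) (use True assms(5) p1_pos in auto)
      finally show ?thesis .
    qed
    then have "Q_retro \<epsilon> dA dB N = \<infinity>" by (rule ereal_top)
    then show ?thesis by simp
  next
    case False
    then have p2_pos: "p2 > 0" using p2 by simp
    obtain \<tau> where "?doe (1 / (real dA * p2)) \<tau>"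
      using dual_feasible_min[OF assms(1-3) T2 _ p2_pos T2le] trT2 p2 by auto
    then have "elog2 (ereal (1 / (real dA * p2))) \<in> {elog2 (ereal l) | l \<tau>. ?doe l \<tau>}" by blast
    then have "?j \<le> elog2 (ereal (1 / (real dA * p2)))" unfolding I_doe_def by (rule Inf_lower)
    also have "\<dots> = ereal (log 2 (1 / (real dA * p2)))"
    proof -
      have "1 / (real dA * p2) > 0" using p2_pos assms(1) by simp
      then show ?thesis by (simp only: elog2_def ereal.case) simp
    qed
    finally have j_le: "?j \<le> ereal (log 2 (1 / (real dA * p2)))" .
    then obtain b where b: "?j = ereal b" using j_ne by (cases ?j) auto
    \<comment> \<open>The factors dA of the two dual values cancel in the product, which leaves p1 /
      p2.\<close>
    have "a + b \<le> log 2 (real dA * p1) + log 2 (1 / (real dA * p2))"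
      using i_le j_le unfolding a b by simp
    also have "\<dots> = log 2 (real dA * p1 * (1 / (real dA * p2)))"
      using p1_pos p2_pos assms(1) by (subst log_mult) auto
    also have "real dA * p1 * (1 / (real dA * p2)) = p1 / p2" using assms(1) by simp
    finally have "2 powr (a + b) \<le> p1 / p2"
      using p1_pos p2_pos by (simp add: le_log_iff)
    define s where "s = c * 2 powr (a + b) + 1"
    have s: "s \<ge> 1" using c by (simp add: s_def)
    \<comment> \<open>The message dimension that the formula predicts; d^2 - 1 <= c p1 / p2 is the
      hypothesis of \<open>achieve\<close> after division.\<close>
    define d where "d = nat \<lfloor>sqrt s\<rfloor>"
    have fl: "\<lfloor>sqrt s\<rfloor> \<ge> 1" using s by (simp add: le_floor_iff)
    have d: "d \<ge> 1" "real d = of_int \<lfloor>sqrt s\<rfloor>"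
      unfolding d_def using fl by linarith+
    have "real d \<le> sqrt s" unfolding d by simp
    then have "(real d)\<^sup>2 \<le> (sqrt s)\<^sup>2" by (intro power_mono) auto
    then have "(real d)\<^sup>2 - 1 \<le> c * 2 powr (a + b)" using s by (simp add: s_def)
    also have "\<dots> \<le> c * (p1 / p2)" using \<open>2 powr (a + b) \<le> p1 / p2\<close> c by (intro mult_left_mono) auto
    finally have "(1 - \<epsilon>) * (p2 * ((real d)\<^sup>2 - 1)) \<le> (1 - \<epsilon>) * (p2 * (c * (p1 / p2)))"
      using assms(6) p2_pos by (intro mult_left_mono) auto
    also have "\<dots> = \<epsilon> * p1" using assms(6) p2_pos by (simp add: c_def)
    finally have "ereal (log 2 (real d)) \<le> Q_retro \<epsilon> dA dB N" by (rule achieve[OF d(1)])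
    then show ?thesis unfolding R_fin[OF b] d(2) s_def .
  qed
  with Q_le show ?thesis unfolding R_def c_def by (rule antisym)
qed

end
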